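(* Let $X$ be a finite set with $|X|\ge 2$, let $M$ be a non-empty set and $\odot\notin M$, and let $d:\binom{X}{2}\to M\cup\{\odot\}$ be a symbolic map. Then $d$ is a symbolic arboreal map if and only if all four of the following properties hold: (A1) the graph $G_d$ is connected and Ptolemaic; (A2) no three pairwise distinct elements of $X$ are in $\Delta$-relation under $d$; (A3) no four pairwise distinct elements of $X$ are in $\Pi$-relation under $d$; (A4) whenever $x,y,z,u\in X$ are pairwise distinct with $d(z,u)=\odot$ and $d$ maps every other element of $\binom{\{x,y,z,u\}}{2}$ to an element of $M$, then $d(x,z)=d(y,z)$ and $d(x,u)=d(y,u)$.
   Context: A symbolic map is a function $d:\binom{X}{2}\to M\cup\{\odot\}$; write $d(x,y)$ for $d(\{x,y\})$. $G_d$ is the graph with vertex set $X$ in which distinct $x,y$ are adjacent iff $d(x,y)\neq\odot$. A graph is Ptolemaic if its shortest-path distance $d^*$ satisfies $d^*(x,y)d^*(z,u)+d^*(x,u)d^*(y,z)\ge d^*(x,z)d^*(y,u)$ for all vertices $x,y,z,u$. Three pairwise distinct $x,y,z$ are in $\Delta$-relation under $d$ if $|\{d(x,y),d(x,z),d(y,z)\}|=3$ and $\odot\notin\{d(x,y),d(x,z),d(y,z)\}$. Four pairwise distinct $x,y,z,u$ are in $\Pi$-relation under $d$ if, up to permuting $x,y,z,u$, $d(x,y)=d(y,z)=d(z,u)\neq d(z,x)=d(x,u)=d(u,y)$ and $\odot\notin\{d(x,y),d(x,z)\}$. In a digraph, a leaf is a vertex of indegree 1 and outdegree 0, a root is a vertex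 of indegree 0. A network on $X$ is a simple acyclic digraph $N$ whose underlying undirected graph is connected, whose set of leaves is $X$, in which every vertex of indegree 0 has outdegree at least 2, every vertex of outdegree 0 has indegree 1, and no vertex has both indegree and outdegree equal to 1. $N$ is arboreal if its underlying undirected graph is a tree. A vertex $v$ is an ancestor of $w$ if there is a directed path (possibly of length 0) from $v$ to $w$; $x,y$ share an ancestor if some vertex is an ancestor of both. A least common ancestor of leaves $x,y$ is a vertex that is an ancestor of both and none of whose children is an ancestor of both; in an arboreal network it is unique whenever $x,y$ share an ancestor, and is denoted $\mathrm{lca}_N(x,y)$. A labelled arboreal network $(N,t)$ consists of an arboreal network $N$ on $X$ and a map $t$ from the set of vertices of $N$ of outdegree at least 2 to $M$. It induces $d_{(N,t)}$ with $d_{(N,t)}(x,y)=t(\mathrm{lca}_N(x,y))$ if $x,y$ share an ancestor in $N$ and $d_{(N,t)}(x,y)=\odot$ otherwise. $d$ is a symbolic arboreal map if $d=d_{(N,t)}$ for some labelled arboreal network $(N,t)$ on $X$. *)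

theory Defs
  imports Graph_Theory.Graph_Theory "HOL-Library.Ramsey"
begin

(* A symbolic map is a function d on the two-element subsets of X, so that d(x,y) is d {x,y}. *)

definition symbolic_graph :: "'a set \<Rightarrow> 'm \<Rightarrow> ('a set \<Rightarrow> 'm) \<Rightarrow> 'a pair_pre_digraph" where
  "symbolic_graph X odot d =
     \<lparr>pverts = X, parcs = {(x, y). x \<in> X \<and> y \<in> X \<and> x \<noteq> y \<and> d {x, y} \<noteq> odot}\<rparr>"

definition graph_dist :: "'v pair_pre_digraph \<Rightarrow> 'v \<Rightarrow> 'v \<Rightarrow> ereal" where
  "graph_dist G u v = wf_digraph.\<mu> (with_proj G) (\<lambda>_. 1) u v"

definition ptolemaic :: "'v pair_pre_digraph \<Rightarrow> bool" where
  "ptolemaic G \<longleftrightarrow>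
     (\<forall>x\<in>pverts G. \<forall>y\<in>pverts G. \<forall>z\<in>pverts G. \<forall>u\<in>pverts G.
        graph_dist G x y * graph_dist G z u + graph_dist G x u * graph_dist G y z
          \<ge> graph_dist G x z * graph_dist G y u)"

definition Delta_relation :: "'m \<Rightarrow> ('a set \<Rightarrow> 'm) \<Rightarrow> 'a \<Rightarrow> 'a \<Rightarrow> 'a \<Rightarrow> bool" where
  "Delta_relation odot d x y z \<longleftrightarrow>
     distinct [x, y, z] \<and>
     card {d {x, y}, d {x, z}, d {y, z}} = 3 \<and>
     odot \<notin> {d {x, y}, d {x, z}, d {y, z}}"

(* (a, b, c, e) ranges over the permutations of (x, y, z, u). *)
definition Pi_relation :: "'m \<Rightarrow> ('a set \<Rightarrow> 'm) \<Rightarrow> 'a \<Rightarrow> 'a \<Rightarrow> 'a \<Rightarrow> 'a \<Rightarrow> bool" where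
  "Pi_relation odot d x y z u \<longleftrightarrow>
     distinct [x, y, z, u] \<and>
     (\<exists>a b c e. {a, b, c, e} = {x, y, z, u} \<and>
        d {a, b} = d {b, c} \<and> d {b, c} = d {c, e} \<and>
        d {c, e} \<noteq> d {c, a} \<and>
        d {c, a} = d {a, e} \<and> d {a, e} = d {e, b} \<and>
        odot \<notin> {d {a, b}, d {a, c}})"

definition network_leaves :: "'v pair_pre_digraph \<Rightarrow> 'v set" where
  "network_leaves N = {v \<in> pverts N. in_degree N v = 1 \<and> out_degree N v = 0}"

(* Networks are finite; the locale predicate pair_digraph includes finiteness. *)
definition network :: "'v pair_pre_digraph \<Rightarrow> 'v set \<Rightarrow> bool" where
  "network N L \<longleftrightarrow>
     pair_digraph N \<and> acyclic (parcs N) \<and> Digraph_Component.connected N \<and>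
     network_leaves N = L \<and>
     (\<forall>v\<in>pverts N. in_degree N v = 0 \<longrightarrow> out_degree N v \<ge> 2) \<and>
     (\<forall>v\<in>pverts N. out_degree N v = 0 \<longrightarrow> in_degree N v = 1) \<and>
     (\<forall>v\<in>pverts N. \<not> (in_degree N v = 1 \<and> out_degree N v = 1))"

(* The library predicate tree only excludes directed cycles, and in a symmetric digraph
   every edge is a directed cycle of length 2; hence the bound on the length. *)
definition underlying_tree :: "'v pair_pre_digraph \<Rightarrow> bool" where
  "underlying_tree G \<longleftrightarrow>
     Digraph_Component.connected G \<and>
     \<not> (\<exists>p. pre_digraph.cycle (mk_symmetric G) p \<and> length p \<ge> 3)"

definition arboreal_network :: "'v pair_pre_digraph \<Rightarrow> 'v set \<Rightarrow> bool" where
  "arboreal_network N L \<longleftrightarrow> network N L \<and> underlying_tree N"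

definition ancestor :: "'v pair_pre_digraph \<Rightarrow> 'v \<Rightarrow> 'v \<Rightarrow> bool" where
  "ancestor N v w \<longleftrightarrow> reachable N v w"

definition share_ancestor :: "'v pair_pre_digraph \<Rightarrow> 'v \<Rightarrow> 'v \<Rightarrow> bool" where
  "share_ancestor N x y \<longleftrightarrow> (\<exists>v. ancestor N v x \<and> ancestor N v y)"

definition is_lca :: "'v pair_pre_digraph \<Rightarrow> 'v \<Rightarrow> 'v \<Rightarrow> 'v \<Rightarrow> bool" where
  "is_lca N x y v \<longleftrightarrow>
     ancestor N v x \<and> ancestor N v y \<and>
     (\<forall>c. (v, c) \<in> parcs N \<longrightarrow> \<not> (ancestor N c x \<and> ancestor N c y))"

definition lca :: "'v pair_pre_digraph \<Rightarrow> 'v \<Rightarrow> 'v \<Rightarrow> 'v" where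
  "lca N x y = (THE v. is_lca N x y v)"

definition labelled_arboreal_network ::
    "'v pair_pre_digraph \<Rightarrow> ('v \<Rightarrow> 'm) \<Rightarrow> 'v set \<Rightarrow> 'm set \<Rightarrow> bool" where
  "labelled_arboreal_network N t L M \<longleftrightarrow>
     arboreal_network N L \<and> (\<forall>v\<in>pverts N. out_degree N v \<ge> 2 \<longrightarrow> t v \<in> M)"

definition induced_map :: "'m \<Rightarrow> 'v pair_pre_digraph \<Rightarrow> ('v \<Rightarrow> 'm) \<Rightarrow> 'v \<Rightarrow> 'v \<Rightarrow> 'm" where
  "induced_map odot N t x y = (if share_ancestor N x y then t (lca N x y) else odot)"

(* The vertices that are not leaves must not compete with X for elements of 'a, which may be
   a finite type. So networks on X live in the type 'a + nat, where x \<in> X is the leaf Inl x.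
   Since networks are finite, this is no restriction: by symbolic_arboreal_mapI below, networks
   over any other vertex type yield the same maps (least common ancestors being unique). *)
definition symbolic_arboreal_map :: "'a set \<Rightarrow> 'm set \<Rightarrow> 'm \<Rightarrow> ('a set \<Rightarrow> 'm) \<Rightarrow> bool" where
  "symbolic_arboreal_map X M odot d \<longleftrightarrow>
     (\<exists>(N :: ('a + nat) pair_pre_digraph) t.
        labelled_arboreal_network N t (Inl ` X) M \<and>
        (\<forall>x\<in>X. \<forall>y\<in>X. x \<noteq> y \<longrightarrow> d {x, y} = induced_map odot N t (Inl x) (Inl y)))"


context
  fixes N :: "'v pair_pre_digraph" and h :: "'v \<Rightarrow> 'w"
  assumes pair_digraph_N: "pair_digraph N" and inj_h: "inj_on h (pverts N)"
begin

private definition N' :: "'w pair_pre_digraph" where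
  "N' = \<lparr>pverts = h ` pverts N, parcs = map_prod h h ` parcs N\<rparr>"

private definition hom :: "('v, 'v \<times> 'v, 'w, 'w \<times> 'w) digraph_isomorphism" where
  "hom = \<lparr>iso_verts = h, iso_arcs = map_prod h h, iso_head = snd, iso_tail = fst\<rparr>"

private abbreviation g :: "'w \<Rightarrow> 'v" where
  "g \<equiv> the_inv_into (pverts N) h"

interpretation N: pair_digraph N
  by (rule pair_digraph_N)

private lemma N'_app_iso: "with_proj N' = app_iso hom (with_proj N)"
  by (simp add: N'_def hom_def app_iso_def with_proj_def)

private lemma g_h: "v \<in> pverts N \<Longrightarrow> g (h v) = v"
  using inj_h by (rule the_inv_into_f_f)

private lemma inj_g: "inj_on g (pverts N')"
  using inj_on_the_inv_into[OF inj_h] by (simp add: N'_def)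

private lemma parcs_g: "(a, b) \<in> parcs N' \<Longrightarrow> (g a, g b) \<in> parcs N"
  by (auto simp: N'_def g_h N.wellformed')

private lemma parcs_h:
  assumes "u \<in> pverts N" and "v \<in> pverts N"
  shows "(h u, h v) \<in> parcs N' \<longleftrightarrow> (u, v) \<in> parcs N"
proof
  assume "(h u, h v) \<in> parcs N'"
  from parcs_g[OF this] show "(u, v) \<in> parcs N" using assms by (simp add: g_h)
qed (auto simp: N'_def)

private lemma hom: "pre_digraph.digraph_isomorphism (with_proj N) hom"
proof -
  have "inj_on (map_prod h h) (parcs N)"
    by (rule inj_on_subset[OF map_prod_inj_on[OF inj_h inj_h]]) (auto dest: N.wellformed')
  then show ?thesis
    using inj_h N.wf_digraph by (auto simp: pre_digraph.digraph_isomorphism_def hom_def)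
qed

private lemma pair_digraph_N': "pair_digraph N'"
proof unfold_locales
  fix e assume "e \<in> parcs N'"
  then obtain u v where e: "e = (h u, h v)" "(u, v) \<in> parcs N"
    by (auto simp: N'_def)
  then have "u \<in> pverts N" "v \<in> pverts N" "u \<noteq> v"
    by (auto dest: N.wellformed' N.no_loops')
  then show "fst e \<in> pverts N'" "snd e \<in> pverts N'" "fst e \<noteq> snd e"
    using e inj_h by (auto simp: N'_def inj_on_eq_iff)
qed (use N.pair_finite_verts N.pair_finite_arcs in \<open>auto simp: N'_def\<close>)

private lemma acyclic_N':
  assumes "acyclic (parcs N)"
  shows "acyclic (parcs N')"
proof -
  have "(g a, g b) \<in> (parcs N)\<^sup>+" if "(a, b) \<in> (parcs N')\<^sup>+" for a b
    using that by induction (auto dest: parcs_g intro: trancl_into_trancl)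
  then show ?thesis
    using assms by (auto simp: acyclic_def)
qed

private lemma degrees_N':
  assumes "v \<in> pverts N"
  shows "in_degree (with_proj N') (h v) = in_degree (with_proj N) v"
    and "out_degree (with_proj N') (h v) = out_degree (with_proj N) v"
  using N.in_degree_app_iso_eq[OF hom, of v] N.out_degree_app_iso_eq[OF hom, of v] assms
  by (simp_all add: N'_app_iso) (simp_all add: hom_def)

private lemma connected_N':
  assumes "Digraph_Component.connected (with_proj N)"
  shows "Digraph_Component.connected (with_proj N')"
  using N.connectedI_app_iso[OF assms hom] by (simp add: N'_app_iso)

private lemma underlying_tree_N':
  assumes "underlying_tree N"
  shows "underlying_tree N'"
proof -
  interpret N': pair_digraph N' by (rule pair_digraph_N')
  interpret S': pair_wf_digraph "mk_symmetric (with_proj N')"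
    by (rule N'.wellformed_mk_symmetric)
  have "\<exists>q. pre_digraph.cycle (with_proj (mk_symmetric (with_proj N))) q \<and> length q \<ge> 3"
    if p: "pre_digraph.cycle (with_proj (mk_symmetric (with_proj N'))) p" "length p \<ge> 3" for p
  proof -
    let ?q = "map (map_prod g g) p"
    obtain u where u: "S'.awalk u p u" "distinct (tl (pawalk_verts u p))"
      using p(1) by (auto simp: S'.cycle_def)
    have verts: "set (pawalk_verts u p) \<subseteq> pverts N'"
      using S'.awalk_conv[of u p u] u(1) by auto
    have pv: "pawalk_verts (g a) (map (map_prod g g) r) = map g (pawalk_verts a r)" for a r
      by (induction r arbitrary: a) auto
    have pc: "pcas a r b \<Longrightarrow> pcas (g a) (map (map_prod g g) r) (g b)" for a r b
      by (induction r arbitrary: a) auto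
    have arcs: "set ?q \<subseteq> parcs (mk_symmetric (with_proj N))"
    proof -
      have "set p \<subseteq> parcs (mk_symmetric (with_proj N'))"
        using u(1) by (simp add: S'.awalk_def)
      moreover have "map_prod g g e \<in> parcs (mk_symmetric (with_proj N))"
        if "e \<in> parcs (mk_symmetric (with_proj N'))" for e
      proof -
        obtain a b where e: "e = (a, b)" by (cases e)
        with that have "(a, b) \<in> parcs N' \<or> (b, a) \<in> parcs N'"
          by (auto simp: parcs_mk_symmetric)
        then have "(g a, g b) \<in> parcs N \<or> (g b, g a) \<in> parcs N"
          by (blast dest: parcs_g)
        then show ?thesis
          unfolding e parcs_mk_symmetric by (auto intro: bexI[rotated])
      qed
      ultimately show ?thesis
        by auto
    qed
    have "u \<in> pverts N'"
      using u(1) by (auto simp: S'.awalk_def)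
    then have "g u \<in> pverts N"
      by (auto simp: N'_def g_h)
    then have "pre_digraph.awalk (with_proj (mk_symmetric (with_proj N))) (g u) ?q (g u)"
      using arcs pc[of u p u] u(1)
      unfolding S'.awalk_def pre_digraph.awalk_def cas_with_proj_eq by simp
    moreover have "distinct (tl (pawalk_verts (g u) ?q))"
    proof -
      have "set (tl (pawalk_verts u p)) \<subseteq> pverts N'"
        using verts by (cases p) auto
      then have "inj_on g (set (tl (pawalk_verts u p)))"
        by (rule inj_on_subset[OF inj_g])
      then show ?thesis
        using u(2) by (simp add: pv map_tl[symmetric] distinct_map)
    qed
    ultimately show ?thesis
      using p(2) unfolding pre_digraph.cycle_def awalk_verts_with_proj_eq
      by (intro exI[of _ ?q]) auto
  qed
  then show ?thesis
    using assms connected_N' by (auto simp: underlying_tree_def)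
qed

private lemma network_N':
  assumes "network N L"
  shows "network N' (h ` L)"
proof -
  have "network_leaves N' = h ` network_leaves N"
  proof
    show "network_leaves N' \<subseteq> h ` network_leaves N"
    proof
      fix w assume w: "w \<in> network_leaves N'"
      then obtain v where "w = h v" "v \<in> pverts N"
        by (auto simp: network_leaves_def N'_def)
      with w show "w \<in> h ` network_leaves N"
        by (auto simp: network_leaves_def degrees_N')
    qed
    show "h ` network_leaves N \<subseteq> network_leaves N'"
      by (auto simp: network_leaves_def degrees_N') (auto simp: N'_def)
  qed
  moreover have "pverts N' = h ` pverts N"
    by (simp add: N'_def)
  ultimately show ?thesis
    using assms pair_digraph_N' acyclic_N' connected_N'
    by (auto simp: network_def degrees_N')
qed

private lemma ancestor_N':
  assumes "v \<in> pverts N" and "w \<in> pverts N"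
  shows "ancestor N' (h v) (h w) \<longleftrightarrow> ancestor N v w"
  using N.reachable_app_iso_eq[OF hom, of "h v" "h w"] assms
    N.iso_verts_inv_iso[OF hom, of v] N.iso_verts_inv_iso[OF hom, of w]
  by (simp add: ancestor_def N'_app_iso hom_def)

private lemma ancestor_in_verts: "ancestor N v w \<Longrightarrow> v \<in> pverts N"
  unfolding ancestor_def by (drule N.reachable_in_verts) simp

private lemma ancestor_in_verts': "ancestor N' a b \<Longrightarrow> a \<in> h ` pverts N"
proof -
  interpret N': pair_digraph N' by (rule pair_digraph_N')
  show "ancestor N' a b \<Longrightarrow> a \<in> h ` pverts N"
    unfolding ancestor_def by (drule N'.reachable_in_verts) (simp add: N'_def)
qed

private lemma share_ancestor_N':
  assumes "x \<in> pverts N" and "y \<in> pverts N"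
  shows "share_ancestor N' (h x) (h y) \<longleftrightarrow> share_ancestor N x y"
proof
  assume "share_ancestor N' (h x) (h y)"
  then obtain a where a: "ancestor N' a (h x)" "ancestor N' a (h y)"
    by (auto simp: share_ancestor_def)
  obtain v where v: "a = h v" "v \<in> pverts N"
    using ancestor_in_verts'[OF a(1)] by (rule imageE)
  show "share_ancestor N x y"
    unfolding share_ancestor_def
    by (rule exI[of _ v]) (use a v assms in \<open>simp add: ancestor_N'\<close>)
next
  assume "share_ancestor N x y"
  then obtain v where v: "ancestor N v x" "ancestor N v y"
    by (auto simp: share_ancestor_def)
  show "share_ancestor N' (h x) (h y)"
    unfolding share_ancestor_def
    by (rule exI[of _ "h v"]) (use v ancestor_in_verts[OF v(1)] assms in \<open>simp add: ancestor_N'\<close>)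
qed

private lemma is_lca_N':
  assumes "x \<in> pverts N" and "y \<in> pverts N" and "v \<in> pverts N"
  shows "is_lca N' (h x) (h y) (h v) \<longleftrightarrow> is_lca N x y v"
proof -
  have children: "(h v, c) \<in> parcs N' \<longleftrightarrow> (\<exists>w. c = h w \<and> (v, w) \<in> parcs N)" for c
  proof
    assume c: "(h v, c) \<in> parcs N'"
    then obtain w where w: "c = h w" "w \<in> pverts N"
      by (auto simp: N'_def dest: N.wellformed')
    then show "\<exists>w. c = h w \<and> (v, w) \<in> parcs N"
      using c parcs_h[OF assms(3) w(2)] by (intro exI[of _ w]) simp
  qed (auto simp: N'_def)
  have "ancestor N' (h w) (h z) \<longleftrightarrow> ancestor N w z"
    if "(v, w) \<in> parcs N" "z \<in> pverts N" for w z
    using N.in_arcsD2[OF that(1)] that(2) by (rule ancestor_N')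
  then have "(\<forall>c. (h v, c) \<in> parcs N' \<longrightarrow> \<not> (ancestor N' c (h x) \<and> ancestor N' c (h y)))
    \<longleftrightarrow> (\<forall>c. (v, c) \<in> parcs N \<longrightarrow> \<not> (ancestor N c x \<and> ancestor N c y))"
    unfolding children using assms(1,2) by auto
  then show ?thesis
    using assms by (simp add: is_lca_def ancestor_N')
qed

lemma labelled_arboreal_network_transport:
  assumes lan: "labelled_arboreal_network N t L M"
    and unique: "\<forall>x\<in>L. \<forall>y\<in>L. x \<noteq> y \<longrightarrow> share_ancestor N x y \<longrightarrow> (\<exists>!v. is_lca N x y v)"
  shows "\<exists>N'' t''. labelled_arboreal_network N'' t'' (h ` L) M \<and>
    (\<forall>x\<in>L. \<forall>y\<in>L. x \<noteq> y \<longrightarrow>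
      induced_map odot N'' t'' (h x) (h y) = induced_map odot N t x y)"
proof (intro exI conjI ballI impI)
  have L: "L \<subseteq> pverts N"
    using lan by (auto simp: labelled_arboreal_network_def arboreal_network_def network_def
        network_leaves_def)
  show "labelled_arboreal_network N' (t \<circ> g) (h ` L) M"
    using lan network_N' underlying_tree_N'
    by (auto simp: labelled_arboreal_network_def arboreal_network_def)
       (auto simp: N'_def g_h degrees_N'[unfolded N'_def])
  show "induced_map odot N' (t \<circ> g) (h x) (h y) = induced_map odot N t x y"
    if xy: "x \<in> L" "y \<in> L" "x \<noteq> y" for x y
  proof (cases "share_ancestor N x y")
    case True
    have xyN: "x \<in> pverts N" "y \<in> pverts N"
      using L xy by auto
    obtain v where v: "is_lca N x y v" "\<And>w. is_lca N x y w \<Longrightarrow> w = v"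
      using unique xy True by blast
    have vN: "v \<in> pverts N"
      using v(1) by (auto simp: is_lca_def dest: ancestor_in_verts)
    have "lca N x y = v"
      unfolding lca_def using v by (rule the_equality)
    moreover have "lca N' (h x) (h y) = h v"
      unfolding lca_def
    proof (rule the_equality)
      show "is_lca N' (h x) (h y) (h v)"
        using v(1) by (simp add: is_lca_N' xyN vN)
      fix w assume w: "is_lca N' (h x) (h y) w"
      then obtain w0 where "w = h w0" "w0 \<in> pverts N"
        by (auto simp: is_lca_def dest!: ancestor_in_verts')
      then show "w = h v"
        using w v(2) by (simp add: is_lca_N' xyN)
    qed
    ultimately show ?thesis
      using True vN xyN by (simp add: induced_map_def share_ancestor_N' g_h)
  next
    case False
    then show ?thesis
      using L xy by (simp add: induced_map_def share_ancestor_N' subset_iff)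
  qed
qed

end

lemma symbolic_arboreal_mapI:
  fixes N :: "'v pair_pre_digraph" and f :: "'a \<Rightarrow> 'v"
  assumes inj: "inj_on f X"
    and lan: "labelled_arboreal_network N t (f ` X) M"
    and d: "\<And>x y. \<lbrakk>x \<in> X; y \<in> X; x \<noteq> y\<rbrakk> \<Longrightarrow> d {x, y} = induced_map odot N t (f x) (f y)"
    and unique: "\<And>x y. \<lbrakk>x \<in> X; y \<in> X; x \<noteq> y; share_ancestor N (f x) (f y)\<rbrakk>
      \<Longrightarrow> \<exists>!v. is_lca N (f x) (f y) v"
  shows "symbolic_arboreal_map X M odot d"
proof -
  have N: "pair_digraph N"
    using lan by (simp add: labelled_arboreal_network_def arboreal_network_def network_def)
  then have fin: "finite (pverts N)"
    by (simp add: pair_digraph_def pair_fin_digraph_def pair_fin_digraph_axioms_def)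
  obtain k :: "'v \<Rightarrow> nat" where k: "inj_on k (pverts N)"
    using finite_imp_inj_to_nat_seg[OF fin] by (elim exE conjE)
  define h where "h v = (if v \<in> f ` X then Inl (the_inv_into X f v) else Inr (k v))" for v
  have h_f: "h (f x) = Inl x" if "x \<in> X" for x
    using that inj by (simp add: h_def the_inv_into_f_f)
  have inj_h: "inj_on h (pverts N)"
  proof (rule inj_onI)
    fix u v assume uv: "u \<in> pverts N" "v \<in> pverts N" "h u = h v"
    show "u = v"
    proof (cases "u \<in> f ` X \<and> v \<in> f ` X")
      case True
      then show ?thesis using uv(3) by (auto simp: h_f)
    next
      case False
      then show ?thesis
        using uv k by (auto simp: h_def inj_on_eq_iff split: if_splits)
    qed
  qed
  have "\<forall>x\<in>f ` X. \<forall>y\<in>f ` X. x \<noteq> y \<longrightarrow> share_ancestor N x y \<longrightarrow> (\<exists>!v. is_lca N x y v)"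
  proof (intro ballI impI)
    fix x y assume xy: "x \<in> f ` X" "y \<in> f ` X" "x \<noteq> y" "share_ancestor N x y"
    obtain x' y' where "x = f x'" "y = f y'" "x' \<in> X" "y' \<in> X"
      using xy(1,2) by auto
    with xy(3,4) show "\<exists>!v. is_lca N x y v"
      using unique[of x' y'] by fast
  qed
  from labelled_arboreal_network_transport[OF N inj_h lan this, of odot]
  obtain N' t' where N': "labelled_arboreal_network N' t' (h ` f ` X) M"
      "\<forall>x\<in>f ` X. \<forall>y\<in>f ` X. x \<noteq> y \<longrightarrow>
        induced_map odot N' t' (h x) (h y) = induced_map odot N t x y"
    by (elim exE conjE)
  have "h ` f ` X = Inl ` X"
    unfolding image_image using h_f by (rule image_cong[OF refl])
  moreover have "d {x, y} = induced_map odot N' t' (Inl x) (Inl y)"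
    if "x \<in> X" "y \<in> X" "x \<noteq> y" for x y
    using N'(2)[rule_format, of "f x" "f y"] d[of x y] that inj by (simp add: h_f inj_on_eq_iff)
  ultimately show ?thesis
    unfolding symbolic_arboreal_map_def using N'(1) by auto
qed

end

theory Submission
  imports Defs
begin

text \<open>
  Both directions rest on two operations: doubling a vertex, and gluing two maps at a cut vertex.

  Let \<open>T\<close> be an oriented tree, and let a pair of vertices (not only leaves) with a common ancestor
  carry the label of its least common ancestor. If \<open>h\<close> is a sink and \<open>(p, h)\<close> an arc, then deleting
  that arc splits \<open>T\<close> into two trees, and the map of \<open>T\<close> arises from the two smaller maps by adding
  \<open>h\<close> as a twin of \<open>p\<close> to the first and gluing the result at \<open>h\<close> with the second. All
  conditions survive these two operations. Sending each vertex to a leaf below it is a retraction,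
  so the leaves form an isometric subgraph and inherit the conditions.

  Conversely, a map satisfying the conditions on at least two points has twins or a cut vertex. If the
  graph is complete, excluding \<open>\<Delta>\<close> and \<open>\<Pi>\<close> yields a partition into two parts with a
  constant value in between, and twins follow by induction. Otherwise choose \<open>a\<close>, \<open>b\<close> at
  distance two with the fewest common neighbours. These form a clique that is a module of the graph, as
  the Ptolemaic inequality forbids gems, and then a module of the map by (A4). So there are twins if
  there are at least two common neighbours. A single common neighbour is a cut vertex, as in a Ptolemaic
  graph induced paths are geodesics. In a network, twins are hung below the leaf that represents
  both, and at a cut vertex two networks are glued at their common leaf, below which a new leaf is hung.
\<close>

section \<open>Ptolemaic graph metrics\<close>

locale graph_metric =
  fixes V :: "'a set" and r :: "'a \<Rightarrow> 'a \<Rightarrow> bool" and D :: "'a \<Rightarrow> 'a \<Rightarrow> nat"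
  assumes r_sym: "\<lbrakk>x \<in> V; y \<in> V; r x y\<rbrakk> \<Longrightarrow> r y x"
    and D_eq_0: "\<lbrakk>x \<in> V; y \<in> V\<rbrakk> \<Longrightarrow> D x y = 0 \<longleftrightarrow> x = y"
    and D_step: "\<lbrakk>x \<in> V; y \<in> V; z \<in> V; r x y\<rbrakk> \<Longrightarrow> D x z \<le> Suc (D y z)"
    and D_pred: "\<lbrakk>x \<in> V; z \<in> V; D x z = Suc n\<rbrakk> \<Longrightarrow> \<exists>y\<in>V. r x y \<and> D y z = n"
begin

lemma D_self [simp]: "x \<in> V \<Longrightarrow> D x x = 0"
  by (simp add: D_eq_0)

lemma D_triangle: "\<lbrakk>x \<in> V; y \<in> V; z \<in> V\<rbrakk> \<Longrightarrow> D x z \<le> D x y + D y z"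
proof (induction "D x y" arbitrary: x)
  case 0
  then show ?case using D_eq_0 by force
next
  case (Suc n)
  then obtain w where w: "w \<in> V" "r x w" "D w y = n"
    using D_pred by metis
  then have "D w z \<le> D w y + D y z" using Suc by auto
  moreover have "D x z \<le> Suc (D w z)" using w Suc.prems by (intro D_step)
  ultimately show ?case using w Suc.hyps(2) by simp
qed

lemma D_adj: "\<lbrakk>x \<in> V; y \<in> V; r x y\<rbrakk> \<Longrightarrow> D x y \<le> 1"
  using D_step[of x y y] by simp

lemma D_sym: "\<lbrakk>x \<in> V; y \<in> V\<rbrakk> \<Longrightarrow> D x y = D y x"
proof -
  have "D y x \<le> D x y" if "x \<in> V" "y \<in> V" for x y
    using that
  proof (induction "D x y" arbitrary: x)
    case 0
    then show ?case using D_eq_0 by force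
  next
    case (Suc n)
    then obtain w where w: "w \<in> V" "r x w" "D w y = n"
      using D_pred by metis
    then have "D y w \<le> n" using Suc by auto
    moreover have "D w x \<le> 1" using w Suc.prems r_sym by (intro D_adj) auto
    moreover have "D y x \<le> D y w + D w x" using w Suc.prems by (intro D_triangle)
    ultimately show ?case using Suc.hyps(2) by simp
  qed
  then show "\<lbrakk>x \<in> V; y \<in> V\<rbrakk> \<Longrightarrow> D x y = D y x" by (simp add: order_antisym)
qed

lemma D_eq_1: "\<lbrakk>x \<in> V; y \<in> V; x \<noteq> y\<rbrakk> \<Longrightarrow> D x y = 1 \<longleftrightarrow> r x y"
  using D_pred[of x y 0] D_adj[of x y] D_eq_0[of x y] D_eq_0 by force

lemma D_ge_2: "\<lbrakk>x \<in> V; y \<in> V; x \<noteq> y; \<not> r x y\<rbrakk> \<Longrightarrow> D x y \<ge> 2"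
  using D_eq_1[of x y] D_eq_0[of x y] by linarith

lemma D_pos: "\<lbrakk>x \<in> V; y \<in> V; x \<noteq> y\<rbrakk> \<Longrightarrow> D x y \<ge> 1"
  using D_eq_0[of x y] by linarith

lemma retract:
  assumes L: "L \<subseteq> V" "\<And>x. x \<in> V \<Longrightarrow> \<phi> x \<in> L" "\<And>x. x \<in> L \<Longrightarrow> \<phi> x = x"
    and hom: "\<And>x y. \<lbrakk>x \<in> V; y \<in> V; r x y\<rbrakk> \<Longrightarrow> r (\<phi> x) (\<phi> y)"
  shows "graph_metric L r D"
proof -
  have nonexp: "D (\<phi> x) (\<phi> y) \<le> D x y" if "x \<in> V" "y \<in> V" for x y
    using that
  proof (induction "D x y" arbitrary: x)
    case 0
    then have "x = y" "\<phi> y \<in> V" using D_eq_0[of x y] L by auto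
    then show ?case by simp
  next
    case (Suc n)
    then obtain w where w: "w \<in> V" "r x w" "D w y = n"
      using D_pred by metis
    then have "D (\<phi> w) (\<phi> y) \<le> n" using Suc by auto
    moreover have "D (\<phi> x) (\<phi> y) \<le> Suc (D (\<phi> w) (\<phi> y))"
      using w Suc.prems L hom by (intro D_step) auto
    ultimately show ?case using Suc.hyps(2) by simp
  qed
  show ?thesis
  proof
    fix x z n assume xz: "x \<in> L" "z \<in> L" "D x z = Suc n"
    then obtain w where w: "w \<in> V" "r x w" "D w z = n"
      using D_pred L by (metis subsetD)
    have "r x (\<phi> w)" using hom[of x w] w xz L by auto
    moreover have "D (\<phi> w) z \<le> n" using nonexp[of w z] w xz L by auto
    moreover have "D x z \<le> Suc (D (\<phi> w) z)"
      using xz w L \<open>r x (\<phi> w)\<close> by (intro D_step) auto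
    ultimately show "\<exists>y\<in>L. r x y \<and> D y z = n"
      using xz w L by (intro bexI[of _ "\<phi> w"]) auto
  qed (use subsetD[OF L(1)] r_sym D_eq_0 D_step in simp_all)
qed

end

definition ptolemaic_on :: "'a set \<Rightarrow> ('a \<Rightarrow> 'a \<Rightarrow> nat) \<Rightarrow> bool" where
  "ptolemaic_on V D \<longleftrightarrow>
     (\<forall>x\<in>V. \<forall>y\<in>V. \<forall>z\<in>V. \<forall>u\<in>V. D x z * D y u \<le> D x y * D z u + D x u * D y z)"

lemma ptolemaic_onD:
  "\<lbrakk>ptolemaic_on V D; x \<in> V; y \<in> V; z \<in> V; u \<in> V\<rbrakk>
    \<Longrightarrow> D x z * D y u \<le> D x y * D z u + D x u * D y z"
  by (auto simp: ptolemaic_on_def)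

lemma ptolemaic_on_subset: "\<lbrakk>ptolemaic_on V D; L \<subseteq> V\<rbrakk> \<Longrightarrow> ptolemaic_on L D"
  unfolding ptolemaic_on_def by blast

lemma (in graph_metric) ptolemaic_onI:
  assumes "\<And>x y z u. \<lbrakk>x \<in> V; y \<in> V; z \<in> V; u \<in> V; distinct [x, y, z, u]\<rbrakk>
    \<Longrightarrow> D x z * D y u \<le> D x y * D z u + D x u * D y z"
  shows "ptolemaic_on V D"
  unfolding ptolemaic_on_def
proof (intro ballI)
  fix x y z u assume V: "x \<in> V" "y \<in> V" "z \<in> V" "u \<in> V"
  show "D x z * D y u \<le> D x y * D z u + D x u * D y z"
  proof (cases "distinct [x, y, z, u]")
    case False
    then show ?thesis using V D_sym[OF V(1,2)] D_sym[OF V(1,4)] D_sym[OF V(2,3)] D_sym[OF V(3,4)]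
      by (auto simp: mult.commute)
  qed (use assms V in auto)
qed

lemma graph_metric_twin:
  assumes "graph_metric V r D" and P: "ptolemaic_on V D" and p: "p \<in> V" "h \<notin> V" "r p p"
    and r': "\<And>x y. r' x y = r ((id(h := p)) x) ((id(h := p)) y)"
  shows "\<exists>D'. graph_metric (insert h V) r' D' \<and> ptolemaic_on (insert h V) D'"
proof -
  interpret graph_metric V r D by fact
  define q where "q = id(h := p)"
  have q: "q x \<in> V" if "x \<in> insert h V" for x using that p by (auto simp: q_def)
  have qV: "q x = x" if "x \<in> V" for x using that p by (auto simp: q_def)
  have qqE: "x \<in> {p, h} \<and> y \<in> {p, h}" if "q x = q y" "x \<noteq> y" for x y
    using that by (auto simp: q_def split: if_splits)
  define E where "E x y = (if x \<noteq> y \<and> q x = q y then 1 else D (q x) (q y))" for x y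
  have E_D: "E x y = D (q x) (q y)" if "x = y \<or> q x \<noteq> q y" for x y
    using that by (auto simp: E_def)
  have E_ge: "D (q x) (q y) \<le> E x y" if "x \<in> insert h V" for x y
    using q[OF that] by (auto simp: E_def)
  have r'q: "r' x y = r (q x) (q y)" for x y by (simp add: r' q_def)
  interpret E: graph_metric "insert h V" r' E
  proof
    fix x y assume xy: "x \<in> insert h V" "y \<in> insert h V"
    show "r' x y \<Longrightarrow> r' y x" using xy r_sym q by (simp add: r'q)
    show "E x y = 0 \<longleftrightarrow> x = y" using xy D_eq_0[OF q q] q by (auto simp: E_def)
    fix z assume z: "z \<in> insert h V" and r: "r' x y"
    show "E x z \<le> Suc (E y z)"
    proof (cases "x \<noteq> z \<and> q x = q z")
      case False
      then have "E x z = D (q x) (q z)" by (auto simp: E_def)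
      also have "\<dots> \<le> Suc (D (q y) (q z))" using xy z q r by (intro D_step) (auto simp: r'q)
      also have "\<dots> \<le> Suc (E y z)" using E_ge xy by simp
      finally show ?thesis .
    qed (simp add: E_def)
  next
    fix x z n assume xz: "x \<in> insert h V" "z \<in> insert h V" "E x z = Suc n"
    show "\<exists>y\<in>insert h V. r' x y \<and> E y z = n"
    proof (cases "x \<noteq> z \<and> q x = q z")
      case True
      then have "n = 0" using xz by (simp add: E_def)
      moreover have "q x = p" "q z = p" using True qqE[of x z] p by (auto simp: q_def)
      then have "r' x z" using p by (simp add: r'q)
      ultimately show ?thesis using xz q by (intro bexI[of _ z]) (auto simp: E_def)
    next
      case False
      then have "D (q x) (q z) = Suc n" using xz by (auto simp: E_def)
      then obtain y where y: "y \<in> V" "r (q x) y" "D y (q z) = n"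
        using D_pred q xz by metis
      show ?thesis
      proof (cases "y = q z")
        case True
        then show ?thesis using y xz q by (intro bexI[of _ z]) (auto simp: r'q E_def)
      next
        case False
        then show ?thesis using y by (intro bexI[of _ y]) (auto simp: r'q E_def qV)
      qed
    qed
  qed
  have "ptolemaic_on (insert h V) E"
  proof (rule E.ptolemaic_onI)
    fix x y z u
    assume W: "x \<in> insert h V" "y \<in> insert h V" "z \<in> insert h V" "u \<in> insert h V"
      and d: "distinct [x, y, z, u]"
    have *: "E v w = E v' w" if "q v = q v'" "v \<noteq> v'" "w \<noteq> v" "w \<noteq> v'" for v v' w
    proof -
      have "q v \<noteq> q w" using qqE[of v v'] qqE[of v w] that by auto
      then show ?thesis using that by (simp add: E_def)
    qed
    have diag: "E v w * E a b \<le> E v a * E v b + E v a * E v b"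
      if "q v = q w" "distinct [v, w, a, b]"
        "v \<in> insert h V" "w \<in> insert h V" "a \<in> insert h V" "b \<in> insert h V" for v w a b
    proof -
      have "E v w = 1" using that by (simp add: E_def)
      moreover have "E a b \<le> E v a + E v b"
        using E.D_triangle[of a v b] E.D_sym[of a v] that by auto
      moreover have "E v a \<ge> 1" "E v b \<ge> 1" using that by (auto intro: E.D_pos[simplified])
      then have "E v a + E v b \<le> E v a * E v b + E v a * E v b" by (intro add_mono) simp_all
      ultimately show ?thesis by simp
    qed
    consider "q x = q z" | "q y = q u" | "q x = q y" | "q z = q u" | "q x = q u" | "q y = q z"
      | "q x \<noteq> q z" "q y \<noteq> q u" "q x \<noteq> q y" "q z \<noteq> q u" "q x \<noteq> q u" "q y \<noteq> q z"
      by blast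
    then show "E x z * E y u \<le> E x y * E z u + E x u * E y z"
    proof cases
      case 1
      then show ?thesis using diag[of x z y u] *[of x z] d W E.D_sym[of y z]
        by (auto simp: mult.commute)
    next
      case 2
      then show ?thesis using diag[of y u x z] *[of y u] d W E.D_sym[of y x] E.D_sym[of z u] E.D_sym[of x u]
        by (auto simp: mult.commute)
    next
      case 3
      then show ?thesis using *[of x y] d by (auto simp: mult.commute)
    next
      case 4
      then show ?thesis using *[of z u] d W E.D_sym[of x z] E.D_sym[of x u] E.D_sym[of y u] E.D_sym[of y z] by auto
    next
      case 5
      then show ?thesis using *[of x u] d W E.D_sym[of y u] E.D_sym[of z u] E.D_sym[of x y] by (auto simp: mult.commute)
    next
      case 6
      then show ?thesis using *[of y z] d W E.D_sym[of x y] E.D_sym[of x z] by (auto simp: mult.commute)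
    next
      case 7
      then show ?thesis using ptolemaic_onD[OF P q q q q, of x y z u] W by (simp add: E_D)
    qed
  qed
  then show ?thesis using E.graph_metric_axioms by blast
qed

lemma ptolemaic_cut_side:
  fixes X Y Z U a b :: nat
  assumes "X \<le> Y + a" "Y \<le> X + a" "Z \<le> U + b" "U \<le> Z + b"
  shows "(X + Z) * (Y + U) \<le> a * b + (X + U) * (Y + Z)"
proof -
  have "(int X - int Y) * (int U - int Z) \<le> \<bar>int X - int Y\<bar> * \<bar>int U - int Z\<bar>"
    by (metis abs_ge_self abs_mult)
  also have "\<dots> \<le> int a * int b"
    using assms by (intro mult_mono) auto
  finally have "int ((X + Z) * (Y + U)) \<le> int (a * b + (X + U) * (Y + Z))"
    by (simp add: algebra_simps)
  then show ?thesis by linarith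
qed

lemma ptolemaic_cut_diagonal:
  fixes X Y Z U a b :: nat
  assumes "a \<le> X + Z" "b \<le> Y + U"
  shows "a * b \<le> (X + Y) * (Z + U) + (X + U) * (Y + Z)"
proof -
  have "a * b \<le> (X + Z) * (Y + U)" using assms by (intro mult_mono) auto
  then show ?thesis by (simp add: algebra_simps)
qed

lemma ptolemaic_cut_corner:
  fixes X Y Z a b c d :: nat
  assumes "a \<le> b + c" "a * Y \<le> b * Z + X * c"
  shows "a * (Y + d) \<le> b * (Z + d) + (X + d) * c"
proof -
  have "a * d \<le> (b + c) * d" using assms by (intro mult_right_mono) auto
  then show ?thesis using assms(2) by (simp add: algebra_simps)
qed

lemma graph_metric_glue:
  assumes "graph_metric V1 r D1" "graph_metric V2 r D2" and P1: "ptolemaic_on V1 D1" and P2: "ptolemaic_on V2 D2"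
    and s: "V1 \<inter> V2 = {s}"
    and cut: "\<And>x y. \<lbrakk>x \<in> V1 - {s}; y \<in> V2 - {s}\<rbrakk> \<Longrightarrow> \<not> r x y \<and> \<not> r y x"
  shows "\<exists>D. graph_metric (V1 \<union> V2) r D \<and> ptolemaic_on (V1 \<union> V2) D"
proof -
  interpret A: graph_metric V1 r D1 by fact
  interpret B: graph_metric V2 r D2 by fact
  define e where "e x = (if x \<in> V1 then x else s)" for x
  define f where "f x = (if x \<in> V2 then x else s)" for x
  have sV: "s \<in> V1" "s \<in> V2" using s by auto
  have e: "e x \<in> V1" and f: "f x \<in> V2" for x using sV by (auto simp: e_def f_def)
  have e1: "e x = x" if "x \<in> V1" for x using that by (simp add: e_def)
  have f2: "f x = x" if "x \<in> V2" for x using that by (simp add: f_def)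
  have e2: "e x = s" if "x \<in> V2" for x using that s by (auto simp: e_def)
  have f1: "f x = s" if "x \<in> V1" for x using that s by (auto simp: f_def)
  define D where "D x y = D1 (e x) (e y) + D2 (f x) (f y)" for x y
  have both: "x \<in> V1 \<and> y \<in> V1 \<or> x \<in> V2 \<and> y \<in> V2" if "x \<in> V1 \<union> V2" "y \<in> V1 \<union> V2" "r x y" for x y
    using that cut[of x y] cut[of y x] sV by auto
  have C: "graph_metric (V1 \<union> V2) r D"
  proof
    fix x y assume xy: "x \<in> V1 \<union> V2" "y \<in> V1 \<union> V2"
    show "r x y \<Longrightarrow> r y x" using both[OF xy] A.r_sym B.r_sym by blast
    show "D x y = 0 \<longleftrightarrow> x = y"
      using xy A.D_eq_0[OF e e, of x y] B.D_eq_0[OF f f, of x y] e1 e2 f1 f2 s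
      unfolding D_def by (metis UnE add_is_0)
    fix z assume z: "z \<in> V1 \<union> V2" and r: "r x y"
    show "D x z \<le> Suc (D y z)"
      using both[OF xy r]
    proof
      assume V: "x \<in> V1 \<and> y \<in> V1"
      then show ?thesis using A.D_step[of x y "e z"] e[of z] r by (simp add: D_def e1 f1)
    next
      assume V: "x \<in> V2 \<and> y \<in> V2"
      then show ?thesis using B.D_step[of x y "f z"] f[of z] r by (simp add: D_def e2 f2)
    qed
  next
    fix x z n assume xz: "x \<in> V1 \<union> V2" "z \<in> V1 \<union> V2" "D x z = Suc n"
    have "\<exists>y\<in>V1. r x y \<and> D y z = n" if x: "x \<in> V1" and m: "D1 x (e z) = Suc m" for m
    proof -
      obtain y where "y \<in> V1" "r x y" "D1 y (e z) = m" using A.D_pred[OF x e m] by blast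
      then show ?thesis using xz x m by (intro bexI[of _ y]) (auto simp: D_def e1 f1)
    qed
    moreover have "\<exists>y\<in>V2. r x y \<and> D y z = n" if x: "x \<in> V2" and m: "D2 x (f z) = Suc m" for m
    proof -
      obtain y where "y \<in> V2" "r x y" "D2 y (f z) = m" using B.D_pred[OF x f m] by blast
      then show ?thesis using xz x m by (intro bexI[of _ y]) (auto simp: D_def e2 f2)
    qed
    moreover have "(x \<in> V1 \<and> D1 x (e z) \<noteq> 0) \<or> (x \<in> V2 \<and> D2 x (f z) \<noteq> 0)"
    proof (rule ccontr)
      assume no: "\<not> ?thesis"
      have "x = z"
      proof (cases "x \<in> V1")
        case True
        then have "x = e z" using no A.D_eq_0[OF True e] by auto
        with no True xz show ?thesis
          using B.D_eq_0[OF sV(2) f, of z] A.D_eq_0[OF True e, of z] e1 e2 f2 s sV by (metis UnE)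
      next
        case False
        then have "x \<in> V2" using xz by auto
        then have "x = f z" using no B.D_eq_0[OF _ f] by auto
        with False xz show ?thesis using sV by (auto simp: f_def split: if_splits)
      qed
      then show False using xz by (auto simp: D_def e f)
    qed
    ultimately show "\<exists>y\<in>V1 \<union> V2. r x y \<and> D y z = n"
      by (metis UnCI not0_implies_Suc)
  qed
  interpret C: graph_metric "V1 \<union> V2" r D by (rule C)
  have D11: "D x y = D1 x y" if "x \<in> V1" "y \<in> V1" for x y using that sV by (simp add: D_def e1 f1)
  have D22: "D x y = D2 x y" if "x \<in> V2" "y \<in> V2" for x y using that sV by (simp add: D_def e2 f2)
  have D12: "D x y = D1 x s + D2 y s" if "x \<in> V1" "y \<in> V2" for x y
    using that sV B.D_sym[of s y] by (simp add: D_def e1 e2 f1 f2)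
  have D21: "D x y = D1 y s + D2 x s" if "x \<in> V2" "y \<in> V1" for x y
    using that sV A.D_sym[of s y] by (simp add: D_def e1 e2 f1 f2)
  note Ds = D11 D22 D12 D21
  have t1: "D1 x y \<le> D1 x s + D1 y s" "D1 x s \<le> D1 y s + D1 x y" "D1 y s \<le> D1 x s + D1 x y"
    if "x \<in> V1" "y \<in> V1" for x y
    using that sV A.D_triangle[of x s y] A.D_triangle[of x y s] A.D_triangle[of y x s] A.D_sym[of x y] A.D_sym[of s y]
    by auto
  have t2: "D2 x y \<le> D2 x s + D2 y s" "D2 x s \<le> D2 y s + D2 x y" "D2 y s \<le> D2 x s + D2 x y"
    if "x \<in> V2" "y \<in> V2" for x y
    using that sV B.D_triangle[of x s y] B.D_triangle[of x y s] B.D_triangle[of y x s] B.D_sym[of x y] B.D_sym[of s y]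
    by auto
  have corner1: "D1 x z * (D1 y s + d) \<le> D1 x y * (D1 z s + d) + (D1 x s + d) * D1 y z"
    if "x \<in> V1" "y \<in> V1" "z \<in> V1" for x y z d
    using A.D_triangle[of x y z] ptolemaic_onD[OF P1, of x y z s] that sV by (intro ptolemaic_cut_corner) auto
  have corner2: "D2 x z * (D2 y s + d) \<le> D2 x y * (D2 z s + d) + (D2 x s + d) * D2 y z"
    if "x \<in> V2" "y \<in> V2" "z \<in> V2" for x y z d
    using B.D_triangle[of x y z] ptolemaic_onD[OF P2, of x y z s] that sV by (intro ptolemaic_cut_corner) auto
  define I where "I x y z u \<longleftrightarrow> D x z * D y u \<le> D x y * D z u + D x u * D y z" for x y z u
  have rot: "I x y z u" if "I y z u x" "{x, y, z, u} \<subseteq> V1 \<union> V2" for x y z u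
    using that unfolding I_def insert_subset
    by (metis C.D_sym add.commute mult.commute)
  have I: "I x y z u" if "x \<in> V1" "y \<in> V1" "z \<in> V1" "u \<in> V1 \<union> V2" for x y z u
    using that corner1[of x y z "D2 u s"] ptolemaic_onD[OF P1, of x y z u]
    by (auto simp: I_def Ds)
  have II: "I x y z u" if "x \<in> V2" "y \<in> V2" "z \<in> V2" "u \<in> V1 \<union> V2" for x y z u
    using that corner2[of x y z "D1 u s"] ptolemaic_onD[OF P2, of x y z u]
    by (auto simp: I_def Ds add.commute)
  have III: "I x y z u" if "x \<in> V1" "y \<in> V1" "z \<in> V2" "u \<in> V2" for x y z u
    using that ptolemaic_cut_side[OF t1(2,3)[of x y] t2(2,3)[of z u]] by (simp add: I_def Ds)
  have IV: "I x y z u" if "x \<in> V1" "y \<in> V2" "z \<in> V1" "u \<in> V2" for x y z u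
    using that ptolemaic_cut_diagonal[OF t1(1)[of x z] t2(1)[of y u]]
    by (simp add: I_def Ds add.commute[of "D2 y s"])
  note base = I II III IV
  have rot2: "I x y z u" if "I z u x y" "{x, y, z, u} \<subseteq> V1 \<union> V2" for x y z u
    by (rule rot[OF rot[OF that(1)]]) (use that(2) in auto)
  have rot3: "I x y z u" if "I u x y z" "{x, y, z, u} \<subseteq> V1 \<union> V2" for x y z u
    by (rule rot[OF rot2[OF that(1)]]) (use that(2) in auto)
  have "I x y z u" if "{x, y, z, u} \<subseteq> V1 \<union> V2" for x y z u
  proof -
    have "I x y z u \<or> I y z u x \<or> I z u x y \<or> I u x y z"
      using that unfolding insert_subset
      by (elim conjE UnE) (simp_all add: base)
    then show ?thesis
      using rot[OF _ that] rot2[OF _ that] rot3[OF _ that] by argo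
  qed
  then have "ptolemaic_on (V1 \<union> V2) D" by (simp add: ptolemaic_on_def I_def)
  then show ?thesis using C by blast
qed

section \<open>Maps satisfying the four conditions\<close>

lemma graph_metric_cong:
  assumes "graph_metric V r D" "\<And>x y. \<lbrakk>x \<in> V; y \<in> V\<rbrakk> \<Longrightarrow> r' x y = r x y"
  shows "graph_metric V r' D"
proof -
  interpret graph_metric V r D by fact
  show ?thesis
  proof
    fix x z n assume xz: "x \<in> V" "z \<in> V" "D x z = Suc n"
    then obtain y where "y \<in> V" "r x y" "D y z = n" using D_pred by blast
    then show "\<exists>y\<in>V. r' x y \<and> D y z = n" using xz assms(2) by auto
  qed (use assms(2) r_sym D_eq_0 D_step in simp_all)
qed

text \<open>Adjacency is made reflexive by giving the diagonal values other than \<open>odot\<close>; the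
  distinctness requirements of the theorem then hold automatically.\<close>

locale arboreal_map =
  fixes V :: "'a set" and odot :: 'm and \<delta> :: "'a \<Rightarrow> 'a \<Rightarrow> 'm"
  assumes sym: "\<lbrakk>x \<in> V; y \<in> V\<rbrakk> \<Longrightarrow> \<delta> x y = \<delta> y x"
    and diag: "x \<in> V \<Longrightarrow> \<delta> x x \<noteq> odot"
    and no_Delta: "\<lbrakk>x \<in> V; y \<in> V; z \<in> V; \<delta> x y \<noteq> odot; \<delta> x z \<noteq> odot; \<delta> y z \<noteq> odot\<rbrakk>
      \<Longrightarrow> \<delta> x y = \<delta> x z \<or> \<delta> x y = \<delta> y z \<or> \<delta> x z = \<delta> y z"
    and no_Pi: "\<lbrakk>a \<in> V; b \<in> V; c \<in> V; e \<in> V; \<delta> a b \<noteq> odot; \<delta> a c \<noteq> odot;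
        \<delta> a b = \<delta> b c; \<delta> b c = \<delta> c e; \<delta> c a = \<delta> a e; \<delta> a e = \<delta> e b\<rbrakk> \<Longrightarrow> \<delta> c e = \<delta> c a"
    and diamond: "\<lbrakk>x \<in> V; y \<in> V; z \<in> V; u \<in> V; \<delta> z u = odot; \<delta> x y \<noteq> odot; \<delta> x z \<noteq> odot;
        \<delta> x u \<noteq> odot; \<delta> y z \<noteq> odot; \<delta> y u \<noteq> odot\<rbrakk> \<Longrightarrow> \<delta> x z = \<delta> y z \<and> \<delta> x u = \<delta> y u"
    and metric: "\<exists>D. graph_metric V (\<lambda>x y. \<delta> x y \<noteq> odot) D \<and> ptolemaic_on V D"

lemma arboreal_mapI:
  assumes sym: "\<And>x y. \<lbrakk>x \<in> V; y \<in> V\<rbrakk> \<Longrightarrow> \<delta> x y = \<delta> y x"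
    and diag: "\<And>x. x \<in> V \<Longrightarrow> \<delta> x x \<noteq> odot"
    and Delta: "\<And>x y z. \<lbrakk>x \<in> V; y \<in> V; z \<in> V; distinct [x, y, z];
        \<delta> x y \<noteq> odot; \<delta> x z \<noteq> odot; \<delta> y z \<noteq> odot\<rbrakk>
      \<Longrightarrow> \<delta> x y = \<delta> x z \<or> \<delta> x y = \<delta> y z \<or> \<delta> x z = \<delta> y z"
    and Pi: "\<And>a b c e. \<lbrakk>a \<in> V; b \<in> V; c \<in> V; e \<in> V; distinct [a, b, c, e];
        \<delta> a b \<noteq> odot; \<delta> a c \<noteq> odot;
        \<delta> a b = \<delta> b c; \<delta> b c = \<delta> c e; \<delta> c a = \<delta> a e; \<delta> a e = \<delta> e b\<rbrakk> \<Longrightarrow> \<delta> c e = \<delta> c a"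
    and diamond: "\<And>x y z u. \<lbrakk>x \<in> V; y \<in> V; z \<in> V; u \<in> V; distinct [x, y, z, u];
        \<delta> z u = odot; \<delta> x y \<noteq> odot; \<delta> x z \<noteq> odot; \<delta> x u \<noteq> odot; \<delta> y z \<noteq> odot; \<delta> y u \<noteq> odot\<rbrakk>
      \<Longrightarrow> \<delta> x z = \<delta> y z \<and> \<delta> x u = \<delta> y u"
    and metric: "\<exists>D. graph_metric V (\<lambda>x y. \<delta> x y \<noteq> odot) D \<and> ptolemaic_on V D"
  shows "arboreal_map V odot \<delta>"
proof
  fix x y z assume "x \<in> V" "y \<in> V" "z \<in> V" "\<delta> x y \<noteq> odot" "\<delta> x z \<noteq> odot" "\<delta> y z \<noteq> odot"
  then show "\<delta> x y = \<delta> x z \<or> \<delta> x y = \<delta> y z \<or> \<delta> x z = \<delta> y z"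
    using Delta[of x y z] sym[of x y] by (cases "distinct [x, y, z]") auto
next
  fix a b c e assume V: "a \<in> V" "b \<in> V" "c \<in> V" "e \<in> V"
    and *: "\<delta> a b \<noteq> odot" "\<delta> a c \<noteq> odot"
      "\<delta> a b = \<delta> b c" "\<delta> b c = \<delta> c e" "\<delta> c a = \<delta> a e" "\<delta> a e = \<delta> e b"
  show "\<delta> c e = \<delta> c a"
  proof (cases "distinct [a, b, c, e]")
    case False
    then consider "a = b" | "a = c" | "a = e" | "b = c" | "b = e" | "c = e" by auto
    then show ?thesis by cases (use * V sym in metis)+
  qed (use Pi V * in simp)
next
  fix x y z u assume V: "x \<in> V" "y \<in> V" "z \<in> V" "u \<in> V"
    and *: "\<delta> z u = odot" "\<delta> x y \<noteq> odot" "\<delta> x z \<noteq> odot" "\<delta> x u \<noteq> odot" "\<delta> y z \<noteq> odot" "\<delta> y u \<noteq> odot"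
  show "\<delta> x z = \<delta> y z \<and> \<delta> x u = \<delta> y u"
  proof (cases "distinct [x, y, z, u]")
    case True
    then show ?thesis using diamond V * by blast
  next
    case False
    then consider "x = y" | "x = z" | "x = u" | "y = z" | "y = u" | "z = u" by auto
    then show ?thesis by cases (use * V sym diag in metis)+
  qed
qed (use sym diag metric in auto)

lemma arboreal_map_cong:
  assumes "arboreal_map V odot \<delta>"
    and eq: "\<And>x y. \<lbrakk>x \<in> V; y \<in> V; x \<noteq> y\<rbrakk> \<Longrightarrow> \<delta>' x y = \<delta> x y"
    and diag': "\<And>x. x \<in> V \<Longrightarrow> \<delta>' x x \<noteq> odot"
  shows "arboreal_map V odot \<delta>'"
proof -
  interpret arboreal_map V odot \<delta> by fact
  show ?thesis
  proof (rule arboreal_mapI)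
    show "\<exists>D. graph_metric V (\<lambda>x y. \<delta>' x y \<noteq> odot) D \<and> ptolemaic_on V D"
      using metric graph_metric_cong[of V "\<lambda>x y. \<delta> x y \<noteq> odot" _ "\<lambda>x y. \<delta>' x y \<noteq> odot"] eq diag diag' by metis
    show "\<delta>' x y = \<delta>' y x" if "x \<in> V" "y \<in> V" for x y
      using that eq[of x y] eq[of y x] sym by (cases "x = y") auto
    show "\<delta>' x y = \<delta>' x z \<or> \<delta>' x y = \<delta>' y z \<or> \<delta>' x z = \<delta>' y z"
      if "x \<in> V" "y \<in> V" "z \<in> V" "distinct [x, y, z]"
        "\<delta>' x y \<noteq> odot" "\<delta>' x z \<noteq> odot" "\<delta>' y z \<noteq> odot" for x y z
      using that no_Delta[of x y z] by (simp add: eq)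
    show "\<delta>' c e = \<delta>' c a" if "a \<in> V" "b \<in> V" "c \<in> V" "e \<in> V" "distinct [a, b, c, e]"
        "\<delta>' a b \<noteq> odot" "\<delta>' a c \<noteq> odot"
        "\<delta>' a b = \<delta>' b c" "\<delta>' b c = \<delta>' c e" "\<delta>' c a = \<delta>' a e" "\<delta>' a e = \<delta>' e b" for a b c e
      using that(5-) eq[OF that(1,2)] eq[OF that(1,3)] eq[OF that(2,3)] eq[OF that(3,4)]
        eq[OF that(3,1)] eq[OF that(1,4)] eq[OF that(4,2)] no_Pi[OF that(1-4)] by auto
    show "\<delta>' x z = \<delta>' y z \<and> \<delta>' x u = \<delta>' y u"
      if "x \<in> V" "y \<in> V" "z \<in> V" "u \<in> V" "distinct [x, y, z, u]"
        "\<delta>' z u = odot" "\<delta>' x y \<noteq> odot" "\<delta>' x z \<noteq> odot" "\<delta>' x u \<noteq> odot" "\<delta>' y z \<noteq> odot" "\<delta>' y u \<noteq> odot"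
      for x y z u
      using that diamond[of x y z u] by (simp add: eq)
  qed (use diag' in auto)
qed

lemma arboreal_map_singleton: "\<delta> v v \<noteq> odot \<Longrightarrow> arboreal_map {v} odot \<delta>"
  by (rule arboreal_mapI)
     (auto simp: graph_metric_def ptolemaic_on_def intro!: exI[of _ "\<lambda>_ _. 0"])

lemma (in arboreal_map) retract:
  assumes L: "L \<subseteq> V" "\<And>x. x \<in> V \<Longrightarrow> \<phi> x \<in> L" "\<And>x. x \<in> L \<Longrightarrow> \<phi> x = x"
    and hom: "\<And>x y. \<lbrakk>x \<in> V; y \<in> V; \<delta> x y \<noteq> odot\<rbrakk> \<Longrightarrow> \<delta> (\<phi> x) (\<phi> y) \<noteq> odot"
  shows "arboreal_map L odot \<delta>"
proof -
  obtain D where D: "graph_metric V (\<lambda>x y. \<delta> x y \<noteq> odot) D" "ptolemaic_on V D"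
    using metric by blast
  have "graph_metric L (\<lambda>x y. \<delta> x y \<noteq> odot) D"
    by (rule graph_metric.retract[OF D(1) L hom])
  then have "\<exists>D. graph_metric L (\<lambda>x y. \<delta> x y \<noteq> odot) D \<and> ptolemaic_on L D"
    using ptolemaic_on_subset[OF D(2) L(1)] by blast
  then show ?thesis
  proof (unfold_locales, goal_cases)
    case (4 a b c e)
    then show ?case using no_Pi[of a b c e] L(1) by (simp add: subset_iff)
  next
    case (5 x y z u)
    then show ?case using diamond[of x y z u] L(1) by (simp add: subset_iff)
  qed (use subsetD[OF L(1)] sym diag no_Delta in simp_all)
qed

lemma arboreal_map_vimage:
  assumes "arboreal_map (f ` X) odot \<delta>" and inj: "inj_on f X"
  shows "arboreal_map X odot (\<lambda>x y. \<delta> (f x) (f y))"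
proof -
  interpret arboreal_map "f ` X" odot \<delta> by fact
  obtain D where D: "graph_metric (f ` X) (\<lambda>x y. \<delta> x y \<noteq> odot) D" "ptolemaic_on (f ` X) D"
    using metric by blast
  interpret D: graph_metric "f ` X" "\<lambda>x y. \<delta> x y \<noteq> odot" D by (rule D)
  have "graph_metric X (\<lambda>x y. \<delta> (f x) (f y) \<noteq> odot) (\<lambda>x y. D (f x) (f y))"
  proof
    fix x z n assume "x \<in> X" "z \<in> X" "D (f x) (f z) = Suc n"
    then show "\<exists>y\<in>X. \<delta> (f x) (f y) \<noteq> odot \<and> D (f y) (f z) = n"
      using D.D_pred[of "f x" "f z" n] by blast
  next
    fix x y assume "x \<in> X" "y \<in> X"
    then show "D (f x) (f y) = 0 \<longleftrightarrow> x = y"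
      using inj D.D_eq_0[of "f x" "f y"] by (auto simp: inj_on_eq_iff)
  qed (use D.r_sym D.D_step in simp_all)
  moreover have "ptolemaic_on X (\<lambda>x y. D (f x) (f y))"
    using D(2) by (auto simp: ptolemaic_on_def)
  ultimately have "\<exists>D. graph_metric X (\<lambda>x y. \<delta> (f x) (f y) \<noteq> odot) D \<and> ptolemaic_on X D"
    by blast
  then show ?thesis
  proof (unfold_locales, goal_cases)
    case (4 a b c e)
    then show ?case using no_Pi[of "f a" "f b" "f c" "f e"] by simp
  next
    case (5 x y z u)
    then show ?case using diamond[of "f x" "f y" "f z" "f u"] by simp
  qed (use sym diag no_Delta in simp_all)
qed

lemma arboreal_map_join:
  assumes "arboreal_map V1 odot \<delta>1" "arboreal_map V2 odot \<delta>2"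
    and disj: "V1 \<inter> V2 = {}" and p: "p \<in> V1" and h: "h \<in> V2"
    and d1: "\<And>x y. \<lbrakk>x \<in> V1; y \<in> V1\<rbrakk> \<Longrightarrow> \<delta> x y = \<delta>1 x y"
    and d2: "\<And>x y. \<lbrakk>x \<in> V2; y \<in> V2\<rbrakk> \<Longrightarrow> \<delta> x y = \<delta>2 x y"
    and dh: "\<And>x. x \<in> V1 \<Longrightarrow> \<delta> x h = \<delta>1 x p \<and> \<delta> h x = \<delta>1 x p"
    and d12: "\<And>x y. \<lbrakk>x \<in> V1; y \<in> V2; y \<noteq> h\<rbrakk> \<Longrightarrow> \<delta> x y = odot \<and> \<delta> y x = odot"
  shows "arboreal_map (V1 \<union> V2) odot \<delta>"
proof -
  interpret A: arboreal_map V1 odot \<delta>1 by fact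
  interpret B: arboreal_map V2 odot \<delta>2 by fact
  define q where "q = id(h := p)"
  define W where "W = insert h V1"
  have hV1: "h \<notin> V1" using disj h by auto
  have q: "q x \<in> V1" if "x \<in> W" for x using that p by (auto simp: q_def W_def)
  have dW: "\<delta> x y = \<delta>1 (q x) (q y)" if "x \<in> W" "y \<in> W" "x \<noteq> y" for x y
    using that d1 dh A.sym p hV1 by (auto simp: q_def W_def)
  have rW: "\<delta> x y \<noteq> odot \<longleftrightarrow> \<delta>1 (q x) (q y) \<noteq> odot" if "x \<in> W" "y \<in> W" for x y
  proof (cases "x = y")
    case True
    then show ?thesis using that A.diag[OF q] A.diag[of x] B.diag[OF h] d1[of x x] d2[OF h h] by (auto simp: W_def)
  qed (use dW that in simp)
  have WV: "W \<union> V2 = V1 \<union> V2" "W \<inter> V2 = {h}" using disj h by (auto simp: W_def)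
  obtain D1 where D1: "graph_metric V1 (\<lambda>x y. \<delta>1 x y \<noteq> odot) D1" "ptolemaic_on V1 D1"
    using A.metric by blast
  obtain D where D: "graph_metric W (\<lambda>x y. \<delta>1 (q x) (q y) \<noteq> odot) D" "ptolemaic_on W D"
    using graph_metric_twin[OF D1 p hV1 A.diag[OF p], of "\<lambda>x y. \<delta>1 (q x) (q y) \<noteq> odot"]
    unfolding q_def W_def by blast
  have DW: "graph_metric W (\<lambda>x y. \<delta> x y \<noteq> odot) D"
    by (rule graph_metric_cong[OF D(1) rW])
  obtain D2 where D2: "graph_metric V2 (\<lambda>x y. \<delta>2 x y \<noteq> odot) D2" "ptolemaic_on V2 D2"
    using B.metric by blast
  have D2': "graph_metric V2 (\<lambda>x y. \<delta> x y \<noteq> odot) D2"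
    by (rule graph_metric_cong[OF D2(1)]) (simp add: d2)
  have metric: "\<exists>D. graph_metric (V1 \<union> V2) (\<lambda>x y. \<delta> x y \<noteq> odot) D \<and> ptolemaic_on (V1 \<union> V2) D"
    using graph_metric_glue[OF DW D2' D(2) D2(2) WV(2)] d12 WV(1) by (auto simp: W_def)
  have symU: "\<delta> x y = \<delta> y x" if xy: "x \<in> V1 \<union> V2" "y \<in> V1 \<union> V2" for x y
  proof -
    consider "x \<in> V1" "y \<in> V1" | "x \<in> V2" "y \<in> V2" | "x \<in> V1" "y \<in> V2" | "x \<in> V2" "y \<in> V1"
      using xy by blast
    then show ?thesis
    proof cases
      case 3
      then show ?thesis using d12[of x y] dh[of x] by (cases "y = h") auto
    next
      case 4
      then show ?thesis using d12[of y x] dh[of y] by (cases "x = h") auto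
    qed (use d1 d2 A.sym B.sym in auto)
  qed
  have adjW: "y \<in> W" if "x \<in> V1" "y \<in> V1 \<union> V2" "\<delta> x y \<noteq> odot" for x y
    using that d12[of x y] by (auto simp: W_def)
  have clique: "S \<subseteq> W \<or> S \<subseteq> V2"
    if "S \<subseteq> V1 \<union> V2" "\<And>x y. \<lbrakk>x \<in> S; y \<in> S; x \<noteq> y\<rbrakk> \<Longrightarrow> \<delta> x y \<noteq> odot" for S
  proof (cases "S \<inter> V1 = {}")
    case False
    then obtain x where "x \<in> S" "x \<in> V1" by blast
    then have "y \<in> W" if "y \<in> S" for y
      using that adjW[of x y] \<open>S \<subseteq> V1 \<union> V2\<close> \<open>\<And>x y. \<lbrakk>x \<in> S; y \<in> S; x \<noteq> y\<rbrakk> \<Longrightarrow> \<delta> x y \<noteq> odot\<close>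
      by (cases "x = y") (auto simp: W_def)
    then show ?thesis by blast
  qed (use that in blast)
  show ?thesis
  proof (rule arboreal_mapI)
    show "\<delta> x x \<noteq> odot" if "x \<in> V1 \<union> V2" for x
      using that d1[of x x] d2[of x x] A.diag[of x] B.diag[of x] by auto
    show "\<delta> x y = \<delta> x z \<or> \<delta> x y = \<delta> y z \<or> \<delta> x z = \<delta> y z"
      if V: "x \<in> V1 \<union> V2" "y \<in> V1 \<union> V2" "z \<in> V1 \<union> V2" and dist: "distinct [x, y, z]"
        and *: "\<delta> x y \<noteq> odot" "\<delta> x z \<noteq> odot" "\<delta> y z \<noteq> odot" for x y z
    proof -
      have "{x, y, z} \<subseteq> W \<or> {x, y, z} \<subseteq> V2"
        using V * symU[OF V(1,2)] symU[OF V(1,3)] symU[OF V(2,3)] by (intro clique) auto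
      then show ?thesis
      proof
        assume "{x, y, z} \<subseteq> W"
        then show ?thesis using A.no_Delta[of "q x" "q y" "q z"] q dist * by (simp add: dW)
      next
        assume "{x, y, z} \<subseteq> V2"
        then show ?thesis using B.no_Delta[of x y z] * by (simp add: d2)
      qed
    qed
    show "\<delta> c e = \<delta> c a"
      if V: "a \<in> V1 \<union> V2" "b \<in> V1 \<union> V2" "c \<in> V1 \<union> V2" "e \<in> V1 \<union> V2" and dist: "distinct [a, b, c, e]"
        and *: "\<delta> a b \<noteq> odot" "\<delta> a c \<noteq> odot"
        "\<delta> a b = \<delta> b c" "\<delta> b c = \<delta> c e" "\<delta> c a = \<delta> a e" "\<delta> a e = \<delta> e b" for a b c e
    proof -
      note s = symU[OF V(1,2)] symU[OF V(1,3)] symU[OF V(1,4)] symU[OF V(2,3)] symU[OF V(2,4)] symU[OF V(3,4)]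
      have "{a, b, c, e} \<subseteq> W \<or> {a, b, c, e} \<subseteq> V2"
        using V * s by (intro clique) auto
      then show ?thesis
      proof
        assume W: "{a, b, c, e} \<subseteq> W"
        show ?thesis
          using A.no_Pi[of "q a" "q b" "q c" "q e"] W q dist * dW[of a b] dW[of b c] dW[of c e]
            dW[of c a] dW[of a c] dW[of a e] dW[of e b] by auto
      next
        assume "{a, b, c, e} \<subseteq> V2"
        then show ?thesis
          using B.no_Pi[of a b c e] * d2[of a b] d2[of b c] d2[of c e]
            d2[of c a] d2[of a c] d2[of a e] d2[of e b] by auto
      qed
    qed
    show "\<delta> x z = \<delta> y z \<and> \<delta> x u = \<delta> y u"
      if V: "x \<in> V1 \<union> V2" "y \<in> V1 \<union> V2" "z \<in> V1 \<union> V2" "u \<in> V1 \<union> V2" and dist: "distinct [x, y, z, u]"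
        and *: "\<delta> z u = odot" "\<delta> x y \<noteq> odot" "\<delta> x z \<noteq> odot" "\<delta> x u \<noteq> odot" "\<delta> y z \<noteq> odot" "\<delta> y u \<noteq> odot"
      for x y z u
    proof -
      have s: "\<delta> z x \<noteq> odot" "\<delta> u x \<noteq> odot" "\<delta> z y \<noteq> odot" "\<delta> u y \<noteq> odot" "\<delta> y x \<noteq> odot" using symU V * by auto
      have "{x, y, z, u} \<subseteq> W \<or> {x, y, z, u} \<subseteq> V2"
      proof (cases "z \<in> V1 \<or> u \<in> V1")
        case True
        then have xy: "x \<in> W" "y \<in> W" using adjW[of z x] adjW[of z y] adjW[of u x] adjW[of u y] V s by auto
        have "x \<in> V1 \<or> y \<in> V1" using xy dist by (auto simp: W_def)
        then have "z \<in> W" "u \<in> W" using adjW[of x z] adjW[of y z] adjW[of x u] adjW[of y u] V * by auto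
        then show ?thesis using xy by simp
      next
        case False
        then have zu: "z \<in> V2" "u \<in> V2" "z \<noteq> h \<or> u \<noteq> h" using V dist by auto
        then have "z \<notin> W \<or> u \<notin> W" using False by (auto simp: W_def)
        then have "x \<notin> V1" "y \<notin> V1" using adjW[of x z] adjW[of x u] adjW[of y z] adjW[of y u] V * by auto
        then show ?thesis using zu V by auto
      qed
      then show ?thesis
      proof
        assume W: "{x, y, z, u} \<subseteq> W"
        then show ?thesis
          using A.diamond[of "q x" "q y" "q z" "q u"] q dist * dW[of x y] dW[of x z] dW[of x u]
            dW[of y z] dW[of y u] dW[of z u] by auto
      next
        assume "{x, y, z, u} \<subseteq> V2"
        then show ?thesis
          using B.diamond[of x y z u] * d2[of x y] d2[of x z] d2[of x u]
            d2[of y z] d2[of y u] d2[of z u] by auto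
      qed
    qed
  qed (use metric symU in auto)
qed

section \<open>Twins and cut vertices\<close>

context arboreal_map
begin

lemma clique_split:
  assumes "finite S" "S \<subseteq> V" "card S \<ge> 2" "\<And>x y. \<lbrakk>x \<in> S; y \<in> S\<rbrakk> \<Longrightarrow> \<delta> x y \<noteq> odot"
  shows "\<exists>A B c. A \<noteq> {} \<and> B \<noteq> {} \<and> A \<inter> B = {} \<and> A \<union> B = S \<and> (\<forall>a\<in>A. \<forall>b\<in>B. \<delta> a b = c)"
  using assms
proof (induction S rule: finite_induct)
  case empty
  then show ?case by simp
next
  case (insert v S)
  have V: "v \<in> V" "\<And>x. x \<in> S \<Longrightarrow> x \<in> V" using insert.prems by auto
  have adj: "\<delta> x y \<noteq> odot" if "x \<in> insert v S" "y \<in> insert v S" for x y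
    using insert.prems(3) that by blast
  show ?case
  proof (cases "card S \<ge> 2")
    case False
    then have "card S = 1" using insert by simp
    then obtain a where "S = {a}" using card_1_singletonE by blast
    then show ?thesis using insert.hyps
      by (intro exI[of _ "{v}"] exI[of _ "{a}"] exI[of _ "\<delta> v a"]) auto
  next
    case True
    have "\<exists>A B c. A \<noteq> {} \<and> B \<noteq> {} \<and> A \<inter> B = {} \<and> A \<union> B = S \<and> (\<forall>a\<in>A. \<forall>b\<in>B. \<delta> a b = c)"
      by (rule insert.IH) (use V True adj in auto)
    then obtain A B c where AB: "A \<noteq> {}" "B \<noteq> {}" "A \<inter> B = {}" "A \<union> B = S"
      and c: "\<And>a b. \<lbrakk>a \<in> A; b \<in> B\<rbrakk> \<Longrightarrow> \<delta> a b = c"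
      by metis
    have S: "x \<in> V" if "x \<in> A \<or> x \<in> B" for x using that AB V by auto
    have c': "\<delta> b a = c" if "a \<in> A" "b \<in> B" for a b using c sym that S by metis
    have tri: "\<delta> v a = \<delta> v b \<or> \<delta> v a = c \<or> \<delta> v b = c" if "a \<in> A" "b \<in> B" for a b
      using no_Delta[of v a b] that S V adj c[OF that] AB(4) by blast
    consider "\<forall>a\<in>A. \<delta> v a = c" | "\<forall>b\<in>B. \<delta> v b = c"
      | a0 b0 where "a0 \<in> A" "b0 \<in> B" "\<delta> v a0 \<noteq> c" "\<delta> v b0 \<noteq> c" by blast
    then show ?thesis
    proof cases
      case 1
      then show ?thesis using AB c sym V S insert.hyps
        by (intro exI[of _ A] exI[of _ "insert v B"] exI[of _ c]) auto
    next
      case 2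
      then show ?thesis using AB c V insert.hyps
        by (intro exI[of _ "insert v A"] exI[of _ B] exI[of _ c]) auto
    next
      case 3
      define e where "e = \<delta> v a0"
      have e: "\<delta> v a0 = e" "\<delta> v b0 = e" "e \<noteq> c" using 3 tri[of a0 b0] by (auto simp: e_def)
      have col: "\<delta> v z = e \<or> \<delta> v z = c" if "z \<in> S" for z
      proof -
        have "z \<in> A \<or> z \<in> B" using that AB(4) by blast
        then show ?thesis using tri[of a0 z] tri[of z b0] 3(1,2) e by metis
      qed
      define P where "P = {z \<in> S. \<delta> v z = c}"
      define Q where "Q = {z \<in> S. \<delta> v z = e}"
      have PQ: "P \<union> Q = S" "P \<inter> Q = {}" using col e by (auto simp: P_def Q_def)
      show ?thesis
      proof (cases "P = {}")
        case True
        then have "\<forall>b\<in>S. \<delta> v b = e" "S \<noteq> {}" using PQ(1) AB(1,4) by (auto simp: Q_def)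
        then show ?thesis using insert.hyps(2)
          by (intro exI[of _ "{v}"] exI[of _ S] exI[of _ e]) simp
      next
        case False
        have same: "\<delta> z w = c"
          if zw: "z \<in> P" "w \<in> Q" and b: "b \<in> S" "\<delta> v b = e" "\<delta> z b = c" "\<delta> b w = c" for z w b
        proof (rule ccontr)
          assume ne: "\<delta> z w \<noteq> c"
          have z: "z \<in> S" "w \<in> S" "\<delta> v z = c" "\<delta> v w = e" using zw by (auto simp: P_def Q_def)
          have "\<delta> z w = e" using no_Delta[of v z w] z V adj[of v z] adj[of v w] adj[of z w] ne e by auto
          then show False
            using no_Pi[of z w v b] z V b e sym[of v w] sym[of v z] adj[of z w] adj[of v z]
            by auto
        qed
        have "\<delta> z w = c" if zw: "z \<in> P" "w \<in> insert v Q" for z w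
        proof (cases "w = v")
          case True
          then show ?thesis using zw V sym by (auto simp: P_def)
        next
          case False
          then have w: "z \<in> P" "w \<in> Q" "z \<in> S" "w \<in> S" using zw by (auto simp: P_def Q_def)
          consider "z \<in> A" "w \<in> A" | "z \<in> B" "w \<in> B" | "z \<in> A" "w \<in> B" | "z \<in> B" "w \<in> A"
            using w AB by auto
          then show ?thesis
          proof cases
            case 1
            then show ?thesis using same[OF w(1,2), of b0] 3 c c' e AB by auto
          next
            case 2
            then show ?thesis using same[OF w(1,2), of a0] 3 c c' e AB by auto
          qed (use c c' in auto)
        qed
        then show ?thesis using False PQ insert.hyps
          by (intro exI[of _ P] exI[of _ "insert v Q"] exI[of _ c]) auto
      qed
    qed
  qed
qed

lemma clique_twins:
  assumes "finite S" "S \<subseteq> V" "card S \<ge> 2" "\<And>x y. \<lbrakk>x \<in> S; y \<in> S\<rbrakk> \<Longrightarrow> \<delta> x y \<noteq> odot"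
  shows "\<exists>x\<in>S. \<exists>y\<in>S. x \<noteq> y \<and> (\<forall>z\<in>S - {x, y}. \<delta> x z = \<delta> y z)"
  using assms
proof (induction S rule: finite_psubset_induct)
  case (psubset S)
  obtain A B c where AB: "A \<noteq> {}" "B \<noteq> {}" "A \<inter> B = {}" "A \<union> B = S"
    and c: "\<And>a b. \<lbrakk>a \<in> A; b \<in> B\<rbrakk> \<Longrightarrow> \<delta> a b = c"
    using clique_split[OF psubset.hyps psubset.prems] by blast
  have c': "\<delta> b a = c" if "a \<in> A" "b \<in> B" for a b
  proof -
    have "a \<in> V" "b \<in> V" using that AB psubset.prems(1) by auto
    then show ?thesis using c[OF that] sym[of a b] by simp
  qed
  have fin: "finite A" "finite B" using AB psubset.hyps by (auto intro: finite_subset)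
  consider "card A \<ge> 2" | "card B \<ge> 2" | "card A = 1" "card B = 1"
    using AB fin by (metis One_nat_def Suc_leI card_gt_0_iff le_antisym not_less_eq_eq numeral_2_eq_2)
  then show ?case
  proof cases
    case 1
    have "\<exists>x\<in>A. \<exists>y\<in>A. x \<noteq> y \<and> (\<forall>z\<in>A - {x, y}. \<delta> x z = \<delta> y z)"
      using AB psubset.prems(1,3) by (intro psubset.IH 1) auto
    then show ?thesis using AB c by (metis DiffD1 DiffD2 DiffI UnE UnI1)
  next
    case 2
    have "\<exists>x\<in>B. \<exists>y\<in>B. x \<noteq> y \<and> (\<forall>z\<in>B - {x, y}. \<delta> x z = \<delta> y z)"
      using AB psubset.prems(1,3) by (intro psubset.IH 2) auto
    then show ?thesis using AB c' by (metis DiffD1 DiffD2 DiffI UnE UnI2)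
  next
    case 3
    then obtain a b where "A = {a}" "B = {b}" by (metis card_1_singletonE)
    then show ?thesis using AB by (intro bexI[of _ a] bexI[of _ b]) auto
  qed
qed

definition adj :: "'a \<Rightarrow> 'a \<Rightarrow> bool" where "adj x y \<longleftrightarrow> \<delta> x y \<noteq> odot"

definition common :: "'a \<Rightarrow> 'a \<Rightarrow> 'a set" where "common a b = {x \<in> V. adj a x \<and> adj b x}"

lemma adj_sym: "\<lbrakk>x \<in> V; y \<in> V\<rbrakk> \<Longrightarrow> adj x y \<longleftrightarrow> adj y x"
  using sym by (simp add: adj_def)

lemma adj_refl: "x \<in> V \<Longrightarrow> adj x x"
  using diag by (simp add: adj_def)

lemma adj_metric: obtains D where "graph_metric V adj D" "ptolemaic_on V D"
  using metric unfolding adj_def[abs_def] by blast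

text \<open>Covers both the induced four-cycle (with \<open>s = u\<close>) and the gem.\<close>

lemma no_gem:
  assumes V: "x \<in> V" "y \<in> V" "z \<in> V" "u \<in> V" "s \<in> V"
    and "adj x y" "adj y z" "adj z u" "adj s x" "adj s u"
  shows "adj x z \<or> adj y u"
proof (rule ccontr)
  assume no: "\<not> ?thesis"
  obtain D where D: "graph_metric V adj D" and P: "ptolemaic_on V D" by (rule adj_metric)
  interpret graph_metric V adj D by (rule D)
  have "x \<noteq> z" "y \<noteq> u" using no adj_refl V by auto
  then have "D x z \<ge> 2" "D y u \<ge> 2" using no V D_ge_2 by auto
  then have "2 * 2 \<le> D x z * D y u" by (intro mult_mono) auto
  also have "\<dots> \<le> D x y * D z u + D x u * D y z" by (rule ptolemaic_onD[OF P]) (use V in auto)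
  also have "\<dots> \<le> 1 * 1 + 2 * 1"
  proof (intro add_mono mult_mono)
    show "D x u \<le> 2"
      using D_triangle[of x s u] D_adj[of x s] D_adj[of s u] adj_sym[of x s] V assms by auto
  qed (use D_adj V assms in auto)
  finally show False by simp
qed

lemma common_clique:
  assumes "a \<in> V" "b \<in> V" "\<not> adj a b" "x \<in> common a b" "y \<in> common a b"
  shows "adj x y"
  using no_gem[of x a y b b] assms adj_refl adj_sym unfolding common_def by blast

lemma common_module:
  assumes fin: "finite V" and ab: "a \<in> V" "b \<in> V" "\<not> adj a b"
    and minimal: "\<And>a' b'. \<lbrakk>a' \<in> V; b' \<in> V; \<not> adj a' b'; common a' b' \<noteq> {}\<rbrakk>
      \<Longrightarrow> card (common a b) \<le> card (common a' b')"
    and z: "z \<in> V" "z \<notin> common a b" and x: "x \<in> common a b" and y: "y \<in> common a b"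
    and zx: "adj z x"
  shows "adj z y"
proof (rule ccontr)
  assume zy: "\<not> adj z y"
  have V: "x \<in> V" "y \<in> V" "adj a x" "adj b x" "adj a y" "adj b y" using x y by (auto simp: common_def)
  have xz: "adj x z" "adj x a" "adj x b" "adj y a" "adj y b" using adj_sym V ab z zx by blast+
  have za: "\<not> adj z a" using no_gem[of z a y b x] V ab z xz zy by blast
  have zb: "\<not> adj z b" using no_gem[of z b y a x] V ab z xz zy adj_sym by blast
  have "x \<in> common z a" using V zx by (simp add: common_def)
  then have "card (common a b) \<le> card (common z a)" using minimal[of z a] za z ab by blast
  moreover have "y \<notin> common z a" using zy by (simp add: common_def)
  moreover have "finite (common a b)" using fin by (simp add: common_def)
  ultimately have "\<not> common z a \<subseteq> common a b"
    using y by (metis psubsetI psubset_card_mono leD)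
  then obtain w where w: "w \<in> V" "adj z w" "adj a w" "\<not> adj b w" by (auto simp: common_def)
  have w': "adj w a" "\<not> adj w b" using adj_sym w ab by blast+
  have "adj x y" by (rule common_clique[OF ab x y])
  then have "adj w y" using no_gem[of z w a y x] V ab z xz w w' za by blast
  then show False using no_gem[of z w y b x] V ab z xz w w' zy by blast
qed

lemma induced_path_dist:
  assumes "graph_metric V adj D" "ptolemaic_on V D"
    and V: "\<And>i. i \<le> n \<Longrightarrow> g i \<in> V" and "g 0 \<noteq> g 1"
    and adj: "\<And>i. i < n \<Longrightarrow> adj (g i) (g (Suc i))"
    and ind: "\<And>i. Suc i < n \<Longrightarrow> \<not> adj (g i) (g (Suc (Suc i)))"
  shows "i \<le> n \<Longrightarrow> D (g i) (g 0) = i"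
proof (induction i rule: less_induct)
  case (less i)
  interpret graph_metric V adj D by fact
  consider "i = 0" | "i = 1" | j where "i = Suc (Suc j)" by (metis One_nat_def not0_implies_Suc)
  then show ?case
  proof cases
    case 1
    then show ?thesis using V by simp
  next
    case 2
    then show ?thesis using less.prems adj[of 0] V[of 0] V[of 1] adj_sym assms(4) D_eq_1[of "g 1" "g 0"] by auto
  next
    case 3
    have Vj: "g j \<in> V" "g (Suc j) \<in> V" "g i \<in> V" "g 0 \<in> V" using V less.prems 3 by auto
    have IH: "D (g j) (g 0) = j" "D (g (Suc j)) (g 0) = Suc j" using less 3 by auto
    have a: "adj (g j) (g (Suc j))" "adj (g (Suc j)) (g i)" "\<not> adj (g j) (g i)"
      using adj[of j] adj[of "Suc j"] ind[of j] less.prems 3 by auto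
    have a': "adj (g (Suc j)) (g j)" "adj (g i) (g (Suc j))" using a adj_sym Vj by blast+
    have "g j \<noteq> g i" using a adj_refl Vj by metis
    then have "2 * Suc j \<le> D (g i) (g j) * D (g (Suc j)) (g 0)"
      unfolding IH using a adj_sym Vj by (intro mult_mono D_ge_2) auto
    also have "\<dots> \<le> D (g i) (g (Suc j)) * D (g j) (g 0) + D (g i) (g 0) * D (g (Suc j)) (g j)"
      by (rule ptolemaic_onD[OF assms(2)]) (use Vj in auto)
    also have "\<dots> \<le> 1 * j + D (g i) (g 0) * 1"
      unfolding IH by (intro add_mono mult_mono D_adj) (use Vj a' in auto)
    finally have "D (g i) (g 0) \<ge> i" using 3 by simp
    moreover have "D (g i) (g 0) \<le> Suc (D (g (Suc j)) (g 0))"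
      using Vj a' by (intro D_step)
    ultimately show ?thesis using IH 3 by simp
  qed
qed

lemma common_singleton_cut:
  assumes "a \<in> V" "b \<in> V" "\<not> adj a b" "common a b = {s}"
  shows "(a, b) \<notin> {(x, y). x \<in> V - {s} \<and> y \<in> V - {s} \<and> adj x y} ^^ k"
  using assms
proof (induction k arbitrary: a rule: less_induct)
  case (less k)
  let ?R = "{(x, y). x \<in> V - {s} \<and> y \<in> V - {s} \<and> adj x y}"
  note ab = less.prems
  have s: "s \<in> V" "adj a s" "adj b s" "adj s a" "adj s b" "s \<noteq> a"
    using ab adj_sym adj_refl unfolding common_def by blast+
  show ?case
  proof
    assume "(a, b) \<in> ?R ^^ k"
    then obtain f where f: "f 0 = a" "f k = b" "\<And>i. i < k \<Longrightarrow> (f i, f (Suc i)) \<in> ?R"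
      unfolding relpow_fun_conv by blast
    have seg: "(f i, f (i + m)) \<in> ?R ^^ m" if "i + m \<le> k" for i m
      unfolding relpow_fun_conv using f(3) that by (intro exI[of _ "\<lambda>j. f (i + j)"]) auto
    have k: "k \<noteq> 0" "k \<noteq> 1" using ab f adj_refl f(3)[of 0] by (auto intro: Nat.gr0I)
    have fV: "f i \<in> V" if "i \<le> k" for i
      using that f(3)[of i] f(2) ab by (cases "i = k") auto
    have fadj: "adj (f i) (f (Suc i))" if "i < k" for i using f(3)[OF that] by simp
    have ind: "\<not> adj (f i) (f (Suc (Suc i)))" if i: "Suc i < k" for i
    proof
      assume "adj (f i) (f (Suc (Suc i)))"
      moreover have "(f i, f (Suc i)) \<in> ?R" "(f (Suc i), f (Suc (Suc i))) \<in> ?R" using f(3) i by auto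
      ultimately have "(f i, f (Suc (Suc i))) \<in> ?R" by auto
      then have "(f 0, f (Suc (Suc i))) \<in> ?R ^^ Suc i"
        using seg[of 0 i] i by (auto intro: relpow_Suc_I)
      moreover have "(f (Suc (Suc i)), f k) \<in> ?R ^^ (k - Suc (Suc i))"
      proof -
        have "Suc (Suc i) + (k - Suc (Suc i)) = k" using i by simp
        then show ?thesis using seg[of "Suc (Suc i)" "k - Suc (Suc i)"] by (metis order_refl)
      qed
      ultimately have "(f 0, f k) \<in> ?R ^^ (Suc i + (k - Suc (Suc i)))"
        unfolding relpow_add by (rule relcompI)
      moreover have "Suc i + (k - Suc (Suc i)) = k - 1" using i by simp
      ultimately have "(a, b) \<in> ?R ^^ (k - 1)" unfolding f(1,2) by (simp only:)
      then show False using less.IH[of "k - 1" a] k ab by simp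
    qed
    show False
    proof (cases "adj s (f 1)")
      case False
      obtain D where D: "graph_metric V adj D" and P: "ptolemaic_on V D" by (rule adj_metric)
      interpret graph_metric V adj D by (rule D)
      define g where "g i = (case i of 0 \<Rightarrow> s | Suc j \<Rightarrow> f j)" for i
      have "D (g (Suc k)) (g 0) = Suc k"
      proof (rule induced_path_dist[OF D P, of "Suc k"])
        show "g i \<in> V" if "i \<le> Suc k" for i using that s fV by (auto simp: g_def split: nat.split)
        show "g 0 \<noteq> g 1" using s f by (simp add: g_def)
        show "adj (g i) (g (Suc i))" if "i < Suc k" for i
          using that s f fadj by (auto simp: g_def split: nat.split)
        show "\<not> adj (g i) (g (Suc (Suc i)))" if "Suc i < Suc k" for i
          using that False ind by (auto simp: g_def split: nat.split)
      qed simp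
      then show False using D_adj[of b s] s ab f k by (simp add: g_def)
    next
      case True
      have v: "f 1 \<in> V" "f 1 \<noteq> s" "adj a (f 1)" using f(3)[of 0] f(1) k by auto
      have vb: "\<not> adj (f 1) b"
      proof
        assume "adj (f 1) b"
        then have "f 1 \<in> common a b" using v ab(2) adj_sym by (simp add: common_def)
        then show False using v ab by simp
      qed
      have "s \<in> common (f 1) b" using s v True adj_sym by (simp add: common_def)
      moreover have "common (f 1) b \<noteq> {s}"
      proof
        assume "common (f 1) b = {s}"
        moreover have "(f 1, b) \<in> ?R ^^ (k - 1)" using seg[of 1 "k - 1"] k f(2) by simp
        ultimately show False using less.IH[of "k - 1" "f 1"] v vb ab k by auto
      qed
      ultimately obtain t where t: "t \<in> V" "t \<noteq> s" "adj (f 1) t" "adj b t"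
        unfolding common_def by blast
      have "adj a t \<or> adj (f 1) b"
        using no_gem[of a "f 1" t b s] s v t ab adj_sym by blast
      then have "t \<in> common a b" using vb t by (simp add: common_def)
      then show False using ab t by simp
    qed
  qed
qed

theorem twins_or_cut_vertex:
  assumes fin: "finite V" and card: "card V \<ge> 2"
  shows "(\<exists>x\<in>V. \<exists>y\<in>V. x \<noteq> y \<and> \<delta> x y \<noteq> odot \<and> (\<forall>z\<in>V - {x, y}. \<delta> x z = \<delta> y z)) \<or>
    (\<exists>s\<in>V. \<exists>A B. A \<noteq> {} \<and> B \<noteq> {} \<and> A \<inter> B = {} \<and> A \<union> B = V - {s} \<and> (\<forall>a\<in>A. \<forall>b\<in>B. \<delta> a b = odot))"
    (is "?twins \<or> ?cut")
proof (cases "\<forall>x\<in>V. \<forall>y\<in>V. adj x y")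
  case True
  then have ?twins using clique_twins[OF fin subset_refl card] unfolding adj_def by blast
  then show ?thesis ..
next
  case False
  then obtain x y where xy: "x \<in> V" "y \<in> V" "\<not> adj x y" by blast
  obtain D where D: "graph_metric V adj D" and P: "ptolemaic_on V D" by (rule adj_metric)
  interpret D: graph_metric V adj D by (rule D)
  have "D x y \<ge> 2" using xy adj_refl by (intro D.D_ge_2) auto
  then obtain m where m: "D x y = Suc (Suc m)"
    by (metis Suc_le_D numeral_2_eq_2 Suc_le_mono)
  then obtain x1 where x1: "x1 \<in> V" "adj x x1" "D x1 y = Suc m" using D.D_pred xy by blast
  then obtain x2 where x2: "x2 \<in> V" "adj x1 x2" "D x2 y = m" using D.D_pred xy by blast
  have "\<not> adj x x2" using D.D_step[of x x2 y] m x2 xy by auto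
  moreover have "x1 \<in> common x x2" using x1 x2 adj_sym by (simp add: common_def)
  ultimately have "(\<lambda>(a, b). a \<in> V \<and> b \<in> V \<and> \<not> adj a b \<and> common a b \<noteq> {}) (x, x2)"
    using xy x2 by auto
  from ex_has_least_nat[of "\<lambda>(a, b). a \<in> V \<and> b \<in> V \<and> \<not> adj a b \<and> common a b \<noteq> {}", OF this,
      of "\<lambda>(a, b). card (common a b)"]
  obtain a b where ab: "a \<in> V" "b \<in> V" "\<not> adj a b" "common a b \<noteq> {}"
    and minimal: "\<And>a' b'. \<lbrakk>a' \<in> V; b' \<in> V; \<not> adj a' b'; common a' b' \<noteq> {}\<rbrakk>
      \<Longrightarrow> card (common a b) \<le> card (common a' b')"
    unfolding split_paired_Ex split_paired_All prod.case by blast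
  let ?S = "common a b"
  have S: "?S \<subseteq> V" "finite ?S" using fin by (auto simp: common_def)
  have clique: "\<delta> x y \<noteq> odot" if "x \<in> ?S" "y \<in> ?S" for x y
    using common_clique[OF ab(1-3) that] by (simp add: adj_def)
  have module: "adj z y" if "z \<in> V" "z \<notin> ?S" "x \<in> ?S" "y \<in> ?S" "adj z x" for x y z
    using common_module[OF fin ab(1-3) minimal that] .
  show ?thesis
  proof (cases "card ?S \<ge> 2")
    case True
    obtain x y where xy: "x \<in> ?S" "y \<in> ?S" "x \<noteq> y" and tw: "\<And>z. z \<in> ?S - {x, y} \<Longrightarrow> \<delta> x z = \<delta> y z"
      using clique_twins[OF S(2,1) True clique] by blast
    have xyV: "x \<in> V" "y \<in> V" "adj x a" "adj x b" "adj y a" "adj y b"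
      using xy ab adj_sym by (auto simp: common_def)
    have "\<delta> x z = \<delta> y z" if z: "z \<in> V" "z \<notin> {x, y}" for z
    proof (cases "z \<in> ?S")
      case True
      then show ?thesis using tw z by blast
    next
      case False
      show ?thesis
      proof (cases "adj z x")
        case True
        then have zy: "adj z y" using module z False xy by blast
        obtain c where "c \<in> V" "\<delta> z c = odot" "adj x c" "adj y c"
          using False z xyV ab adj_sym unfolding common_def adj_def by blast
        then show ?thesis using diamond[of x y z c] True zy clique[OF xy(1,2)] z xyV(1,2) sym
          by (simp add: adj_def)
      next
        case nx: False
        then have "\<not> adj z y" using module z False xy by blast
        then show ?thesis using nx xyV z sym by (simp add: adj_def)
      qed
    qed
    then have ?twins using xy xyV clique by blast
    then show ?thesis ..
  next
    case False
    then have "card ?S = 1" using ab(4) S(2) by (simp add: card_gt_0_iff le_Suc_eq not_le less_Suc_eq numeral_2_eq_2)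
    then obtain s where s: "?S = {s}" using card_1_singletonE by blast
    let ?R = "{(x, y). x \<in> V - {s} \<and> y \<in> V - {s} \<and> adj x y}"
    define A where "A = {x. (a, x) \<in> ?R\<^sup>*}"
    have sV: "s \<in> V" "s \<noteq> a" "s \<noteq> b" using s ab adj_sym unfolding common_def by blast+
    have AV: "A \<subseteq> V - {s}"
    proof
      fix x assume "x \<in> A"
      then have "(a, x) \<in> ?R\<^sup>*" by (simp add: A_def)
      then show "x \<in> V - {s}" by (cases rule: rtranclE) (use ab sV in auto)
    qed
    have "b \<notin> A"
      using common_singleton_cut[OF ab(1-3) s] by (auto simp: A_def dest: rtrancl_imp_relpow)
    moreover have "\<delta> x y = odot" if "x \<in> A" "y \<in> V - {s} - A" for x y
    proof (rule ccontr)
      assume "\<delta> x y \<noteq> odot"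
      then have "(x, y) \<in> ?R" using that AV by (auto simp: adj_def)
      then have "y \<in> A" using that(1) unfolding A_def by (auto intro: rtrancl_into_rtrancl)
      then show False using that by simp
    qed
    moreover have "a \<in> A" by (simp add: A_def)
    ultimately have ?cut using AV sV ab
      by (intro bexI[of _ s] exI[of _ A] exI[of _ "V - {s} - A"]) auto
    then show ?thesis ..
  qed
qed

end

section \<open>Oriented trees\<close>

abbreviation linked :: "('v \<times> 'v) set \<Rightarrow> ('v \<times> 'v) set" where
  "linked E \<equiv> (E \<union> E\<inverse>)\<^sup>*"

text \<open>Acyclicity of the underlying graph is expressed by saying that every arc is a bridge.\<close>

definition oriented_tree :: "'v set \<Rightarrow> ('v \<times> 'v) set \<Rightarrow> bool" where
  "oriented_tree V E \<longleftrightarrow> finite V \<and> V \<noteq> {} \<and> E \<subseteq> V \<times> V \<and> (\<forall>a\<in>V. \<forall>b\<in>V. (a, b) \<in> linked E) \<and>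
     (\<forall>a b. (a, b) \<in> E \<longrightarrow> (a, b) \<notin> linked (E - {(a, b)}))"

lemma linked_sym: "(a, b) \<in> linked E \<Longrightarrow> (b, a) \<in> linked E"
  by (metis sym_Un_converse sym_rtrancl symD)

lemma linked_mono: "\<lbrakk>E \<subseteq> F; (a, b) \<in> linked E\<rbrakk> \<Longrightarrow> (a, b) \<in> linked F"
  using rtrancl_mono[of "E \<union> E\<inverse>" "F \<union> F\<inverse>"] by auto

lemma rtrancl_image:
  assumes "(u, v) \<in> R\<^sup>*" "\<And>a b. (a, b) \<in> R \<Longrightarrow> (f a, f b) \<in> S\<^sup>*"
  shows "(f u, f v) \<in> S\<^sup>*"
  using assms(1) by induction (auto intro: assms(2) rtrancl_trans)

lemma rtrancl_closed:
  assumes "(u, v) \<in> E\<^sup>*" "E \<subseteq> V \<times> V"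
  shows "u = v \<or> u \<in> V \<and> v \<in> V"
  using assms by induction auto

lemma
  assumes "oriented_tree V E"
  shows oriented_tree_finite: "finite V" and oriented_tree_nonempty: "V \<noteq> {}"
    and oriented_tree_arcs: "E \<subseteq> V \<times> V" and oriented_tree_finite_arcs: "finite E"
    and oriented_tree_linked: "\<lbrakk>a \<in> V; b \<in> V\<rbrakk> \<Longrightarrow> (a, b) \<in> linked E"
    and oriented_tree_bridge: "(a, b) \<in> E \<Longrightarrow> (a, b) \<notin> linked (E - {(a, b)})"
  using assms finite_subset[of E "V \<times> V"] by (auto simp: oriented_tree_def)

lemma oriented_tree_acyclic:
  assumes "oriented_tree V E"
  shows "acyclic E"
proof (rule acyclicI, rule allI, rule notI)
  fix a assume "(a, a) \<in> E\<^sup>+"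
  then obtain b where ab: "(a, b) \<in> E" "(b, a) \<in> E\<^sup>*" by (meson tranclD)
  have "(z, a) \<in> (E - {(a, b)})\<^sup>*" if "(z, a) \<in> E\<^sup>*" for z
    using that
  proof (induction rule: converse_rtrancl_induct)
    case (step y z)
    show ?case
    proof (cases "(y, z) = (a, b)")
      case False
      then have "(y, z) \<in> E - {(a, b)}" using step.hyps(1) by simp
      then show ?thesis using step.IH by (rule converse_rtrancl_into_rtrancl)
    qed simp
  qed simp
  from this[OF ab(2)] have "(b, a) \<in> linked (E - {(a, b)})"
    by (rule subsetD[OF rtrancl_mono[OF Un_upper1]])
  then have "(a, b) \<in> linked (E - {(a, b)})" by (rule linked_sym)
  with oriented_tree_bridge[OF assms ab(1)] show False by contradiction
qed

lemma oriented_tree_component: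
  assumes T: "oriented_tree V E" and F: "F \<subseteq> E" and c: "c \<in> V"
  defines "C \<equiv> {v. (c, v) \<in> linked F}"
  shows "oriented_tree C (F \<inter> C \<times> C)"
  unfolding oriented_tree_def
proof (intro conjI ballI allI impI)
  have CV: "C \<subseteq> V"
  proof
    fix v assume "v \<in> C"
    then have "(c, v) \<in> linked F" by (simp add: C_def)
    moreover have "F \<union> F\<inverse> \<subseteq> V \<times> V" using F oriented_tree_arcs[OF T] by auto
    ultimately show "v \<in> V" using rtrancl_closed c by metis
  qed
  then show "finite C" using oriented_tree_finite[OF T] by (rule finite_subset)
  show "C \<noteq> {}" by (auto simp: C_def)
  show "F \<inter> C \<times> C \<subseteq> C \<times> C" by simp
  have to: "(c, v) \<in> linked (F \<inter> C \<times> C)" if "(c, v) \<in> linked F" for v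
    using that
  proof (induction rule: rtrancl_induct)
    case (step v w)
    then have "v \<in> C" "w \<in> C" by (auto simp: C_def intro: rtrancl_into_rtrancl)
    then have "(v, w) \<in> F \<inter> C \<times> C \<union> (F \<inter> C \<times> C)\<inverse>" using step.hyps by auto
    then show ?case using step.IH by (rule rtrancl_into_rtrancl[rotated])
  qed simp
  fix a b
  show "(a, b) \<in> linked (F \<inter> C \<times> C)" if "a \<in> C" "b \<in> C"
  proof -
    have "(c, a) \<in> linked (F \<inter> C \<times> C)" "(c, b) \<in> linked (F \<inter> C \<times> C)"
      using to that by (simp_all add: C_def)
    then show ?thesis by (blast intro: rtrancl_trans[OF linked_sym])
  qed
  show "(a, b) \<notin> linked (F \<inter> C \<times> C - {(a, b)})" if "(a, b) \<in> F \<inter> C \<times> C"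
    using oriented_tree_bridge[OF T, of a b] that F
      linked_mono[of "F \<inter> C \<times> C - {(a, b)}" "E - {(a, b)}" a b] by blast
qed

lemma oriented_tree_induct [consumes 1, case_names single join]:
  assumes "oriented_tree V E"
    and single: "\<And>v. P {v} {}"
    and join: "\<And>V1 E1 V2 E2 p h. \<lbrakk>oriented_tree V1 E1; oriented_tree V2 E2; V1 \<inter> V2 = {};
        p \<in> V1; h \<in> V2; h \<notin> Domain E2; oriented_tree (V1 \<union> V2) (insert (p, h) (E1 \<union> E2));
        P V1 E1; P V2 E2\<rbrakk> \<Longrightarrow> P (V1 \<union> V2) (insert (p, h) (E1 \<union> E2))"
  shows "P V E"
  using assms(1)
proof (induction "card V" arbitrary: V E rule: less_induct)
  case less
  note T = less.prems
  show ?case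
  proof (cases "E = {}")
    case True
    have "\<exists>v. V = {v}"
      using oriented_tree_nonempty[OF T] oriented_tree_linked[OF T] True by fastforce
    then show ?thesis using True single by auto
  next
    case False
    have "wf (E\<inverse>)"
      using oriented_tree_acyclic[OF T] oriented_tree_finite_arcs[OF T] by (rule finite_acyclic_wf_converse[rotated])
    then obtain h where h: "h \<in> Range E" "\<And>y. (y, h) \<in> E\<inverse> \<Longrightarrow> y \<notin> Range E"
      using False wfE_min[of "E\<inverse>" _ "Range E"] by (metis Range_empty_iff ex_in_conv)
    then obtain p where p: "(p, h) \<in> E" by auto
    have sink: "h \<notin> Domain E" using h(2) by auto
    have pV: "p \<in> V" "h \<in> V" using p oriented_tree_arcs[OF T] by auto
    define F where "F = E - {(p, h)}"
    define V1 where "V1 = {v. (p, v) \<in> linked F}"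
    define V2 where "V2 = {v. (h, v) \<in> linked F}"
    define E1 where "E1 = F \<inter> V1 \<times> V1"
    define E2 where "E2 = F \<inter> V2 \<times> V2"
    have FE: "F \<subseteq> E" by (auto simp: F_def)
    have T1: "oriented_tree V1 E1" and T2: "oriented_tree V2 E2"
      unfolding E1_def E2_def V1_def V2_def
      using oriented_tree_component[OF T FE] pV by auto
    have disj: "V1 \<inter> V2 = {}"
    proof (rule ccontr)
      assume "V1 \<inter> V2 \<noteq> {}"
      then obtain v where "(p, v) \<in> linked F" "(h, v) \<in> linked F" by (auto simp: V1_def V2_def)
      then have "(p, h) \<in> linked F" using linked_sym rtrancl_trans by metis
      then show False using oriented_tree_bridge[OF T p] by (simp add: F_def)
    qed
    have cl1: "w \<in> V1" if "v \<in> V1" "(v, w) \<in> F \<union> F\<inverse>" for v w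
      using that by (auto simp: V1_def intro: rtrancl_into_rtrancl)
    have cl2: "w \<in> V2" if "v \<in> V2" "(v, w) \<in> F \<union> F\<inverse>" for v w
      using that by (auto simp: V2_def intro: rtrancl_into_rtrancl)
    have ph: "p \<in> V1" "h \<in> V2" by (auto simp: V1_def V2_def)
    have "v \<in> V1 \<union> V2" if "(p, v) \<in> linked E" for v
      using that
    proof (induction rule: rtrancl_induct)
      case (step v w)
      have "(v, w) \<in> F \<union> F\<inverse> \<or> w = h \<or> w = p" using step.hyps by (auto simp: F_def)
      then show ?case using step.IH cl1 cl2 ph by blast
    qed (use ph in simp)
    then have "V \<subseteq> V1 \<union> V2" using oriented_tree_linked[OF T pV(1)] by blast
    moreover have "V1 \<union> V2 \<subseteq> V"
      using FE oriented_tree_arcs[OF T] pV rtrancl_closed[of _ _ "F \<union> F\<inverse>" V]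
      unfolding V1_def V2_def by fastforce
    ultimately have V: "V = V1 \<union> V2" by blast
    have "F \<subseteq> E1 \<union> E2"
    proof
      fix e assume e: "e \<in> F"
      obtain a b where ab: "e = (a, b)" by (cases e)
      then have "a \<in> V1 \<union> V2" using e FE V oriented_tree_arcs[OF T] by auto
      then show "e \<in> E1 \<union> E2" using e ab cl1[of a b] cl2[of a b] by (auto simp: E1_def E2_def)
    qed
    then have E: "E = insert (p, h) (E1 \<union> E2)" using p by (auto simp: E1_def E2_def F_def)
    have "card V1 < card V" "card V2 < card V"
      using V ph disj oriented_tree_finite[OF T] by (auto intro!: psubset_card_mono)
    then have "P V1 E1" "P V2 E2" using less.hyps T1 T2 by blast+
    then show ?thesis using join[of V1 E1 V2 E2 p h] T1 T2 disj ph sink T E V by auto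
  qed
qed

definition lca_of :: "('v \<times> 'v) set \<Rightarrow> 'v \<Rightarrow> 'v \<Rightarrow> 'v \<Rightarrow> bool" where
  "lca_of E x y v \<longleftrightarrow> (v, x) \<in> E\<^sup>* \<and> (v, y) \<in> E\<^sup>* \<and>
     (\<forall>c. (v, c) \<in> E \<longrightarrow> \<not> ((c, x) \<in> E\<^sup>* \<and> (c, y) \<in> E\<^sup>*))"

lemma lca_of_commute: "lca_of E x y = lca_of E y x"
  by (auto simp: lca_of_def fun_eq_iff)

lemma lca_of_self: "acyclic E \<Longrightarrow> lca_of E x x v \<longleftrightarrow> v = x"
  unfolding lca_of_def acyclic_def
  by (metis converse_rtranclE rtrancl.rtrancl_refl rtrancl_into_trancl2)

lemma lca_of_exists:
  assumes "finite E" "acyclic E" "(v, x) \<in> E\<^sup>*" "(v, y) \<in> E\<^sup>*"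
  shows "\<exists>w. lca_of E x y w"
proof -
  have "wf (E\<inverse>)" using assms(1,2) by (rule finite_acyclic_wf_converse)
  then show ?thesis using assms(3,4)
  proof (induction v rule: wf_induct_rule)
    case (less v)
    then show ?case by (cases "lca_of E x y v") (auto simp: lca_of_def)
  qed
qed

lemma lca_of_join:
  assumes T1: "oriented_tree V1 E1" and T2: "oriented_tree V2 E2" and disj: "V1 \<inter> V2 = {}"
    and p: "p \<in> V1" and h: "h \<in> V2" "h \<notin> Domain E2"
    and T: "oriented_tree (V1 \<union> V2) (insert (p, h) (E1 \<union> E2))"
  defines "E \<equiv> insert (p, h) (E1 \<union> E2)"
  shows lca_of_join_11: "\<lbrakk>x \<in> V1; y \<in> V1\<rbrakk> \<Longrightarrow> lca_of E x y = lca_of E1 x y"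
    and lca_of_join_22: "\<lbrakk>x \<in> V2; y \<in> V2\<rbrakk> \<Longrightarrow> lca_of E x y = lca_of E2 x y"
    and lca_of_join_1h: "x \<in> V1 \<Longrightarrow> lca_of E x h = lca_of E1 x p"
    and lca_of_join_12: "\<lbrakk>x \<in> V1; y \<in> V2; y \<noteq> h\<rbrakk> \<Longrightarrow> \<not> lca_of E x y v"
proof -
  have E1: "E1 \<subseteq> V1 \<times> V1" and E2: "E2 \<subseteq> V2 \<times> V2" using T1 T2 by (auto dest: oriented_tree_arcs)
  have r1: "v \<in> V1 \<and> (u, v) \<in> E1\<^sup>* \<or> v = h \<and> (u, p) \<in> E1\<^sup>*" if "u \<in> V1" "(u, v) \<in> E\<^sup>*" for u v
    using that(2)
  proof (induction rule: rtrancl_induct)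
    case (step v w)
    show ?case
    proof (cases "v = h")
      case True
      then have "(v, w) \<notin> E" using h E1 disj p by (auto simp: E_def)
      then show ?thesis using step by simp
    next
      case False
      then have v: "v \<in> V1" "(u, v) \<in> E1\<^sup>*" using step by auto
      then have "(v, w) \<in> E1 \<or> v = p \<and> w = h" using step.hyps(2) E2 disj by (auto simp: E_def)
      then show ?thesis using v E1 by (auto intro: rtrancl_into_rtrancl)
    qed
  qed (use that in simp)
  have r2: "v \<in> V2 \<and> (u, v) \<in> E2\<^sup>*" if "u \<in> V2" "(u, v) \<in> E\<^sup>*" for u v
    using that(2)
  proof (induction rule: rtrancl_induct)
    case (step v w)
    then have "(v, w) \<in> E2" using E1 p disj by (auto simp: E_def)
    then show ?case using step E2 by (auto intro: rtrancl_into_rtrancl)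
  qed (use that in simp)
  have up1: "(u, v) \<in> E\<^sup>*" if "(u, v) \<in> E1\<^sup>*" for u v
    using that rtrancl_mono[of E1 E] by (auto simp: E_def)
  have up2: "(u, v) \<in> E\<^sup>*" if "(u, v) \<in> E2\<^sup>*" for u v
    using that rtrancl_mono[of E2 E] by (auto simp: E_def)
  have hV1: "h \<notin> V1" using disj h by auto
  have R11: "(u, v) \<in> E\<^sup>* \<longleftrightarrow> (u, v) \<in> E1\<^sup>*" if "u \<in> V1" "v \<in> V1" for u v
    using r1[of u v] that up1 hV1 by blast
  have R1h: "(u, h) \<in> E\<^sup>* \<longleftrightarrow> (u, p) \<in> E1\<^sup>*" if "u \<in> V1" for u
  proof -
    have "(p, h) \<in> E" by (simp add: E_def)
    then show ?thesis using r1[of u h] that up1 hV1 by (meson rtrancl_into_rtrancl)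
  qed
  have R12: "(u, v) \<notin> E\<^sup>*" if "u \<in> V1" "v \<in> V2" "v \<noteq> h" for u v
    using r1[of u v] that disj by blast
  have R21: "(u, v) \<notin> E\<^sup>*" if "u \<in> V2" "v \<in> V1" for u v
    using r2[of u v] that disj by blast
  have R22: "(u, v) \<in> E\<^sup>* \<longleftrightarrow> (u, v) \<in> E2\<^sup>*" if "u \<in> V2" for u v
    using r2[of u v] that up2 by blast
  have inV: "v \<in> V1 \<union> V2" if "(v, x) \<in> E\<^sup>*" "x \<in> V1 \<union> V2" for v x
    using rtrancl_closed[OF that(1) oriented_tree_arcs[OF T, folded E_def]] that(2) by auto
  have inV1: "v \<in> V1" if "(v, x) \<in> E1\<^sup>*" "x \<in> V1" for v x
    using rtrancl_closed[OF that(1) E1] that(2) by auto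
  have inV2: "v \<in> V2" if "(v, x) \<in> E2\<^sup>*" "x \<in> V2" for v x
    using rtrancl_closed[OF that(1) E2] that(2) by auto
  have out1: "(v, c) \<in> E \<longleftrightarrow> (v, c) \<in> E1 \<or> v = p \<and> c = h" if "v \<in> V1" for v c
    using that E2 disj by (auto simp: E_def)
  have out2: "(v, c) \<in> E \<longleftrightarrow> (v, c) \<in> E2" if "v \<in> V2" for v c
    using that E1 p disj by (auto simp: E_def)
  have child1: "c \<in> V1" if "(v, c) \<in> E1" for v c using that E1 by auto
  have child2: "c \<in> V2" if "(v, c) \<in> E2" for v c using that E2 by auto
  show 11: "lca_of E x y = lca_of E1 x y" if xy: "x \<in> V1" "y \<in> V1" for x y
  proof
    fix v
    show "lca_of E x y v = lca_of E1 x y v"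
    proof (cases "v \<in> V1")
      case True
      have "(\<forall>c. (v, c) \<in> E \<longrightarrow> \<not> ((c, x) \<in> E\<^sup>* \<and> (c, y) \<in> E\<^sup>*)) \<longleftrightarrow>
        (\<forall>c. (v, c) \<in> E1 \<longrightarrow> \<not> ((c, x) \<in> E1\<^sup>* \<and> (c, y) \<in> E1\<^sup>*))"
        using out1[OF True] child1 R11 R21[OF h(1)] xy by metis
      then show ?thesis using True xy R11 by (simp add: lca_of_def)
    next
      case False
      then show ?thesis using xy inV1[of v x] inV[of v x] R21[of v x] by (auto simp: lca_of_def)
    qed
  qed
  show "lca_of E x h = lca_of E1 x p" if x: "x \<in> V1" for x
  proof
    fix v
    show "lca_of E x h v = lca_of E1 x p v"
    proof (cases "v \<in> V1")
      case True
      have "(\<forall>c. (v, c) \<in> E \<longrightarrow> \<not> ((c, x) \<in> E\<^sup>* \<and> (c, h) \<in> E\<^sup>*)) \<longleftrightarrow>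
        (\<forall>c. (v, c) \<in> E1 \<longrightarrow> \<not> ((c, x) \<in> E1\<^sup>* \<and> (c, p) \<in> E1\<^sup>*))"
        using out1[OF True] child1 R11 R1h R21[OF h(1)] x by metis
      then show ?thesis using True x R11 R1h by (simp add: lca_of_def)
    next
      case False
      then show ?thesis using x inV1[of v x] inV[of v x] R21[of v x] by (auto simp: lca_of_def)
    qed
  qed
  show "\<not> lca_of E x y v" if "x \<in> V1" "y \<in> V2" "y \<noteq> h" for x y v
    using that R12[of v y] R21[of v x] inV[of v x] by (auto simp: lca_of_def)
  show "lca_of E x y = lca_of E2 x y" if xy: "x \<in> V2" "y \<in> V2" for x y
  proof
    fix v
    show "lca_of E x y v = lca_of E2 x y v"
    proof (cases "x = h \<and> y = h")
      case True
      then show ?thesis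
        using lca_of_self[OF oriented_tree_acyclic[OF T]] lca_of_self[OF oriented_tree_acyclic[OF T2]]
        by (simp add: E_def)
    next
      case nh: False
      show ?thesis
      proof (cases "v \<in> V2")
        case True
        have "(\<forall>c. (v, c) \<in> E \<longrightarrow> \<not> ((c, x) \<in> E\<^sup>* \<and> (c, y) \<in> E\<^sup>*)) \<longleftrightarrow>
          (\<forall>c. (v, c) \<in> E2 \<longrightarrow> \<not> ((c, x) \<in> E2\<^sup>* \<and> (c, y) \<in> E2\<^sup>*))"
          using out2[OF True] child2 R22 by metis
        then show ?thesis using True R22 by (simp add: lca_of_def)
      next
        case False
        have "\<not> lca_of E x y v"
          using False inV[of v x] xy nh R12[of v x] R12[of v y] by (auto simp: lca_of_def)
        then show ?thesis using False xy inV2[of v x] by (auto simp: lca_of_def)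
      qed
    qed
  qed
qed

lemma lca_of_unique:
  assumes "oriented_tree V E" "x \<in> V" "y \<in> V" "lca_of E x y v" "lca_of E x y w"
  shows "v = w"
  using assms
proof (induction arbitrary: x y v w rule: oriented_tree_induct)
  case (single u)
  then show ?case by (simp add: lca_of_def)
next
  case (join V1 E1 V2 E2 p h)
  note eqs = lca_of_join_11[OF join.hyps(1-7)] lca_of_join_22[OF join.hyps(1-7)]
    lca_of_join_1h[OF join.hyps(1-7)] lca_of_join_12[OF join.hyps(1-7)]
  consider "x \<in> V1" "y \<in> V1" | "x \<in> V2" "y \<in> V2" | "x \<in> V1" "y = h" | "x = h" "y \<in> V1"
    | "x \<in> V1" "y \<in> V2" "y \<noteq> h" | "x \<in> V2" "x \<noteq> h" "y \<in> V1"
    using join.prems(1,2) by blast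
  then show ?case
  proof cases
    case 1
    then show ?thesis using join.prems(3,4) join.IH(1) by (simp add: eqs)
  next
    case 2
    then show ?thesis using join.prems(3,4) join.IH(2) by (simp add: eqs)
  next
    case 3
    then show ?thesis using join.prems(3,4) join.IH(1)[of x p] join.hyps(4) by (simp add: eqs)
  next
    case 4
    then show ?thesis using join.prems(3,4) join.IH(1)[of y p] join.hyps(4)
      by (simp add: eqs lca_of_commute[of _ h y])
  next
    case 5
    then show ?thesis using join.prems(3) by (simp add: eqs)
  next
    case 6
    then show ?thesis using join.prems(3) by (simp add: eqs lca_of_commute[of _ x y])
  qed
qed

definition lca_label :: "('v \<times> 'v) set \<Rightarrow> ('v \<Rightarrow> 'm) \<Rightarrow> 'm \<Rightarrow> 'v \<Rightarrow> 'v \<Rightarrow> 'm" where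
  "lca_label E t odot x y = (if \<exists>v. lca_of E x y v then t (THE v. lca_of E x y v) else odot)"

lemma lca_label_eq:
  assumes "oriented_tree V E" "x \<in> V" "y \<in> V" "lca_of E x y v"
  shows "lca_label E t odot x y = t v"
  using assms lca_of_unique[OF assms(1-3)] unfolding lca_label_def by (metis the_equality)

lemma oriented_tree_arboreal_map:
  assumes "oriented_tree V E" "\<And>v. v \<in> V \<Longrightarrow> t v \<noteq> odot"
  shows "arboreal_map V odot (lca_label E t odot)"
  using assms
proof (induction rule: oriented_tree_induct)
  case (single v)
  have "lca_label {} t odot v v = t v"
    by (intro lca_label_eq[of "{v}"]) (auto simp: oriented_tree_def lca_of_def)
  then show ?case using single by (intro arboreal_map_singleton) simp
next
  case (join V1 E1 V2 E2 p h)
  note eqs = lca_of_join_11[OF join.hyps(1-7)] lca_of_join_22[OF join.hyps(1-7)]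
    lca_of_join_1h[OF join.hyps(1-7)] lca_of_join_12[OF join.hyps(1-7)]
  show ?case
  proof (rule arboreal_map_join[OF join.IH(1) join.IH(2) join.hyps(3-5)])
    fix x assume x: "x \<in> V1"
    then show "lca_label (insert (p, h) (E1 \<union> E2)) t odot x h = lca_label E1 t odot x p \<and>
        lca_label (insert (p, h) (E1 \<union> E2)) t odot h x = lca_label E1 t odot x p"
      by (simp add: lca_label_def eqs lca_of_commute[of _ h])
    fix y assume "y \<in> V2" "y \<noteq> h"
    then show "lca_label (insert (p, h) (E1 \<union> E2)) t odot x y = odot \<and>
        lca_label (insert (p, h) (E1 \<union> E2)) t odot y x = odot"
      using x by (simp add: lca_label_def eqs lca_of_commute[of _ y])
  qed (use join.prems eqs in \<open>auto simp: lca_label_def\<close>)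
qed

section \<open>Networks as oriented trees\<close>

lemma reachable_pair_iff:
  assumes "pair_wf_digraph N"
  shows "reachable (with_proj N) u v \<longleftrightarrow> u \<in> pverts N \<and> v \<in> pverts N \<and> (u, v) \<in> (parcs N)\<^sup>*"
proof -
  interpret pair_wf_digraph N by fact
  show ?thesis
    unfolding reachable_def with_proj_simps
    using rtrancl_consistent_rtrancl_on[of u v "parcs N" "pverts N"] in_arcsD2
    by (auto dest: in_rtrancl_on_in_F intro: rtrancl_on_rtranclI)
qed

lemma parcs_mk_symmetric_pair: "parcs (mk_symmetric (with_proj N)) = parcs N \<union> (parcs N)\<inverse>"
  by (auto simp: parcs_mk_symmetric intro: bexI[rotated])

lemma connected_pair_iff:
  assumes "pair_wf_digraph N"
  shows "Digraph_Component.connected (with_proj N) \<longleftrightarrow>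
    pverts N \<noteq> {} \<and> (\<forall>u\<in>pverts N. \<forall>v\<in>pverts N. (u, v) \<in> linked (parcs N))"
proof -
  interpret pair_wf_digraph N by fact
  show ?thesis
    using reachable_pair_iff[OF wellformed_mk_symmetric]
    by (auto simp: Digraph_Component.connected_def strongly_connected_def parcs_mk_symmetric_pair)
qed

lemma long_cycle_iff_not_bridge:
  assumes "pair_wf_digraph N" "acyclic (parcs N)"
  shows "(\<exists>p. pre_digraph.cycle (with_proj (mk_symmetric (with_proj N))) p \<and> length p \<ge> 3) \<longleftrightarrow>
    (\<exists>a b. (a, b) \<in> parcs N \<and> (a, b) \<in> linked (parcs N - {(a, b)}))"
proof -
  interpret pair_wf_digraph N by fact
  let ?E = "parcs N"
  interpret S: pair_wf_digraph "mk_symmetric (with_proj N)" by (rule wellformed_mk_symmetric)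
  show ?thesis
  proof
    assume "\<exists>p. S.cycle p \<and> length p \<ge> 3"
    then obtain p u where p: "S.awalk u p u" "distinct (tl (pawalk_verts u p))" "length p \<ge> 3"
      by (auto simp: S.cycle_def)
    then obtain v q where pq: "p = (u, v) # q"
      by (cases p) (auto simp: S.awalk_Cons_iff)
    have q: "S.awalk v q u" "distinct (pawalk_verts v q)" "length q \<ge> 2"
      using p by (auto simp: pq S.awalk_Cons_iff)
    have e: "(u, v) \<in> ?E \<or> (v, u) \<in> ?E"
      using p(1) by (auto simp: pq S.awalk_Cons_iff parcs_mk_symmetric_pair)
    have set: "set q \<subseteq> ?E \<union> ?E\<inverse>" "pcas v q u"
      using q(1) by (auto simp: S.awalk_def parcs_mk_symmetric_pair)
    have verts: "fst x \<in> set (pawalk_verts w r)" "snd x \<in> set (pawalk_verts w r)"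
      if "x \<in> set r" "pcas w r z" for x w r z
      using that by (induction r arbitrary: w) (auto, (case_tac r; auto)+)
    have last: "w \<in> set (pawalk_verts z r)" if "pcas z r w" for z r w
      using that by (induction r arbitrary: z) auto
    have avoid: "x \<notin> {(u, v), (v, u)}" if "x \<in> set q" for x
    proof -
      obtain y r where r: "q = (v, y) # r" "pcas y r u" "r \<noteq> []"
        using set(2) q(3) by (cases q) (auto simp: Suc_le_eq)
      have vr: "v \<notin> set (pawalk_verts y r)" "distinct (pawalk_verts y r)" using q(2) r by auto
      have "y \<noteq> u"
      proof
        assume "y = u"
        obtain y' r' where r': "r = (y, y') # r'" "pcas y' r' u" using r by (cases r) auto
        then show False using vr(2) last[OF r'(2)] \<open>y = u\<close> by auto
      qed
      moreover have "y \<noteq> v" using vr(1) by (cases r) (use r in auto)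
      ultimately show ?thesis using that r verts[of x r y u] vr(1) by auto
    qed
    have walk: "(w, z) \<in> F\<^sup>*" if "set r \<subseteq> F" "pcas w r z" for w z r and F :: "('a \<times> 'a) set"
      using that by (induction r arbitrary: w) (auto intro: converse_rtrancl_into_rtrancl)
    from e show "\<exists>a b. (a, b) \<in> ?E \<and> (a, b) \<in> linked (?E - {(a, b)})"
    proof
      assume uv: "(u, v) \<in> ?E"
      have "set q \<subseteq> (?E - {(u, v)}) \<union> (?E - {(u, v)})\<inverse>" using set(1) avoid by auto
      then have "(v, u) \<in> linked (?E - {(u, v)})" using set(2) by (rule walk)
      then have "(u, v) \<in> linked (?E - {(u, v)})" by (rule linked_sym)
      with uv show ?thesis by (intro exI conjI)
    next
      assume vu: "(v, u) \<in> ?E"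
      have "set q \<subseteq> (?E - {(v, u)}) \<union> (?E - {(v, u)})\<inverse>" using set(1) avoid by auto
      then have "(v, u) \<in> linked (?E - {(v, u)})" using set(2) by (rule walk)
      with vu show ?thesis by (intro exI conjI)
    qed
  next
    assume "\<exists>a b. (a, b) \<in> ?E \<and> (a, b) \<in> linked (?E - {(a, b)})"
    then obtain a b where ab: "(a, b) \<in> ?E" "(a, b) \<in> linked (?E - {(a, b)})" by blast
    define F where "F = (?E - {(a, b)}) \<union> (?E - {(a, b)})\<inverse>"
    interpret G: pair_wf_digraph "\<lparr>pverts = pverts N, parcs = F\<rparr>"
      by unfold_locales (auto simp: F_def arc_fst_in_verts arc_snd_in_verts dest: in_arcsD1 in_arcsD2)
    have abV: "a \<in> pverts N" "b \<in> pverts N" using ab(1) in_arcsD1 in_arcsD2 by auto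
    have "reachable (with_proj \<lparr>pverts = pverts N, parcs = F\<rparr>) a b"
      using reachable_pair_iff[OF G.pair_wf_digraph_axioms] ab abV by (simp add: F_def)
    then obtain q where "G.apath a q b" using G.reachable_apath by blast
    then have q: "set q \<subseteq> F" "pcas a q b" "distinct (pawalk_verts a q)"
      by (auto simp: G.apath_def G.awalk_def)
    have "(b, a) \<notin> ?E" "a \<noteq> b"
      using assms(2) ab(1) unfolding acyclic_def by (meson r_into_trancl trancl_trans)+
    then have "length q \<ge> 2" using q(1,2)
      by (cases q; cases "tl q") (auto simp: F_def)
    moreover have "S.awalk b ((b, a) # q) b"
      using q ab(1) abV by (auto simp: S.awalk_def parcs_mk_symmetric_pair F_def)
    ultimately show "\<exists>p. S.cycle p \<and> length p \<ge> 3"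
      using q(3) by (intro exI[of _ "(b, a) # q"]) (auto simp: S.cycle_def)
  qed
qed

definition indeg :: "('v \<times> 'v) set \<Rightarrow> 'v \<Rightarrow> nat" where
  "indeg E v = card {e \<in> E. snd e = v}"

definition outdeg :: "('v \<times> 'v) set \<Rightarrow> 'v \<Rightarrow> nat" where
  "outdeg E v = card {e \<in> E. fst e = v}"

definition network_degrees :: "nat \<Rightarrow> nat \<Rightarrow> bool" where
  "network_degrees i k \<longleftrightarrow> (i = 0 \<longrightarrow> k \<ge> 2) \<and> (k = 0 \<longrightarrow> i = 1) \<and> \<not> (i = 1 \<and> k = 1)"

lemma arboreal_network_iff:
  "arboreal_network N L \<longleftrightarrow> oriented_tree (pverts N) (parcs N) \<and>
     L = {v \<in> pverts N. outdeg (parcs N) v = 0} \<and>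
     (\<forall>v\<in>pverts N. network_degrees (indeg (parcs N) v) (outdeg (parcs N) v))"
  (is "?l \<longleftrightarrow> ?r")
proof -
  have deg: "in_degree (with_proj N) = indeg (parcs N)" "out_degree (with_proj N) = outdeg (parcs N)"
    by (auto simp: fun_eq_iff in_degree_def in_arcs_def out_degree_def out_arcs_def indeg_def outdeg_def)
  have *: "?l \<longleftrightarrow> pair_digraph N \<and> acyclic (parcs N) \<and> Digraph_Component.connected (with_proj N) \<and>
      underlying_tree N \<and> L = {v \<in> pverts N. outdeg (parcs N) v = 0} \<and>
      (\<forall>v\<in>pverts N. network_degrees (indeg (parcs N) v) (outdeg (parcs N) v))"
    unfolding arboreal_network_def network_def network_leaves_def deg network_degrees_def by auto
  show ?thesis
  proof
    assume l: ?l
    then interpret pair_digraph N by (simp add: *)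
    have "oriented_tree (pverts N) (parcs N)"
      unfolding oriented_tree_def
      using l connected_pair_iff[OF pair_wf_digraph_axioms]
        long_cycle_iff_not_bridge[OF pair_wf_digraph_axioms] in_arcsD1 in_arcsD2
      by (auto simp: * underlying_tree_def)
    then show ?r using l by (simp add: *)
  next
    assume r: ?r
    then have T: "oriented_tree (pverts N) (parcs N)" by blast
    have sub: "parcs N \<subseteq> pverts N \<times> pverts N" by (rule oriented_tree_arcs[OF T])
    interpret pair_digraph N
    proof
      fix e assume e: "e \<in> parcs N"
      then show "fst e \<in> pverts N" "snd e \<in> pverts N" using sub by auto
      show "fst e \<noteq> snd e"
        using oriented_tree_bridge[OF T, of "fst e" "snd e"] e by (metis prod.collapse rtrancl.rtrancl_refl)
    qed (use oriented_tree_finite[OF T] oriented_tree_finite_arcs[OF T] in auto)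
    have con: "Digraph_Component.connected (with_proj N)"
      using connected_pair_iff[OF pair_wf_digraph_axioms] oriented_tree_nonempty[OF T]
        oriented_tree_linked[OF T] by blast
    moreover have "underlying_tree N"
      using con long_cycle_iff_not_bridge[OF pair_wf_digraph_axioms oriented_tree_acyclic[OF T]]
        oriented_tree_bridge[OF T] by (auto simp: underlying_tree_def)
    ultimately show ?l unfolding * using r oriented_tree_acyclic[OF T] pair_digraph_axioms by simp
  qed
qed

lemma
  assumes T: "oriented_tree (pverts N) (parcs N)" and x: "x \<in> pverts N" and y: "y \<in> pverts N"
  shows is_lca_iff: "is_lca N x y v \<longleftrightarrow> lca_of (parcs N) x y v"
    and share_ancestor_iff: "share_ancestor N x y \<longleftrightarrow> (\<exists>v. lca_of (parcs N) x y v)"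
    and induced_map_eq: "induced_map odot N t x y = lca_label (parcs N) t odot x y"
proof -
  have sub: "parcs N \<subseteq> pverts N \<times> pverts N" by (rule oriented_tree_arcs[OF T])
  have N: "pair_wf_digraph N" by unfold_locales (use sub in auto)
  have anc: "ancestor N v z \<longleftrightarrow> (v, z) \<in> (parcs N)\<^sup>*" if "z \<in> pverts N" for v z
    using reachable_pair_iff[OF N, of v z] that rtrancl_closed[of v z "parcs N" "pverts N"] sub
    by (auto simp: ancestor_def)
  show 1: "is_lca N x y v \<longleftrightarrow> lca_of (parcs N) x y v" for v
    by (simp add: is_lca_def lca_of_def anc x y)
  show 2: "share_ancestor N x y \<longleftrightarrow> (\<exists>v. lca_of (parcs N) x y v)"
    using lca_of_exists[OF oriented_tree_finite_arcs[OF T] oriented_tree_acyclic[OF T]]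
    by (auto simp: share_ancestor_def anc x y) (auto simp: lca_of_def)
  show "induced_map odot N t x y = lca_label (parcs N) t odot x y"
    unfolding induced_map_def lca_label_def lca_def 1 2 ..
qed

lemma outdeg_eq_0_iff: "finite E \<Longrightarrow> outdeg E v = 0 \<longleftrightarrow> v \<notin> Domain E"
  by (auto simp: outdeg_def Domain_iff)

lemma outdeg_ge_2:
  assumes "finite E" "(v, c) \<in> E" "(v, c') \<in> E" "c \<noteq> c'"
  shows "outdeg E v \<ge> 2"
proof -
  have "card {(v, c), (v, c')} \<le> outdeg E v"
    unfolding outdeg_def using assms by (intro card_mono) auto
  then show ?thesis using assms by simp
qed

lemma lca_of_outdeg:
  assumes "finite E" "lca_of E x y v" "x \<noteq> y" "x \<notin> Domain E" "y \<notin> Domain E"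
  shows "outdeg E v \<ge> 2"
proof -
  have v: "(v, x) \<in> E\<^sup>*" "(v, y) \<in> E\<^sup>*" using assms by (auto simp: lca_of_def)
  have "v \<noteq> x" using v(2) assms(3,4) by (metis Domain.DomainI converse_rtranclE)
  then obtain c where c: "(v, c) \<in> E" "(c, x) \<in> E\<^sup>*" using v(1) by (metis converse_rtranclE)
  have "v \<noteq> y" using v(1) assms(3,5) by (metis Domain.DomainI converse_rtranclE)
  then obtain c' where c': "(v, c') \<in> E" "(c', y) \<in> E\<^sup>*" using v(2) by (metis converse_rtranclE)
  have "c \<noteq> c'" using c c' assms(2) by (auto simp: lca_of_def)
  then show ?thesis using outdeg_ge_2[OF assms(1) c(1) c'(1)] by simp
qed

lemma symbolic_arboreal_map_imp_arboreal_map: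
  assumes "symbolic_arboreal_map X M odot d" "odot \<notin> M" "m \<in> M"
  shows "arboreal_map X odot (\<lambda>x y. if x = y then m else d {x, y})"
proof -
  obtain N :: "('a + nat) pair_pre_digraph" and t
    where lan: "labelled_arboreal_network N t (Inl ` X) M"
      and d: "\<And>x y. \<lbrakk>x \<in> X; y \<in> X; x \<noteq> y\<rbrakk> \<Longrightarrow> d {x, y} = induced_map odot N t (Inl x) (Inl y)"
    using assms(1) unfolding symbolic_arboreal_map_def by blast
  let ?V = "pverts N" and ?E = "parcs N"
  have "arboreal_network N (Inl ` X)" and t: "\<And>v. \<lbrakk>v \<in> ?V; outdeg ?E v \<ge> 2\<rbrakk> \<Longrightarrow> t v \<in> M"
    using lan by (auto simp: labelled_arboreal_network_def out_degree_def out_arcs_def outdeg_def)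
  then have T: "oriented_tree ?V ?E" and L: "Inl ` X = {v \<in> ?V. outdeg ?E v = 0}"
    by (auto simp: arboreal_network_iff)
  have fin: "finite ?E" by (rule oriented_tree_finite_arcs[OF T])
  have L': "Inl ` X = ?V - Domain ?E" using L outdeg_eq_0_iff[OF fin] by auto
  define t' where "t' v = (if outdeg ?E v \<ge> 2 then t v else m)" for v
  interpret A: arboreal_map ?V odot "lca_label ?E t' odot"
    using t assms(2,3) by (intro oriented_tree_arboreal_map[OF T]) (auto simp: t'_def)
  have "wf (?E\<inverse>)" using fin oriented_tree_acyclic[OF T] by (rule finite_acyclic_wf_converse)
  then have "\<exists>w. (v, w) \<in> ?E\<^sup>* \<and> w \<notin> Domain ?E" for v
  proof (induction v rule: wf_induct_rule)
    case (less v)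
    show ?case
    proof (cases "v \<in> Domain ?E")
      case True
      then obtain b where "(v, b) \<in> ?E" by blast
      then show ?thesis using less[of b] by (blast intro: converse_rtrancl_into_rtrancl)
    qed auto
  qed
  then obtain s where s: "\<And>v. (v, s v) \<in> ?E\<^sup>*" "\<And>v. s v \<notin> Domain ?E" by metis
  have sV: "s v \<in> ?V" if "v \<in> ?V" for v
    using rtrancl_closed[OF s(1) oriented_tree_arcs[OF T]] that by metis
  have adj: "lca_label ?E t' odot x y \<noteq> odot \<longleftrightarrow> (\<exists>v. (v, x) \<in> ?E\<^sup>* \<and> (v, y) \<in> ?E\<^sup>*)"
    if xy: "x \<in> ?V" "y \<in> ?V" for x y
  proof
    assume "lca_label ?E t' odot x y \<noteq> odot"
    then show "\<exists>v. (v, x) \<in> ?E\<^sup>* \<and> (v, y) \<in> ?E\<^sup>*"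
      by (auto simp: lca_label_def lca_of_def split: if_splits)
  next
    assume "\<exists>v. (v, x) \<in> ?E\<^sup>* \<and> (v, y) \<in> ?E\<^sup>*"
    then obtain v where v: "lca_of ?E x y v"
      using lca_of_exists[OF fin oriented_tree_acyclic[OF T]] by blast
    then have "v \<in> ?V"
      using rtrancl_closed[of v x ?E, OF _ oriented_tree_arcs[OF T]] xy by (auto simp: lca_of_def)
    then have "t' v \<in> M" using t assms(3) by (simp add: t'_def)
    then show "lca_label ?E t' odot x y \<noteq> odot"
      using lca_label_eq[OF T xy v, of t' odot] assms(2) by auto
  qed
  have "arboreal_map (Inl ` X) odot (lca_label ?E t' odot)"
  proof (rule A.retract)
    show "Inl ` X \<subseteq> ?V" using L by auto
    show "s v \<in> Inl ` X" if "v \<in> ?V" for v using sV[OF that] s(2) L' by auto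
    show "s v = v" if "v \<in> Inl ` X" for v
      using that L' s(1)[of v] by (auto elim: converse_rtranclE)
    fix x y assume xy: "x \<in> ?V" "y \<in> ?V" "lca_label ?E t' odot x y \<noteq> odot"
    then obtain v where "(v, x) \<in> ?E\<^sup>*" "(v, y) \<in> ?E\<^sup>*" using adj by blast
    then have "(v, s x) \<in> ?E\<^sup>*" "(v, s y) \<in> ?E\<^sup>*" using s(1) rtrancl_trans by metis+
    then show "lca_label ?E t' odot (s x) (s y) \<noteq> odot" using adj sV xy by blast
  qed
  then have "arboreal_map X odot (\<lambda>x y. lca_label ?E t' odot (Inl x) (Inl y))"
    by (rule arboreal_map_vimage) simp
  then show ?thesis
  proof (rule arboreal_map_cong)
    fix x y assume xy: "x \<in> X" "y \<in> X" "x \<noteq> y"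
    have V: "Inl x \<in> ?V - Domain ?E" "Inl y \<in> ?V - Domain ?E" using xy L' by blast+
    have "lca_label ?E t odot (Inl x) (Inl y) = lca_label ?E t' odot (Inl x) (Inl y)"
    proof (cases "\<exists>v. lca_of ?E (Inl x) (Inl y) v")
      case True
      then obtain v where v: "lca_of ?E (Inl x) (Inl y) v" ..
      have "outdeg ?E v \<ge> 2" using lca_of_outdeg[OF fin v] V xy by simp
      then show ?thesis using lca_label_eq[OF T _ _ v, of t odot] lca_label_eq[OF T _ _ v, of t' odot] V
        by (simp add: t'_def)
    qed (simp add: lca_label_def)
    then show "(if x = y then m else d {x, y}) = lca_label ?E t' odot (Inl x) (Inl y)"
      using d[OF xy] induced_map_eq[OF T, of "Inl x" "Inl y" odot t] V xy by simp
  qed (use assms in auto)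
qed

section \<open>The graph of a symbolic map\<close>

lemma graph_metric_exists:
  assumes A: "A \<subseteq> X \<times> X" "sym A" "irrefl A" and con: "\<And>x y. \<lbrakk>x \<in> X; y \<in> X\<rbrakk> \<Longrightarrow> (x, y) \<in> A\<^sup>*"
    and r: "\<And>x y. \<lbrakk>x \<in> X; y \<in> X\<rbrakk> \<Longrightarrow> r x y \<longleftrightarrow> x = y \<or> (x, y) \<in> A"
  shows "\<exists>D. graph_metric X r D"
proof -
  define D where "D x y = (LEAST n. (x, y) \<in> A ^^ n)" for x y
  have D: "(x, y) \<in> A ^^ D x y" if "x \<in> X" "y \<in> X" for x y
    unfolding D_def by (rule LeastI_ex) (use con[OF that] rtrancl_imp_relpow in blast)
  have le: "D x y \<le> n" if "(x, y) \<in> A ^^ n" for x y n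
    unfolding D_def using that by (rule Least_le)
  have step: "D x z \<le> Suc (D y z)" if "x \<in> X" "y \<in> X" "z \<in> X" "r x y" for x y z
  proof (cases "x = y")
    case False
    then have "(x, y) \<in> A" using that r by blast
    then show ?thesis using D[of y z] that by (intro le relpow_Suc_I2)
  qed simp
  have "graph_metric X r D"
  proof
    show "r y x" if "x \<in> X" "y \<in> X" "r x y" for x y
      using that r[of x y] r[of y x] A(2) by (auto dest: symD)
    show "D x y = 0 \<longleftrightarrow> x = y" if "x \<in> X" "y \<in> X" for x y
      using D[OF that] le[of x y 0] by auto
    show "\<exists>y\<in>X. r x y \<and> D y z = n" if xz: "x \<in> X" "z \<in> X" "D x z = Suc n" for x z n
    proof -
      have "(x, z) \<in> A ^^ Suc n" using D[of x z] xz by metis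
      then obtain y where y: "(x, y) \<in> A" "(y, z) \<in> A ^^ n" by (rule relpow_Suc_E2)
      have "y \<in> X" "r x y" using y(1) A(1) r by auto
      moreover have "D y z = n" using le[OF y(2)] step[of x y z] xz \<open>y \<in> X\<close> \<open>r x y\<close> by simp
      ultimately show ?thesis by blast
    qed
  qed (rule step)
  then show ?thesis by blast
qed

lemma symbolic_graph_simps [simp]:
  "pverts (symbolic_graph X odot d) = X"
  "parcs (symbolic_graph X odot d) = {(x, y). x \<in> X \<and> y \<in> X \<and> x \<noteq> y \<and> d {x, y} \<noteq> odot}"
  by (simp_all add: symbolic_graph_def)

lemma symbolic_graph_wf: "pair_wf_digraph (symbolic_graph X odot d)"
  by unfold_locales auto

lemma graph_dist_symbolic_graph:
  assumes "graph_metric X r D"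
    and r: "\<And>x y. \<lbrakk>x \<in> X; y \<in> X; x \<noteq> y\<rbrakk> \<Longrightarrow> r x y \<longleftrightarrow> d {x, y} \<noteq> odot"
    and xy: "x \<in> X" "y \<in> X"
  shows "graph_dist (symbolic_graph X odot d) x y = ereal (real (D x y))"
proof -
  interpret graph_metric X r D by fact
  interpret G: pair_wf_digraph "symbolic_graph X odot d" by (rule symbolic_graph_wf)
  have cost: "G.awalk_cost (\<lambda>_. 1) p = real (length p)" for p by (induction p) auto
  have lower: "D x y \<le> length p" if "G.awalk x p y" for x y p
    using that
  proof (induction p arbitrary: x)
    case Nil
    then show ?case by (auto simp: G.awalk_Nil_iff)
  next
    case (Cons e p)
    then obtain w where w: "e = (x, w)" "x \<in> X" "w \<in> X" "x \<noteq> w" "d {x, w} \<noteq> odot" "G.awalk w p y"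
      by (cases e) (auto simp: G.awalk_Cons_iff)
    have "y \<in> X" using G.awalk_last_in_verts[OF Cons.prems] by simp
    then have "D x y \<le> Suc (D w y)" using w r by (intro D_step) auto
    then show ?case using Cons.IH[OF w(6)] by simp
  qed
  have upper: "\<exists>p. G.awalk x p y \<and> length p = D x y" if "x \<in> X" "y \<in> X" for x y
    using that
  proof (induction "D x y" arbitrary: x)
    case 0
    then show ?case using D_eq_0[of x y] by (intro exI[of _ "[]"]) (simp add: G.awalk_Nil_iff)
  next
    case (Suc n)
    then obtain w where w: "w \<in> X" "r x w" "D w y = n" using D_pred by metis
    then have "x \<noteq> w" using Suc.hyps(2) by auto
    then have "d {x, w} \<noteq> odot" using w r Suc.prems by blast
    moreover obtain p where "G.awalk w p y" "length p = n" using Suc.hyps(1)[of w] w Suc.prems by auto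
    ultimately show ?case using Suc.hyps(2) Suc.prems w \<open>x \<noteq> w\<close>
      by (intro exI[of _ "(x, w) # p"]) (simp add: G.awalk_Cons_iff)
  qed
  obtain p where p: "G.awalk x p y" "length p = D x y" using upper[OF xy] by blast
  show ?thesis
    unfolding graph_dist_def G.\<mu>_def
  proof (rule antisym)
    show "(INF p\<in>{p. G.awalk x p y}. ereal (G.awalk_cost (\<lambda>_. 1) p)) \<le> ereal (real (D x y))"
      using p by (intro INF_lower2[of p]) (auto simp: cost)
    show "ereal (real (D x y)) \<le> (INF p\<in>{p. G.awalk x p y}. ereal (G.awalk_cost (\<lambda>_. 1) p))"
      using lower by (intro INF_greatest) (auto simp: cost)
  qed
qed

lemma connected_ptolemaic_iff:
  fixes d :: "'a set \<Rightarrow> 'm"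
  assumes "X \<noteq> {}" and r: "\<And>x y. \<lbrakk>x \<in> X; y \<in> X\<rbrakk> \<Longrightarrow> r x y \<longleftrightarrow> x = y \<or> d {x, y} \<noteq> odot"
  shows "Digraph_Component.connected (symbolic_graph X odot d) \<and> ptolemaic (symbolic_graph X odot d) \<longleftrightarrow>
    (\<exists>D. graph_metric X r D \<and> ptolemaic_on X D)"
proof -
  let ?A = "parcs (symbolic_graph X odot d)"
  have sym: "sym ?A" by (auto simp: sym_def insert_commute)
  have r': "r x y \<longleftrightarrow> x = y \<or> (x, y) \<in> ?A" if "x \<in> X" "y \<in> X" for x y
    using r[OF that] that by auto
  have con: "Digraph_Component.connected (symbolic_graph X odot d) \<longleftrightarrow> (\<forall>x\<in>X. \<forall>y\<in>X. (x, y) \<in> ?A\<^sup>*)"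
    using connected_pair_iff[OF symbolic_graph_wf, of X odot d] sym assms(1)
    by (simp del: symbolic_graph_simps(2) add: sym_conv_converse_eq)
  have ptol: "ptolemaic (symbolic_graph X odot d) \<longleftrightarrow> ptolemaic_on X D" if "graph_metric X r D" for D
  proof -
    have "graph_dist (symbolic_graph X odot d) x y = ereal (real (D x y))" if "x \<in> X" "y \<in> X" for x y
      using graph_dist_symbolic_graph[OF \<open>graph_metric X r D\<close> _ that, of d odot] r by blast
    then show ?thesis
      by (simp add: ptolemaic_def ptolemaic_on_def flip: of_nat_mult of_nat_add)
  qed
  show ?thesis
  proof
    assume c: "Digraph_Component.connected (symbolic_graph X odot d) \<and> ptolemaic (symbolic_graph X odot d)"
    have "\<exists>D. graph_metric X r D"
      by (rule graph_metric_exists[of ?A, OF _ sym]) (use c con r' in \<open>auto simp: irrefl_def\<close>)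
    then show "\<exists>D. graph_metric X r D \<and> ptolemaic_on X D" using ptol c by blast
  next
    assume "\<exists>D. graph_metric X r D \<and> ptolemaic_on X D"
    then obtain D where D: "graph_metric X r D" "ptolemaic_on X D" by blast
    interpret graph_metric X r D by (rule D)
    have "(x, y) \<in> ?A\<^sup>*" if "x \<in> X" "y \<in> X" for x y
      using that
    proof (induction "D x y" arbitrary: x)
      case 0
      then show ?case using D_eq_0[of x y] by simp
    next
      case (Suc n)
      then obtain w where w: "w \<in> X" "r x w" "D w y = n" using D_pred by metis
      then have "x \<noteq> w" using Suc.hyps(2) by auto
      then have "(x, w) \<in> ?A" using w r' Suc.prems by blast
      then show ?case using Suc w by (blast intro: converse_rtrancl_into_rtrancl)
    qed
    then show "Digraph_Component.connected (symbolic_graph X odot d) \<and> ptolemaic (symbolic_graph X odot d)"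
      using con ptol D by blast
  qed
qed

lemma arboreal_map_iff:
  fixes d :: "'a set \<Rightarrow> 'm"
  assumes "X \<noteq> {}" and M: "odot \<notin> M" "m \<in> M" and d: "d \<in> nsets X 2 \<rightarrow> M \<union> {odot}"
  shows "arboreal_map X odot (\<lambda>x y. if x = y then m else d {x, y}) \<longleftrightarrow>
    (Digraph_Component.connected (symbolic_graph X odot d) \<and> ptolemaic (symbolic_graph X odot d)) \<and>
    (\<not> (\<exists>x\<in>X. \<exists>y\<in>X. \<exists>z\<in>X. Delta_relation odot d x y z)) \<and>
    (\<not> (\<exists>x\<in>X. \<exists>y\<in>X. \<exists>z\<in>X. \<exists>u\<in>X. Pi_relation odot d x y z u)) \<and>
    (\<forall>x\<in>X. \<forall>y\<in>X. \<forall>z\<in>X. \<forall>u\<in>X.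
       distinct [x, y, z, u] \<and> d {z, u} = odot \<and>
       (\<forall>e \<in> nsets {x, y, z, u} 2 - {{z, u}}. d e \<in> M)
       \<longrightarrow> d {x, z} = d {y, z} \<and> d {x, u} = d {y, u})"
    (is "arboreal_map X odot ?\<delta> \<longleftrightarrow> ?con \<and> ?Delta \<and> ?Pi \<and> ?diamond")
proof -
  have comm: "d {x, y} = d {y, x}" for x y by (simp add: insert_commute)
  have dM: "d {x, y} \<in> M \<longleftrightarrow> d {x, y} \<noteq> odot" if "x \<in> X" "y \<in> X" "x \<noteq> y" for x y
    using d M that by (auto simp: Pi_iff)
  have con: "?con \<longleftrightarrow> (\<exists>D. graph_metric X (\<lambda>x y. ?\<delta> x y \<noteq> odot) D \<and> ptolemaic_on X D)"
    using M by (intro connected_ptolemaic_iff[OF assms(1)]) auto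
  have five: "(\<forall>e \<in> nsets {x, y, z, u} 2 - {{z, u}}. d e \<in> M) \<longleftrightarrow>
      d {x, y} \<noteq> odot \<and> d {x, z} \<noteq> odot \<and> d {x, u} \<noteq> odot \<and> d {y, z} \<noteq> odot \<and> d {y, u} \<noteq> odot"
    if V: "x \<in> X" "y \<in> X" "z \<in> X" "u \<in> X" and dist: "distinct [x, y, z, u]" for x y z u
  proof
    assume *: "\<forall>e \<in> nsets {x, y, z, u} 2 - {{z, u}}. d e \<in> M"
    have "d {p, q} \<noteq> odot" if "p \<in> {x, y}" "q \<in> {x, y, z, u}" "p \<noteq> q" for p q
    proof -
      have "{p, q} \<in> nsets {x, y, z, u} 2 - {{z, u}}" using that dist by (auto simp: doubleton_eq_iff)
      then show ?thesis using * M(1) by metis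
    qed
    then show "d {x, y} \<noteq> odot \<and> d {x, z} \<noteq> odot \<and> d {x, u} \<noteq> odot \<and> d {y, z} \<noteq> odot \<and> d {y, u} \<noteq> odot"
      using dist by simp
  next
    assume *: "d {x, y} \<noteq> odot \<and> d {x, z} \<noteq> odot \<and> d {x, u} \<noteq> odot \<and> d {y, z} \<noteq> odot \<and> d {y, u} \<noteq> odot"
    then have *: "d {p, q} \<noteq> odot" if "p \<in> {x, y}" "q \<in> {x, y, z, u}" "p \<noteq> q" for p q
      using that comm[of y x] by auto
    show "\<forall>e \<in> nsets {x, y, z, u} 2 - {{z, u}}. d e \<in> M"
    proof
      fix e assume e: "e \<in> nsets {x, y, z, u} 2 - {{z, u}}"
      then have "e \<in> nsets {x, y, z, u} 2" by simp
      then obtain p q where pq: "e = {p, q}" "p \<in> {x, y, z, u}" "q \<in> {x, y, z, u}" "p \<noteq> q"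
        by (metis nsets2_E)
      have "p \<in> {x, y} \<or> q \<in> {x, y}" using pq e by (auto simp: doubleton_eq_iff)
      then have "d {p, q} \<noteq> odot" using *[of p q] *[of q p] pq comm[of p q] by auto
      then show "d e \<in> M" using dM[of p q] pq V by auto
    qed
  qed
  show ?thesis
  proof
    assume "arboreal_map X odot ?\<delta>"
    then interpret arboreal_map X odot ?\<delta> .
    have ?con using con metric by blast
    moreover have ?Delta
    proof
      assume "\<exists>x\<in>X. \<exists>y\<in>X. \<exists>z\<in>X. Delta_relation odot d x y z"
      then obtain x y z where V: "x \<in> X" "y \<in> X" "z \<in> X" and D: "Delta_relation odot d x y z" by blast
      have "d {x, y} = d {x, z} \<or> d {x, y} = d {y, z} \<or> d {x, z} = d {y, z}"
        using no_Delta[OF V] D by (auto simp: Delta_relation_def)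
      then have "card {d {x, y}, d {x, z}, d {y, z}} \<le> 2" by (auto simp: card_insert_if)
      then show False using D by (simp add: Delta_relation_def)
    qed
    moreover have ?Pi
    proof
      assume "\<exists>x\<in>X. \<exists>y\<in>X. \<exists>z\<in>X. \<exists>u\<in>X. Pi_relation odot d x y z u"
      then obtain x y z u a b c e where V: "x \<in> X" "y \<in> X" "z \<in> X" "u \<in> X"
        and dist: "distinct [x, y, z, u]" and eq: "{a, b, c, e} = {x, y, z, u}"
        and *: "d {a, b} = d {b, c}" "d {b, c} = d {c, e}" "d {c, e} \<noteq> d {c, a}"
          "d {c, a} = d {a, e}" "d {a, e} = d {e, b}" "odot \<notin> {d {a, b}, d {a, c}}"
        unfolding Pi_relation_def by blast
      have "card {a, b, c, e} = 4" using dist by (simp add: eq)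
      then have abce: "distinct [a, b, c, e]" using card_distinct[of "[a, b, c, e]"] by simp
      have "{a, b, c, e} \<subseteq> X" using eq V by simp
      then show False using no_Pi[of a b c e] abce * by auto
    qed
    moreover have ?diamond
    proof (intro ballI impI, elim conjE)
      fix x y z u assume V: "x \<in> X" "y \<in> X" "z \<in> X" "u \<in> X" and dist: "distinct [x, y, z, u]"
        and zu: "d {z, u} = odot" and e: "\<forall>e \<in> nsets {x, y, z, u} 2 - {{z, u}}. d e \<in> M"
      show "d {x, z} = d {y, z} \<and> d {x, u} = d {y, u}"
        using diamond[OF V] dist zu e[unfolded five[OF V dist]] by auto
    qed
    ultimately show "?con \<and> ?Delta \<and> ?Pi \<and> ?diamond" by blast
  next
    assume r: "?con \<and> ?Delta \<and> ?Pi \<and> ?diamond"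
    show "arboreal_map X odot ?\<delta>"
    proof (rule arboreal_mapI)
      fix x y z assume V: "x \<in> X" "y \<in> X" "z \<in> X" and dist: "distinct [x, y, z]"
        and ne: "?\<delta> x y \<noteq> odot" "?\<delta> x z \<noteq> odot" "?\<delta> y z \<noteq> odot"
      have "\<not> Delta_relation odot d x y z" using r V by blast
      then show "?\<delta> x y = ?\<delta> x z \<or> ?\<delta> x y = ?\<delta> y z \<or> ?\<delta> x z = ?\<delta> y z"
        using dist ne by (auto simp: Delta_relation_def card_insert_if split: if_splits)
    next
      fix a b c e assume V: "a \<in> X" "b \<in> X" "c \<in> X" "e \<in> X" and dist: "distinct [a, b, c, e]"
        and *: "?\<delta> a b \<noteq> odot" "?\<delta> a c \<noteq> odot"
          "?\<delta> a b = ?\<delta> b c" "?\<delta> b c = ?\<delta> c e" "?\<delta> c a = ?\<delta> a e" "?\<delta> a e = ?\<delta> e b"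
      have "\<not> Pi_relation odot d a b c e" using r V by blast
      then have "\<not> (d {a, b} = d {b, c} \<and> d {b, c} = d {c, e} \<and> d {c, e} \<noteq> d {c, a} \<and>
          d {c, a} = d {a, e} \<and> d {a, e} = d {e, b} \<and> odot \<notin> {d {a, b}, d {a, c}})"
        using dist unfolding Pi_relation_def by blast
      then show "?\<delta> c e = ?\<delta> c a" using dist * by auto
    next
      fix x y z u assume V: "x \<in> X" "y \<in> X" "z \<in> X" "u \<in> X" and dist: "distinct [x, y, z, u]"
        and ne: "?\<delta> z u = odot" "?\<delta> x y \<noteq> odot" "?\<delta> x z \<noteq> odot" "?\<delta> x u \<noteq> odot" "?\<delta> y z \<noteq> odot" "?\<delta> y u \<noteq> odot"
      have "d {x, z} = d {y, z} \<and> d {x, u} = d {y, u}"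
        using r[THEN conjunct2, THEN conjunct2, THEN conjunct2, rule_format, OF V] five[OF V dist] dist ne by simp
      then show "?\<delta> x z = ?\<delta> y z \<and> ?\<delta> x u = ?\<delta> y u" using dist by auto
    next
      show "\<exists>D. graph_metric X (\<lambda>x y. ?\<delta> x y \<noteq> odot) D \<and> ptolemaic_on X D"
        using r con by blast
      show "?\<delta> x y = ?\<delta> y x" for x y using comm[of x y] by simp
      show "?\<delta> x x \<noteq> odot" for x using M by auto
    qed
  qed
qed

section \<open>Gluing oriented trees\<close>

lemma glue_retract:
  assumes sub: "F1 \<subseteq> V1 \<times> V1" "F2 \<subseteq> V2 \<times> V2" and h: "V1 \<inter> V2 = {h}"
    and ab: "(a, b) \<in> (F1 \<union> F2)\<^sup>*"
  shows "(if a \<in> V1 then a else h, if b \<in> V1 then b else h) \<in> F1\<^sup>*"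
  using ab
proof (rule rtrancl_image[where f = "\<lambda>x. if x \<in> V1 then x else h"])
  fix x y assume "(x, y) \<in> F1 \<union> F2"
  then show "(if x \<in> V1 then x else h, if y \<in> V1 then y else h) \<in> F1\<^sup>*"
  proof
    assume "(x, y) \<in> F1"
    then show ?thesis using sub(1) by auto
  next
    assume "(x, y) \<in> F2"
    then have "(if x \<in> V1 then x else h) = h" "(if y \<in> V1 then y else h) = h" using sub(2) h by auto
    then show ?thesis by simp
  qed
qed

lemma oriented_tree_arc: "a \<noteq> b \<Longrightarrow> oriented_tree {a, b} {(a, b)}"
  by (auto simp: oriented_tree_def)

lemma oriented_tree_glue:
  assumes T1: "oriented_tree V1 E1" and T2: "oriented_tree V2 E2" and h: "V1 \<inter> V2 = {h}"
  shows "oriented_tree (V1 \<union> V2) (E1 \<union> E2)"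
proof -
  have E1: "E1 \<subseteq> V1 \<times> V1" and E2: "E2 \<subseteq> V2 \<times> V2" using T1 T2 by (auto dest: oriented_tree_arcs)
  have bridge: "(a, b) \<notin> linked (F \<union> G - {(a, b)})"
    if T: "oriented_tree V F" and G: "G \<subseteq> W \<times> W" and VW: "V \<inter> W = {h}" and ab: "(a, b) \<in> F" for a b F G V W
  proof
    assume "(a, b) \<in> linked (F \<union> G - {(a, b)})"
    then have "(a, b) \<in> ((F - {(a, b)}) \<union> (F - {(a, b)})\<inverse> \<union> (G \<union> G\<inverse>))\<^sup>*"
      by (rule rev_subsetD) (intro rtrancl_mono, auto)
    moreover have F: "F \<subseteq> V \<times> V" by (rule oriented_tree_arcs[OF T])
    then have "(F - {(a, b)}) \<union> (F - {(a, b)})\<inverse> \<subseteq> V \<times> V" "G \<union> G\<inverse> \<subseteq> W \<times> W" using G by auto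
    ultimately have "(if a \<in> V then a else h, if b \<in> V then b else h) \<in> linked (F - {(a, b)})"
      using VW by (intro glue_retract)
    moreover have "a \<in> V" "b \<in> V" using F ab by auto
    ultimately have "(a, b) \<in> linked (F - {(a, b)})" by simp
    then show False using oriented_tree_bridge[OF T ab] by contradiction
  qed
  have link: "(a, h) \<in> linked (E1 \<union> E2)" if "a \<in> V1 \<union> V2" for a
    using that
  proof
    assume "a \<in> V1"
    then have "(a, h) \<in> linked E1" using oriented_tree_linked[OF T1] h by blast
    then show ?thesis by (rule linked_mono[rotated]) simp
  next
    assume "a \<in> V2"
    then have "(a, h) \<in> linked E2" using oriented_tree_linked[OF T2] h by blast
    then show ?thesis by (rule linked_mono[rotated]) simp
  qed
  show ?thesis
    unfolding oriented_tree_def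
  proof (intro conjI ballI allI impI)
    show "finite (V1 \<union> V2)" using oriented_tree_finite[OF T1] oriented_tree_finite[OF T2] by simp
    show "V1 \<union> V2 \<noteq> {}" using h by blast
    show "E1 \<union> E2 \<subseteq> (V1 \<union> V2) \<times> (V1 \<union> V2)" using E1 E2 by blast
    fix a b
    show "(a, b) \<in> linked (E1 \<union> E2)" if "a \<in> V1 \<union> V2" "b \<in> V1 \<union> V2"
      using link[OF that(1)] linked_sym[OF link[OF that(2)]] by (rule rtrancl_trans)
    show "(a, b) \<notin> linked (E1 \<union> E2 - {(a, b)})" if "(a, b) \<in> E1 \<union> E2"
      using that
    proof
      assume "(a, b) \<in> E1"
      then show ?thesis by (rule bridge[OF T1 E2 h])
    next
      assume ab: "(a, b) \<in> E2"
      have "V2 \<inter> V1 = {h}" using h by blast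
      from bridge[OF T2 E1 this ab] show ?thesis by (simp add: Un_commute)
    qed
  qed
qed

lemma glue_rtrancl:
  assumes "E1 \<subseteq> V1 \<times> V1" "E2 \<subseteq> V2 \<times> V2" "V1 \<inter> V2 = {h}"
  shows glue_rtrancl_same: "\<lbrakk>u \<in> V1; v \<in> V1\<rbrakk> \<Longrightarrow> (u, v) \<in> (E1 \<union> E2)\<^sup>* \<longleftrightarrow> (u, v) \<in> E1\<^sup>*"
    and glue_rtrancl_across: "\<lbrakk>u \<in> V1; v \<in> V2\<rbrakk> \<Longrightarrow>
      (u, v) \<in> (E1 \<union> E2)\<^sup>* \<longleftrightarrow> (u, h) \<in> E1\<^sup>* \<and> (h, v) \<in> E2\<^sup>*"
proof -
  have h: "h \<in> V1" "h \<in> V2" "V2 \<inter> V1 = {h}" using assms(3) by auto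
  have up: "(u, v) \<in> E1\<^sup>* \<Longrightarrow> (u, v) \<in> (E1 \<union> E2)\<^sup>*" "(u, v) \<in> E2\<^sup>* \<Longrightarrow> (u, v) \<in> (E1 \<union> E2)\<^sup>*" for u v
    by (meson Un_upper1 Un_upper2 rtrancl_mono subsetD)+
  show "(u, v) \<in> (E1 \<union> E2)\<^sup>* \<longleftrightarrow> (u, v) \<in> E1\<^sup>*" if "u \<in> V1" "v \<in> V1" for u v
    using glue_retract[OF assms, of u v] that up(1) by auto
  show "(u, v) \<in> (E1 \<union> E2)\<^sup>* \<longleftrightarrow> (u, h) \<in> E1\<^sup>* \<and> (h, v) \<in> E2\<^sup>*" if uv: "u \<in> V1" "v \<in> V2" for u v
  proof
    assume "(u, h) \<in> E1\<^sup>* \<and> (h, v) \<in> E2\<^sup>*"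
    then show "(u, v) \<in> (E1 \<union> E2)\<^sup>*" using up rtrancl_trans by metis
  next
    assume r: "(u, v) \<in> (E1 \<union> E2)\<^sup>*"
    have "(if v \<in> V1 then v else h) = h" "(if u \<in> V2 then u else h) = h" using uv assms(3) by auto
    then show "(u, h) \<in> E1\<^sup>* \<and> (h, v) \<in> E2\<^sup>*"
      using glue_retract[OF assms r] glue_retract[OF assms(2,1) h(3), of u v] r uv
      by (simp add: Un_commute)
  qed
qed

lemma lca_of_glue:
  assumes T1: "oriented_tree V1 E1" and T2: "oriented_tree V2 E2" and h: "V1 \<inter> V2 = {h}"
    and sink: "h \<notin> Domain E1"
  shows lca_of_glue_11: "\<lbrakk>x \<in> V1 - {h}; y \<in> V1\<rbrakk> \<Longrightarrow> lca_of (E1 \<union> E2) x y = lca_of E1 x y"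
    and lca_of_glue_12: "\<lbrakk>x \<in> V1 - {h}; y \<in> V2; (h, y) \<in> E2\<^sup>*\<rbrakk> \<Longrightarrow> lca_of (E1 \<union> E2) x y = lca_of E1 x h"
    and lca_of_glue_none: "\<lbrakk>x \<in> V1 - {h}; y \<in> V2; (h, y) \<notin> E2\<^sup>*\<rbrakk> \<Longrightarrow> \<not> lca_of (E1 \<union> E2) x y v"
    and lca_of_glue_22: "\<lbrakk>x \<in> V2; y \<in> V2\<rbrakk> \<Longrightarrow> lca_of (E1 \<union> E2) x y = lca_of E2 x y"
proof -
  let ?E = "E1 \<union> E2"
  have E1: "E1 \<subseteq> V1 \<times> V1" and E2: "E2 \<subseteq> V2 \<times> V2" using T1 T2 by (auto dest: oriented_tree_arcs)
  have h': "V2 \<inter> V1 = {h}" and hV: "h \<in> V1" "h \<in> V2" using h by auto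
  have R11: "(u, v) \<in> ?E\<^sup>* \<longleftrightarrow> (u, v) \<in> E1\<^sup>*" if "u \<in> V1" "v \<in> V1" for u v
    by (rule glue_rtrancl_same[OF E1 E2 h that])
  have R22: "(u, v) \<in> ?E\<^sup>* \<longleftrightarrow> (u, v) \<in> E2\<^sup>*" if "u \<in> V2" "v \<in> V2" for u v
    using glue_rtrancl_same[OF E2 E1 h' that] by (simp add: Un_commute)
  have R12: "(u, v) \<in> ?E\<^sup>* \<longleftrightarrow> (u, h) \<in> E1\<^sup>* \<and> (h, v) \<in> E2\<^sup>*" if "u \<in> V1" "v \<in> V2" for u v
    by (rule glue_rtrancl_across[OF E1 E2 h that])
  have hsink: "v = h" if "(h, v) \<in> E1\<^sup>*" for v using that sink by (auto elim: converse_rtranclE)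
  have R21: "(u, v) \<notin> ?E\<^sup>*" if "u \<in> V2" "v \<in> V1 - {h}" for u v
    using glue_rtrancl_across[OF E2 E1 h' that(1), of v] that hsink by (auto simp: Un_commute)
  have inV: "v \<in> V1 \<or> v \<in> V2" if "(v, x) \<in> ?E\<^sup>*" "x \<in> V1 \<union> V2" for v x
    using rtrancl_closed[OF that(1) oriented_tree_arcs[OF oriented_tree_glue[OF T1 T2 h]]] that(2) by auto
  have inV1: "v \<in> V1" if "(v, x) \<in> E1\<^sup>*" "x \<in> V1" for v x
    using rtrancl_closed[OF that(1) E1] that(2) by auto
  have inV2: "v \<in> V2" if "(v, x) \<in> E2\<^sup>*" "x \<in> V2" for v x
    using rtrancl_closed[OF that(1) E2] that(2) by auto
  have out1: "(v, c) \<in> ?E \<longleftrightarrow> (v, c) \<in> E1" if "v \<in> V1 - {h}" for v c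
    using that E2 h by auto
  have out2: "(v, c) \<in> ?E \<longleftrightarrow> (v, c) \<in> E2" if "v \<in> V2" for v c
    using that E1 h sink by auto
  have child1: "c \<in> V1" if "(v, c) \<in> E1" for v c using that E1 by auto
  have child2: "c \<in> V2" if "(v, c) \<in> E2" for v c using that E2 by auto
  have side1: "v \<in> V1 - {h}" if "(v, x) \<in> ?E\<^sup>*" "x \<in> V1 - {h}" for v x
    using that inV[of v x] R21[of v x] hV by auto
  have side1': "v \<in> V1 - {h}" if "(v, x) \<in> E1\<^sup>*" "x \<in> V1 - {h}" for v x
    using that inV1[of v x] hsink by auto
  show "lca_of ?E x y = lca_of E1 x y" if xy: "x \<in> V1 - {h}" "y \<in> V1" for x y
  proof
    fix v
    show "lca_of ?E x y v = lca_of E1 x y v"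
    proof (cases "v \<in> V1 - {h}")
      case True
      have "(\<forall>c. (v, c) \<in> ?E \<longrightarrow> \<not> ((c, x) \<in> ?E\<^sup>* \<and> (c, y) \<in> ?E\<^sup>*)) \<longleftrightarrow>
        (\<forall>c. (v, c) \<in> E1 \<longrightarrow> \<not> ((c, x) \<in> E1\<^sup>* \<and> (c, y) \<in> E1\<^sup>*))"
        unfolding out1[OF True] using child1 R11 xy by blast
      then show ?thesis using True xy R11 by (simp add: lca_of_def)
    next
      case False
      then show ?thesis using side1[of v x] side1'[of v x] xy unfolding lca_of_def by blast
    qed
  qed
  show "lca_of ?E x y = lca_of E1 x h" if xy: "x \<in> V1 - {h}" "y \<in> V2" "(h, y) \<in> E2\<^sup>*" for x y
  proof
    fix v
    have y: "(c, y) \<in> ?E\<^sup>* \<longleftrightarrow> (c, h) \<in> E1\<^sup>*" if "c \<in> V1" for c using R12[OF that xy(2)] xy(3) by simp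
    show "lca_of ?E x y v = lca_of E1 x h v"
    proof (cases "v \<in> V1 - {h}")
      case True
      have "(\<forall>c. (v, c) \<in> ?E \<longrightarrow> \<not> ((c, x) \<in> ?E\<^sup>* \<and> (c, y) \<in> ?E\<^sup>*)) \<longleftrightarrow>
        (\<forall>c. (v, c) \<in> E1 \<longrightarrow> \<not> ((c, x) \<in> E1\<^sup>* \<and> (c, h) \<in> E1\<^sup>*))"
        unfolding out1[OF True] using child1 R11 y xy by blast
      then show ?thesis using True xy R11 y by (simp add: lca_of_def)
    next
      case False
      then show ?thesis using side1[of v x] side1'[of v x] xy unfolding lca_of_def by blast
    qed
  qed
  show "\<not> lca_of ?E x y v" if xy: "x \<in> V1 - {h}" "y \<in> V2" "(h, y) \<notin> E2\<^sup>*" for x y v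
    using side1[of v x] R12[of v y] xy unfolding lca_of_def by blast
  show "lca_of ?E x y = lca_of E2 x y" if xy: "x \<in> V2" "y \<in> V2" for x y
  proof
    fix v
    show "lca_of ?E x y v = lca_of E2 x y v"
    proof (cases "v \<in> V2")
      case True
      have "(\<forall>c. (v, c) \<in> ?E \<longrightarrow> \<not> ((c, x) \<in> ?E\<^sup>* \<and> (c, y) \<in> ?E\<^sup>*)) \<longleftrightarrow>
        (\<forall>c. (v, c) \<in> E2 \<longrightarrow> \<not> ((c, x) \<in> E2\<^sup>* \<and> (c, y) \<in> E2\<^sup>*))"
        unfolding out2[OF True] using child2 R22 xy by blast
      then show ?thesis using True xy R22 by (simp add: lca_of_def)
    next
      case False
      have "\<not> lca_of ?E x y v"
      proof
        assume l: "lca_of ?E x y v"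
        then have r: "(v, x) \<in> ?E\<^sup>*" "(v, y) \<in> ?E\<^sup>*" by (auto simp: lca_of_def)
        have v: "v \<in> V1" using inV[OF r(1)] xy False by blast
        then have r': "(v, h) \<in> E1\<^sup>*" "(h, x) \<in> E2\<^sup>*" "(h, y) \<in> E2\<^sup>*" using R12 r xy by blast+
        have "v \<noteq> h" using False hV by blast
        then obtain c where c: "(v, c) \<in> E1" "(c, h) \<in> E1\<^sup>*" using r'(1) by (metis converse_rtranclE)
        then have "(c, x) \<in> ?E\<^sup>*" "(c, y) \<in> ?E\<^sup>*" using R12 r' child1 xy by blast+
        then show False using l c(1) unfolding lca_of_def by blast
      qed
      then show ?thesis using False inV2[of v x] xy unfolding lca_of_def by blast
    qed
  qed
qed

lemma
  assumes "E2 \<subseteq> V2 \<times> V2" "v \<notin> V2"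
  shows indeg_glue_other: "indeg (E1 \<union> E2) v = indeg E1 v"
    and outdeg_glue_other: "outdeg (E1 \<union> E2) v = outdeg E1 v"
proof -
  have "{e \<in> E1 \<union> E2. snd e = v} = {e \<in> E1. snd e = v}" "{e \<in> E1 \<union> E2. fst e = v} = {e \<in> E1. fst e = v}"
    using assms by auto
  then show "indeg (E1 \<union> E2) v = indeg E1 v" "outdeg (E1 \<union> E2) v = outdeg E1 v"
    by (simp_all add: indeg_def outdeg_def)
qed

lemma
  assumes "finite E1" "finite E2" "E1 \<inter> E2 = {}"
  shows indeg_Un: "indeg (E1 \<union> E2) v = indeg E1 v + indeg E2 v"
    and outdeg_Un: "outdeg (E1 \<union> E2) v = outdeg E1 v + outdeg E2 v"
proof -
  have "{e \<in> E1 \<union> E2. snd e = v} = {e \<in> E1. snd e = v} \<union> {e \<in> E2. snd e = v}"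
    "{e \<in> E1 \<union> E2. fst e = v} = {e \<in> E1. fst e = v} \<union> {e \<in> E2. fst e = v}" by auto
  then show "indeg (E1 \<union> E2) v = indeg E1 v + indeg E2 v"
    "outdeg (E1 \<union> E2) v = outdeg E1 v + outdeg E2 v"
    using assms by (auto simp: indeg_def outdeg_def intro!: card_Un_disjoint)
qed

lemma oriented_tree_disjoint:
  assumes T1: "oriented_tree V1 E1" and T2: "oriented_tree V2 E2" and h: "V1 \<inter> V2 = {h}"
  shows "E1 \<inter> E2 = {}"
proof -
  have "(a, b) \<notin> E2" if "(a, b) \<in> E1" for a b
  proof
    assume "(a, b) \<in> E2"
    then have "a = h" "b = h" using that oriented_tree_arcs[OF T1] oriented_tree_arcs[OF T2] h by blast+
    then show False using oriented_tree_bridge[OF T1 that] by simp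
  qed
  then show ?thesis by auto
qed

lemma
  shows indeg_arc: "indeg {(a, b)} v = (if v = b then 1 else 0)"
    and outdeg_arc: "outdeg {(a, b)} v = (if v = a then 1 else 0)"
proof -
  have "{e \<in> {(a, b)}. snd e = v} = (if v = b then {(a, b)} else {})"
    "{e \<in> {(a, b)}. fst e = v} = (if v = a then {(a, b)} else {})" by auto
  then show "indeg {(a, b)} v = (if v = b then 1 else 0)" "outdeg {(a, b)} v = (if v = a then 1 else 0)"
    by (simp_all add: indeg_def outdeg_def)
qed

lemma
  assumes "b \<noteq> c"
  shows indeg_star: "indeg {(a, b), (a, c)} v = (if v = b \<or> v = c then 1 else 0)"
    and outdeg_star: "outdeg {(a, b), (a, c)} v = (if v = a then 2 else 0)"
  using indeg_Un[of "{(a, b)}" "{(a, c)}" v] outdeg_Un[of "{(a, b)}" "{(a, c)}" v] assms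
  by (auto simp: indeg_arc outdeg_arc insert_is_Un[of "(a, b)" "{(a, c)}"])

lemma oriented_tree_star:
  assumes "distinct [a, b, c]"
  shows "oriented_tree {a, b, c} {(a, b), (a, c)}"
proof -
  have "oriented_tree ({a, b} \<union> {a, c}) ({(a, b)} \<union> {(a, c)})"
    using assms by (intro oriented_tree_glue[of _ _ _ _ a] oriented_tree_arc) auto
  then show ?thesis by (simp add: insert_commute)
qed

lemma lca_of_star:
  assumes "distinct [a, b, c]"
  shows "lca_of {(a, b), (a, c)} b c a"
proof -
  have "(b, c) \<notin> {(a, b), (a, c)}\<^sup>*" "(c, b) \<notin> {(a, b), (a, c)}\<^sup>*"
    using assms by (auto elim: converse_rtranclE)
  then show ?thesis by (auto simp: lca_of_def)
qed

section \<open>Constructing networks\<close>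

definition network_rep ::
    "'m set \<Rightarrow> 'm \<Rightarrow> 'a set \<Rightarrow> ('a \<Rightarrow> 'a \<Rightarrow> 'm) \<Rightarrow> 'v set \<Rightarrow> ('v \<times> 'v) set \<Rightarrow> ('a \<Rightarrow> 'v) \<Rightarrow> ('v \<Rightarrow> 'm) \<Rightarrow> bool" where
  "network_rep M odot X \<delta> V E f t \<longleftrightarrow> oriented_tree V E \<and>
     (\<forall>v\<in>V. network_degrees (indeg E v) (outdeg E v)) \<and> inj_on f X \<and> f ` X = V - Domain E \<and>
     t ` Domain E \<subseteq> M \<and> (\<forall>x\<in>X. \<forall>y\<in>X. x \<noteq> y \<longrightarrow> lca_label E t odot (f x) (f y) = \<delta> x y)"

lemma network_repD:
  assumes "network_rep M odot X \<delta> V E f t"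
  shows "oriented_tree V E" "v \<in> V \<Longrightarrow> network_degrees (indeg E v) (outdeg E v)"
    "inj_on f X" "f ` X = V - Domain E" "t ` Domain E \<subseteq> M"
    "\<lbrakk>x \<in> X; y \<in> X; x \<noteq> y\<rbrakk> \<Longrightarrow> lca_label E t odot (f x) (f y) = \<delta> x y"
  using assms by (simp_all add: network_rep_def)

lemma network_rep_leaf:
  assumes "network_rep M odot X \<delta> V E f t" "x \<in> X"
  shows "f x \<in> V" "f x \<notin> Domain E" "outdeg E (f x) = 0" "indeg E (f x) = 1"
proof -
  have T: "oriented_tree V E" using assms by (simp add: network_rep_def)
  have "f x \<in> V - Domain E" using assms by (auto simp: network_rep_def)
  then show "f x \<in> V" "f x \<notin> Domain E" by auto
  then show "outdeg E (f x) = 0" using outdeg_eq_0_iff[OF oriented_tree_finite_arcs[OF T]] by blast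
  then show "indeg E (f x) = 1"
    using assms \<open>f x \<in> V\<close> by (auto simp: network_rep_def network_degrees_def)
qed

lemma lca_label_cong:
  assumes "lca_of E x y = lca_of E' x' y'" "\<And>v. \<lbrakk>lca_of E' x' y' v\<rbrakk> \<Longrightarrow> t v = t' v"
    and "oriented_tree V E'" "x' \<in> V" "y' \<in> V"
  shows "lca_label E t odot x y = lca_label E' t' odot x' y'"
proof (cases "\<exists>v. lca_of E' x' y' v")
  case True
  then obtain v where v: "lca_of E' x' y' v" ..
  have "(THE v. lca_of E' x' y' v) = v"
    using lca_of_unique[OF assms(3-5) _ v] v by (rule the_equality[rotated])
  then show ?thesis using v assms(2) by (auto simp: lca_label_def assms(1))
qed (simp add: lca_label_def assms(1))

lemma lca_label_commute: "lca_label E t odot x y = lca_label E t odot y x"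
  by (simp add: lca_label_def lca_of_commute[of E x y])

lemma lca_of_in_verts:
  assumes "oriented_tree V E" "x \<in> V" "lca_of E x y v"
  shows "v \<in> V"
  using rtrancl_closed[of v x E, OF _ oriented_tree_arcs[OF assms(1)]] assms by (auto simp: lca_of_def)

lemma lca_of_ne_sink:
  assumes "lca_of E x y v" "x \<noteq> h" "h \<notin> Domain E"
  shows "v \<noteq> h"
  using assms by (auto simp: lca_of_def elim: converse_rtranclE)

lemma network_rep_cherry:
  fixes a b c :: 'v
  assumes "distinct [a, b, c]" "x \<noteq> y" "\<delta> x y \<in> M" "\<delta> y x = \<delta> x y"
  shows "network_rep M odot {x, y} \<delta> {a, b, c} {(a, b), (a, c)} (\<lambda>z. if z = x then b else c) (\<lambda>_. \<delta> x y)"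
proof -
  let ?E = "{(a, b), (a, c)}"
  have T: "oriented_tree {a, b, c} ?E" by (rule oriented_tree_star[OF assms(1)])
  have "lca_label ?E (\<lambda>_. \<delta> x y) odot b c = \<delta> x y"
    by (rule lca_label_eq[OF T _ _ lca_of_star[OF assms(1)]]) auto
  then show ?thesis
    using T assms lca_label_commute[of ?E "\<lambda>_. \<delta> x y" odot b c]
    by (auto simp: network_rep_def network_degrees_def indeg_star outdeg_star inj_on_def)
qed

lemma network_rep_twin:
  fixes V :: "'v set"
  assumes N: "network_rep M odot (X - {y}) \<delta> V E f t"
    and x: "x \<in> X" "y \<in> X" "x \<noteq> y" and xy: "\<delta> x y \<in> M"
    and sym: "\<And>u v. \<lbrakk>u \<in> X; v \<in> X\<rbrakk> \<Longrightarrow> \<delta> u v = \<delta> v u"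
    and twin: "\<And>z. z \<in> X - {x, y} \<Longrightarrow> \<delta> x z = \<delta> y z"
    and new: "n1 \<notin> V" "n2 \<notin> V" "n1 \<noteq> n2"
  shows "network_rep M odot X \<delta> (insert n1 (insert n2 V)) (E \<union> {(f x, n1), (f x, n2)})
    (f(x := n1, y := n2)) (t(f x := \<delta> x y))"
proof -
  define h where "h = f x"
  define S where "S = {(h, n1), (h, n2)}"
  define E' where "E' = E \<union> S"
  define f' where "f' = f(x := n1, y := n2)"
  define t' where "t' = t(h := \<delta> x y)"
  have xX: "x \<in> X - {y}" using x by simp
  note T = network_repD(1)[OF N] and deg = network_repD(2)[OF N] and inj = network_repD(3)[OF N]
    and leaves = network_repD(4)[OF N] and tM = network_repD(5)[OF N] and lab = network_repD(6)[OF N]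
  note h = network_rep_leaf[OF N xX, folded h_def]
  have hn: "distinct [h, n1, n2]" using h new by auto
  have TS: "oriented_tree {h, n1, n2} S" unfolding S_def by (rule oriented_tree_star[OF hn])
  have Vh: "V \<inter> {h, n1, n2} = {h}" using h new by auto
  have verts: "V \<union> {h, n1, n2} = insert n1 (insert n2 V)" using h by auto
  have T': "oriented_tree (insert n1 (insert n2 V)) E'"
    using oriented_tree_glue[OF T TS Vh] by (simp only: verts E'_def)
  note S = oriented_tree_arcs[OF TS]
  have other: "f u \<in> V - {h}" "f u \<noteq> h" if "u \<in> X - {x, y}" for u
    using that leaves inj_on_eq_iff[OF inj, of u x] x by (auto simp: h_def)
  have deg': "network_degrees (indeg E' v) (outdeg E' v)" if v: "v \<in> insert n1 (insert n2 V)" for v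
  proof (cases "v \<in> V - {h}")
    case True
    then have "v \<notin> {h, n1, n2}" using new by auto
    then show ?thesis
      using indeg_glue_other[OF S] outdeg_glue_other[OF S] deg True by (simp add: E'_def)
  next
    case False
    then consider "v = h" | "v = n1 \<or> v = n2" using v by blast
    then show ?thesis
    proof cases
      case 1
      have "indeg E' h = 1" "outdeg E' h = 2"
        using indeg_Un[of E S h] outdeg_Un[of E S h] oriented_tree_disjoint[OF T TS Vh] h hn
          oriented_tree_finite_arcs[OF T] by (auto simp: E'_def S_def indeg_star outdeg_star)
      then show ?thesis using 1 by (simp add: network_degrees_def)
    next
      case 2
      have "indeg E' v = indeg S v" "outdeg E' v = outdeg S v"
        using indeg_glue_other[OF oriented_tree_arcs[OF T], of v S]
          outdeg_glue_other[OF oriented_tree_arcs[OF T], of v S] 2 new by (auto simp: E'_def Un_commute)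
      then show ?thesis using 2 hn by (auto simp: S_def indeg_star outdeg_star network_degrees_def)
    qed
  qed
  have reach: "(h, n) \<in> S\<^sup>*" if "n \<in> {n1, n2}" for n using that by (auto simp: S_def)
  have lab_other: "lca_label E' t' odot (f u) z = \<delta> u w"
    if u: "u \<in> X - {x, y}" and w: "w \<in> X - {y}" "u \<noteq> w" and z: "lca_of E' (f u) z = lca_of E (f u) (f w)" for u w z
  proof -
    have "lca_label E' t' odot (f u) z = lca_label E t odot (f u) (f w)"
    proof (rule lca_label_cong[OF z _ T])
      show "t' v = t v" if "lca_of E (f u) (f w) v" for v
        using lca_of_ne_sink[OF that other(2)[OF u] h(2)] by (simp add: t'_def)
    qed (use other[OF u] w leaves in auto)
    then show ?thesis using lab[of u w] u w by simp
  qed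
  have leaf: "lca_label E' t' odot (f u) n = \<delta> u x" if "u \<in> X - {x, y}" "n \<in> {n1, n2}" for u n
  proof (rule lab_other[OF that(1) xX])
    show "lca_of E' (f u) n = lca_of E (f u) (f x)"
      unfolding E'_def h_def[symmetric]
      by (rule lca_of_glue_12[OF T TS Vh h(2) other(1)[OF that(1)] _ reach[OF that(2)]]) (use that in auto)
  qed (use that in auto)
  have cherry: "lca_label E' t' odot n1 n2 = \<delta> x y"
  proof -
    have "lca_of E' n1 n2 = lca_of S n1 n2"
      unfolding E'_def by (rule lca_of_glue_22[OF T TS Vh h(2)]) auto
    then have "lca_of E' n1 n2 h" using lca_of_star[OF hn] by (simp add: S_def)
    from lca_label_eq[OF T' _ _ this, of t' odot] show ?thesis by (simp add: t'_def)
  qed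
  have lab': "lca_label E' t' odot (f' u) (f' v) = \<delta> u v" if uv: "u \<in> X" "v \<in> X" "u \<noteq> v" for u v
  proof -
    consider "u \<in> {x, y}" "v \<in> {x, y}" | "u \<in> {x, y}" "v \<notin> {x, y}" | "u \<notin> {x, y}" "v \<in> {x, y}"
      | "u \<notin> {x, y}" "v \<notin> {x, y}" by blast
    then show ?thesis
    proof cases
      case 1
      then show ?thesis using uv x cherry lca_label_commute[of E' t' odot n1 n2] sym[of x y]
        by (auto simp: f'_def)
    next
      case 2
      then have v: "v \<in> X - {x, y}" "f' v = f v" "f' u \<in> {n1, n2}" using uv x by (auto simp: f'_def)
      have "lca_label E' t' odot (f' u) (f' v) = \<delta> v x"
        using leaf[OF v(1,3)] v(2) lca_label_commute[of E' t' odot "f' u" "f' v"] by simp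
      also have "\<dots> = \<delta> u v" using 2 sym[of v x] twin[OF v(1)] uv x by auto
      finally show ?thesis .
    next
      case 3
      then have u: "u \<in> X - {x, y}" "f' u = f u" "f' v \<in> {n1, n2}" using uv x by (auto simp: f'_def)
      have "lca_label E' t' odot (f' u) (f' v) = \<delta> u x" using leaf[OF u(1,3)] u(2) by simp
      also have "\<dots> = \<delta> u v" using 3 sym[of u x] sym[of u y] twin[OF u(1)] uv x by auto
      finally show ?thesis .
    next
      case 4
      then have u: "u \<in> X - {x, y}" "v \<in> X - {x, y}" "f' u = f u" "f' v = f v" using uv by (auto simp: f'_def)
      have "lca_of E' (f u) (f v) = lca_of E (f u) (f v)"
        unfolding E'_def using other[OF u(1)] other[OF u(2)] by (intro lca_of_glue_11[OF T TS Vh h(2)]) auto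
      then show ?thesis using lab_other[OF u(1) _ uv(3)] u by auto
    qed
  qed
  have inj': "inj_on f' X"
  proof (rule inj_onI)
    fix u v assume uv: "u \<in> X" "v \<in> X" "f' u = f' v"
    have fV: "f w \<noteq> n1" "f w \<noteq> n2" if "w \<in> X - {x, y}" for w using other(1)[OF that] new by auto
    show "u = v"
      using uv fV[of u] fV[of v] inj_on_eq_iff[OF inj, of u v] new x
      by (auto simp: f'_def split: if_splits)
  qed
  have leaves': "f' ` X = insert n1 (insert n2 V) - Domain E'"
  proof -
    have "X = insert x (insert y (X - {x, y}))" using x by auto
    then have "f' ` X = f' ` insert x (insert y (X - {x, y}))" by simp
    also have "\<dots> = insert n1 (insert n2 (f ` (X - {x, y})))"
      using x by (auto simp: f'_def)
    also have "f ` (X - {x, y}) = f ` (X - {y}) - {h}"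
      using inj x other by (auto simp: h_def inj_on_eq_iff)
    also have "\<dots> = V - Domain E'" using leaves by (auto simp: E'_def S_def)
    also have "insert n1 (insert n2 (V - Domain E')) = insert n1 (insert n2 V) - Domain E'"
      using new oriented_tree_arcs[OF T] hn by (auto simp: E'_def S_def)
    finally show ?thesis .
  qed
  have tM': "t' ` Domain E' \<subseteq> M" using tM xy by (auto simp: t'_def E'_def S_def)
  have "network_rep M odot X \<delta> (insert n1 (insert n2 V)) E' f' t'"
    unfolding network_rep_def
    by (intro conjI ballI impI T' deg' inj' leaves' tM' lab')
  then show ?thesis by (simp only: f'_def t'_def E'_def S_def h_def)
qed

lemma network_rep_transport:
  assumes N: "network_rep M odot X \<delta> V E f t" and g: "inj_on g V"
  shows "network_rep M odot X \<delta> (g ` V) (map_prod g g ` E) (g \<circ> f) (t \<circ> the_inv_into V g)"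
proof -
  define k where "k = the_inv_into V g"
  have k: "k (g v) = v" if "v \<in> V" for v using the_inv_into_f_f[OF g that] by (simp add: k_def)
  let ?g = "\<lambda>R. map_prod g g ` R"
  note T = network_repD(1)[OF N] and deg = network_repD(2)[OF N] and inj = network_repD(3)[OF N]
    and leaves = network_repD(4)[OF N] and tM = network_repD(5)[OF N] and lab = network_repD(6)[OF N]
  have E: "E \<subseteq> V \<times> V" by (rule oriented_tree_arcs[OF T])
  have inj2: "inj_on (map_prod g g) (V \<times> V)" by (rule map_prod_inj_on[OF g g])
  have reach: "(g u, g v) \<in> (?g R)\<^sup>* \<longleftrightarrow> (u, v) \<in> R\<^sup>*" if R: "R \<subseteq> V \<times> V" and uv: "u \<in> V" "v \<in> V" for u v R
  proof
    assume "(g u, g v) \<in> (?g R)\<^sup>*"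
    then have "(k (g u), k (g v)) \<in> R\<^sup>*"
      by (rule rtrancl_image) (use R k in auto)
    then show "(u, v) \<in> R\<^sup>*" using k uv by simp
  next
    assume "(u, v) \<in> R\<^sup>*"
    then show "(g u, g v) \<in> (?g R)\<^sup>*" by (rule rtrancl_image) force
  qed
  have conv: "?g R \<union> (?g R)\<inverse> = ?g (R \<union> R\<inverse>)" for R by force
  have arc: "(g u, g v) \<in> ?g E \<longleftrightarrow> (u, v) \<in> E" if "u \<in> V" "v \<in> V" for u v
    using inj_on_image_mem_iff[OF inj2, of "(u, v)" E] that E by simp
  have T': "oriented_tree (g ` V) (?g E)"
    unfolding oriented_tree_def
  proof (intro conjI ballI allI impI)
    show "finite (g ` V)" "g ` V \<noteq> {}" using oriented_tree_finite[OF T] oriented_tree_nonempty[OF T] by auto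
    show "?g E \<subseteq> g ` V \<times> g ` V" using E by auto
    fix a b assume "a \<in> g ` V" "b \<in> g ` V"
    then show "(a, b) \<in> linked (?g E)"
      unfolding conv using reach[of "E \<union> E\<inverse>"] E oriented_tree_linked[OF T] by auto
  next
    fix a b assume "(a, b) \<in> ?g E"
    then obtain u v where uv: "a = g u" "b = g v" "(u, v) \<in> E" by auto
    then have V: "u \<in> V" "v \<in> V" using E by auto
    have "?g E - {(a, b)} = ?g (E - {(u, v)})"
    proof -
      have "E - {(u, v)} \<subseteq> V \<times> V" "{(u, v)} \<subseteq> V \<times> V" using E V by auto
      from inj_on_image_set_diff[OF inj2 this] show ?thesis using uv by simp
    qed
    moreover have "(g u, g v) \<notin> linked (?g (E - {(u, v)}))"
      unfolding conv using reach[of "(E - {(u, v)}) \<union> (E - {(u, v)})\<inverse>" u v] E V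
        oriented_tree_bridge[OF T uv(3)] by auto
    ultimately show "(a, b) \<notin> linked (?g E - {(a, b)})" using uv by simp
  qed
  have "indeg (?g E) (g v) = indeg E v" "outdeg (?g E) (g v) = outdeg E v" if v: "v \<in> V" for v
  proof -
    have "{e \<in> ?g E. snd e = g v} = ?g {e \<in> E. snd e = v}" "{e \<in> ?g E. fst e = g v} = ?g {e \<in> E. fst e = v}"
      using E v inj_on_eq_iff[OF g] by (auto simp: image_iff) force+
    moreover have "inj_on (map_prod g g) {e \<in> E. snd e = v}" "inj_on (map_prod g g) {e \<in> E. fst e = v}"
      using E by (auto intro: inj_on_subset[OF inj2])
    ultimately show "indeg (?g E) (g v) = indeg E v" "outdeg (?g E) (g v) = outdeg E v"
      by (simp_all add: indeg_def outdeg_def card_image)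
  qed
  then have deg': "network_degrees (indeg (?g E) v) (outdeg (?g E) v)" if "v \<in> g ` V" for v
    using that deg by auto
  have lca: "lca_of (?g E) (g u) (g v) (g w) \<longleftrightarrow> lca_of E u v w" if uvw: "u \<in> V" "v \<in> V" "w \<in> V" for u v w
  proof -
    have "(\<forall>c. (g w, c) \<in> ?g E \<longrightarrow> \<not> ((c, g u) \<in> (?g E)\<^sup>* \<and> (c, g v) \<in> (?g E)\<^sup>*)) \<longleftrightarrow>
        (\<forall>c\<in>V. (g w, g c) \<in> ?g E \<longrightarrow> \<not> ((g c, g u) \<in> (?g E)\<^sup>* \<and> (g c, g v) \<in> (?g E)\<^sup>*))"
      (is "?L \<longleftrightarrow> ?R")
    proof
      assume R: ?R
      show ?L
      proof (intro allI impI)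
        fix c assume c: "(g w, c) \<in> ?g E"
        then obtain c' where "c = g c'" "c' \<in> V" using E by auto
        then show "\<not> ((c, g u) \<in> (?g E)\<^sup>* \<and> (c, g v) \<in> (?g E)\<^sup>*)" using R c by simp
      qed
    qed simp
    also have "\<dots> \<longleftrightarrow> (\<forall>c\<in>V. (w, c) \<in> E \<longrightarrow> \<not> ((c, u) \<in> E\<^sup>* \<and> (c, v) \<in> E\<^sup>*))"
      using reach[OF E] arc uvw by simp
    also have "\<dots> \<longleftrightarrow> (\<forall>c. (w, c) \<in> E \<longrightarrow> \<not> ((c, u) \<in> E\<^sup>* \<and> (c, v) \<in> E\<^sup>*))" using E by auto
    finally show ?thesis using reach[OF E] uvw by (simp add: lca_of_def)
  qed
  have lab': "lca_label (?g E) (t \<circ> k) odot (g u) (g v) = lca_label E t odot u v" if uv: "u \<in> V" "v \<in> V" for u v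
  proof (cases "\<exists>w. lca_of E u v w")
    case True
    then obtain w where w: "lca_of E u v w" ..
    have wV: "w \<in> V" by (rule lca_of_in_verts[OF T uv(1) w])
    have "lca_label (?g E) (t \<circ> k) odot (g u) (g v) = (t \<circ> k) (g w)"
      using uv lca[OF uv wV] w by (intro lca_label_eq[OF T']) auto
    then show ?thesis using lca_label_eq[OF T uv w, of t odot] k[OF wV] by simp
  next
    case False
    have "\<not> lca_of (?g E) (g u) (g v) w" for w
      using lca_of_in_verts[OF T', of "g u" "g v" w] lca[OF uv] False uv by auto
    then show ?thesis using False by (simp add: lca_label_def)
  qed
  have fV: "f x \<in> V" if "x \<in> X" for x using that leaves by auto
  have Dom: "Domain (?g E) = g ` Domain E" by force
  have DomV: "Domain E \<subseteq> V" using E by auto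
  show ?thesis
    unfolding network_rep_def k_def[symmetric]
  proof (intro conjI ballI impI)
    show "inj_on (g \<circ> f) X" using inj g leaves by (intro comp_inj_on) (auto intro: inj_on_subset)
    show "(g \<circ> f) ` X = g ` V - Domain (?g E)"
      unfolding Dom image_comp[symmetric] leaves using inj_on_image_set_diff[OF g _ DomV] by simp
    have "t (k (g v)) \<in> M" if "v \<in> Domain E" for v
      using k[OF subsetD[OF DomV that]] imageI[OF that, of t] tM by auto
    then show "(t \<circ> k) ` Domain (?g E) \<subseteq> M" unfolding Dom by auto
    show "lca_label (?g E) (t \<circ> k) odot ((g \<circ> f) u) ((g \<circ> f) v) = \<delta> u v"
      if "u \<in> X" "v \<in> X" "u \<noteq> v" for u v
      using lab'[OF fV[OF that(1)] fV[OF that(2)]] lab[OF that] by simp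
  qed (use T' deg' in auto)
qed

lemma network_rep_cut:
  assumes N1: "network_rep M odot (insert s A) \<delta> V1 E1 f1 t1"
    and N2: "network_rep M odot (insert s B) \<delta> V2 E2 f2 t2"
    and s: "s \<notin> A" "s \<notin> B" "A \<inter> B = {}" and fs: "f1 s = h" "f2 s = h" and h: "V1 \<inter> V2 = {h}"
    and n: "n \<notin> V1 \<union> V2" and m: "m \<in> M"
    and sym: "\<And>u v. \<lbrakk>u \<in> insert s (A \<union> B); v \<in> insert s (A \<union> B)\<rbrakk> \<Longrightarrow> \<delta> u v = \<delta> v u"
    and cross: "\<And>a b. \<lbrakk>a \<in> A; b \<in> B\<rbrakk> \<Longrightarrow> \<delta> a b = odot"
  shows "network_rep M odot (insert s (A \<union> B)) \<delta> (insert n (V1 \<union> V2)) (E1 \<union> E2 \<union> {(h, n)})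
    (\<lambda>x. if x = s then n else if x \<in> A then f1 x else f2 x)
    (\<lambda>v. if v = h then m else if v \<in> V1 then t1 v else t2 v)"
proof -
  define E' where "E' = E1 \<union> E2 \<union> {(h, n)}"
  define f' where "f' x = (if x = s then n else if x \<in> A then f1 x else f2 x)" for x
  define t' where "t' v = (if v = h then m else if v \<in> V1 then t1 v else t2 v)" for v
  note T1 = network_repD(1)[OF N1] and deg1 = network_repD(2)[OF N1] and inj1 = network_repD(3)[OF N1]
    and leaves1 = network_repD(4)[OF N1] and tM1 = network_repD(5)[OF N1] and lab1 = network_repD(6)[OF N1]
  note T2 = network_repD(1)[OF N2] and deg2 = network_repD(2)[OF N2] and inj2 = network_repD(3)[OF N2]
    and leaves2 = network_repD(4)[OF N2] and tM2 = network_repD(5)[OF N2] and lab2 = network_repD(6)[OF N2]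
  note h1 = network_rep_leaf[OF N1 insertI1, unfolded fs]
  note h2 = network_rep_leaf[OF N2 insertI1, unfolded fs]
  have h': "V2 \<inter> V1 = {h}" using h by blast
  note a1 = oriented_tree_arcs[OF T1] and a2 = oriented_tree_arcs[OF T2]
  have T12: "oriented_tree (V1 \<union> V2) (E1 \<union> E2)" by (rule oriented_tree_glue[OF T1 T2 h])
  have hn: "h \<noteq> n" using h1 n by auto
  have TA: "oriented_tree {h, n} {(h, n)}" by (rule oriented_tree_arc[OF hn])
  have hA: "(V1 \<union> V2) \<inter> {h, n} = {h}" using h1 n by auto
  have sink: "h \<notin> Domain (E1 \<union> E2)" using h1 h2 by auto
  have verts: "V1 \<union> V2 \<union> {h, n} = insert n (V1 \<union> V2)" using h1 by auto
  have T': "oriented_tree (insert n (V1 \<union> V2)) E'"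
    using oriented_tree_glue[OF T12 TA hA] by (simp only: verts E'_def)
  note aA = oriented_tree_arcs[OF TA]
  have fA: "f1 a \<in> V1 - {h}" if "a \<in> A" for a
    using that leaves1 inj_on_eq_iff[OF inj1, of a s] s fs by auto
  have fB: "f2 b \<in> V2 - {h}" if "b \<in> B" for b
    using that leaves2 inj_on_eq_iff[OF inj2, of b s] s fs by auto
  have deg': "network_degrees (indeg E' v) (outdeg E' v)" if v: "v \<in> insert n (V1 \<union> V2)" for v
  proof -
    consider "v \<in> V1 - {h}" | "v \<in> V2 - {h}" | "v = h" | "v = n" using v by blast
    then show ?thesis
    proof cases
      case 1
      then have "v \<notin> {h, n}" "v \<notin> V2" using n h by auto
      then show ?thesis
        using indeg_glue_other[OF aA, of v "E1 \<union> E2"] outdeg_glue_other[OF aA, of v "E1 \<union> E2"]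
          indeg_glue_other[OF a2, of v E1] outdeg_glue_other[OF a2, of v E1] deg1[of v] 1
        by (simp add: E'_def)
    next
      case 2
      then have "v \<notin> {h, n}" "v \<notin> V1" using n h by auto
      then show ?thesis
        using indeg_glue_other[OF aA, of v "E1 \<union> E2"] outdeg_glue_other[OF aA, of v "E1 \<union> E2"]
          indeg_glue_other[OF a1, of v E2] outdeg_glue_other[OF a1, of v E2] deg2[of v] 2
        by (simp add: E'_def Un_commute)
    next
      case 3
      have "indeg E' h = 2" "outdeg E' h = 1"
        using indeg_Un[OF _ _ oriented_tree_disjoint[OF T12 TA hA], of h] indeg_Un[OF _ _ oriented_tree_disjoint[OF T1 T2 h], of h]
          outdeg_Un[OF _ _ oriented_tree_disjoint[OF T12 TA hA], of h] outdeg_Un[OF _ _ oriented_tree_disjoint[OF T1 T2 h], of h]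
          h1(3,4) h2(3,4) hn oriented_tree_finite_arcs[OF T1] oriented_tree_finite_arcs[OF T2]
        unfolding E'_def by (simp_all add: indeg_arc outdeg_arc)
      then show ?thesis using 3 by (simp add: network_degrees_def)
    next
      case 4
      have "indeg E' n = 1" "outdeg E' n = 0"
        using indeg_glue_other[OF oriented_tree_arcs[OF T12] n, of "{(h, n)}"]
          outdeg_glue_other[OF oriented_tree_arcs[OF T12] n, of "{(h, n)}"] hn
        unfolding E'_def by (simp_all add: indeg_arc outdeg_arc Un_commute)
      then show ?thesis using 4 by (simp add: network_degrees_def)
    qed
  qed
  have labA: "lca_label E' t' odot (f1 a) z = \<delta> a w"
    if a: "a \<in> A" and w: "w \<in> insert s A" "a \<noteq> w" and z: "lca_of E' (f1 a) z = lca_of E1 (f1 a) (f1 w)" for a w z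
  proof -
    have V: "f1 a \<in> V1" "f1 w \<in> V1" using fA[OF a] w leaves1 by auto
    have "lca_label E' t' odot (f1 a) z = lca_label E1 t1 odot (f1 a) (f1 w)"
    proof (rule lca_label_cong[OF z _ T1 V])
      show "t' v = t1 v" if v: "lca_of E1 (f1 a) (f1 w) v" for v
        using lca_of_ne_sink[OF v _ h1(2)] lca_of_in_verts[OF T1 V(1) v] fA[OF a] by (simp add: t'_def)
    qed
    then show ?thesis using lab1[of a w] a w by simp
  qed
  have labB: "lca_label E' t' odot (f2 b) z = \<delta> b w"
    if b: "b \<in> B" and w: "w \<in> insert s B" "b \<noteq> w" and z: "lca_of E' (f2 b) z = lca_of E2 (f2 b) (f2 w)" for b w z
  proof -
    have V: "f2 b \<in> V2" "f2 w \<in> V2" using fB[OF b] w leaves2 by auto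
    have "lca_label E' t' odot (f2 b) z = lca_label E2 t2 odot (f2 b) (f2 w)"
    proof (rule lca_label_cong[OF z _ T2 V])
      fix v assume v: "lca_of E2 (f2 b) (f2 w) v"
      have "v \<noteq> h" "v \<in> V2" using lca_of_ne_sink[OF v _ h2(2)] lca_of_in_verts[OF T2 V(1) v] fB[OF b] by auto
      then show "t' v = t2 v" using h by (auto simp: t'_def)
    qed
    then show ?thesis using lab2[of b w] b w by simp
  qed
  have in11: "lca_of (E1 \<union> E2) x y = lca_of E1 x y" if "x \<in> V1 - {h}" "y \<in> V1" for x y
    by (rule lca_of_glue_11[OF T1 T2 h h1(2) that])
  have in22: "lca_of (E1 \<union> E2) x y = lca_of E2 x y" if "x \<in> V2 - {h}" "y \<in> V2" for x y
    using lca_of_glue_11[OF T2 T1 h' h2(2) that] by (simp add: Un_commute)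
  have out11: "lca_of E' x y = lca_of (E1 \<union> E2) x y" if "x \<in> V1 \<union> V2 - {h}" "y \<in> V1 \<union> V2" for x y
    unfolding E'_def by (rule lca_of_glue_11[OF T12 TA hA sink that])
  have outn: "lca_of E' x n = lca_of (E1 \<union> E2) x h" if "x \<in> V1 \<union> V2 - {h}" for x
    unfolding E'_def by (rule lca_of_glue_12[OF T12 TA hA sink that]) auto
  have leafA: "lca_label E' t' odot (f1 a) n = \<delta> a s" if "a \<in> A" for a
    using fA[OF that] that s h1 by (intro labA) (auto simp: outn in11 fs)
  have leafB: "lca_label E' t' odot (f2 b) n = \<delta> b s" if "b \<in> B" for b
    using fB[OF that] that s h2 by (intro labB) (auto simp: outn in22 fs)
  have cross': "lca_label E' t' odot (f1 a) (f2 b) = odot" if "a \<in> A" "b \<in> B" for a b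
  proof -
    have "(h, f2 b) \<notin> E2\<^sup>*" using fB[OF that(2)] h2(2) by (auto elim: converse_rtranclE)
    then have "\<not> lca_of (E1 \<union> E2) (f1 a) (f2 b) v" for v
      using lca_of_glue_none[OF T1 T2 h h1(2)] fA[OF that(1)] fB[OF that(2)] by blast
    then show ?thesis using out11[of "f1 a" "f2 b"] fA[OF that(1)] fB[OF that(2)] by (simp add: lca_label_def)
  qed
  have f': "f' s = n" "\<And>a. a \<in> A \<Longrightarrow> f' a = f1 a" "\<And>b. b \<in> B \<Longrightarrow> f' b = f2 b"
    using s by (auto simp: f'_def)
  have half: "lca_label E' t' odot (f' u) (f' v) = \<delta> u v"
    if uv: "u \<in> A \<and> v \<in> insert s (A \<union> B) \<or> u \<in> B \<and> v \<in> insert s B" "u \<noteq> v" for u v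
  proof -
    consider "u \<in> A" "v \<in> A" | "u \<in> A" "v = s" | "u \<in> A" "v \<in> B" | "u \<in> B" "v \<in> B" | "u \<in> B" "v = s"
      using uv by blast
    then show ?thesis
    proof cases
      case 1
      then show ?thesis using fA[of u] fA[of v] uv(2) by (auto simp: f' out11 in11 intro!: labA)
    next
      case 4
      then show ?thesis using fB[of u] fB[of v] uv(2) by (auto simp: f' out11 in22 intro!: labB)
    qed (auto simp: f' leafA leafB cross' cross)
  qed
  have lab': "lca_label E' t' odot (f' u) (f' v) = \<delta> u v"
    if uv: "u \<in> insert s (A \<union> B)" "v \<in> insert s (A \<union> B)" "u \<noteq> v" for u v
  proof (cases "u \<in> A \<or> u \<in> B \<and> v \<notin> A")
    case True
    then show ?thesis using half uv by blast
  next
    case False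
    then have "lca_label E' t' odot (f' v) (f' u) = \<delta> v u" using uv by (intro half) auto
    then show ?thesis using sym[OF uv(1,2)] by (simp add: lca_label_commute[of E' t' odot "f' u"])
  qed
  have inj': "inj_on f' (insert s (A \<union> B))"
  proof -
    have img: "f' ` A = f1 ` A" "f' ` B = f2 ` B" using f' by auto
    have "inj_on f' A" using inj1 f'(2) inj_on_cong[of A f' f1] by (simp add: inj_on_insert)
    moreover have "inj_on f' B" using inj2 f'(3) inj_on_cong[of B f' f2] by (simp add: inj_on_insert)
    moreover have "f' ` A \<inter> f' ` B = {}" "n \<notin> f' ` (A \<union> B)"
    proof -
      have A: "f' ` A \<subseteq> V1 - {h}" unfolding img using fA by auto
      have B: "f' ` B \<subseteq> V2 - {h}" unfolding img using fB by auto
      show "f' ` A \<inter> f' ` B = {}" using A B h by auto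
      show "n \<notin> f' ` (A \<union> B)" unfolding image_Un using A B n by auto
    qed
    ultimately show ?thesis using f'(1) by (auto simp: inj_on_insert inj_on_Un)
  qed
  have leaves': "f' ` insert s (A \<union> B) = insert n (V1 \<union> V2) - Domain E'"
  proof -
    have "f' ` A = f1 ` A" "f' ` B = f2 ` B" using f' by auto
    then have "f' ` insert s (A \<union> B) = insert n (f1 ` A \<union> f2 ` B)" by (simp add: image_Un f'(1))
    also have "f1 ` A = V1 - Domain E1 - {h}" using leaves1 fA fs by auto
    also have "f2 ` B = V2 - Domain E2 - {h}" using leaves2 fB fs by auto
    also have "insert n ((V1 - Domain E1 - {h}) \<union> (V2 - Domain E2 - {h})) = insert n (V1 \<union> V2) - Domain E'"
      using a1 a2 n h hn by (auto simp: E'_def)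
    finally show ?thesis .
  qed
  have tM': "t' ` Domain E' \<subseteq> M"
  proof -
    have "t1 v \<in> M" if "(v, c) \<in> E1" for v c using tM1 that by auto
    moreover have "t2 v \<in> M" if "(v, c) \<in> E2" for v c using tM2 that by auto
    ultimately show ?thesis using m a1 a2 h by (auto simp: t'_def E'_def)
  qed
  have "network_rep M odot (insert s (A \<union> B)) \<delta> (insert n (V1 \<union> V2)) E' f' t'"
    unfolding network_rep_def
    by (intro conjI ballI impI T' deg' inj' leaves' tM' lab')
  then show ?thesis by (simp only: f'_def[abs_def] t'_def[abs_def] E'_def)
qed

lemma arboreal_map_network_rep:
  assumes "finite X" "card X \<ge> 2" "arboreal_map X odot \<delta>"
    and "\<And>x y. \<lbrakk>x \<in> X; y \<in> X\<rbrakk> \<Longrightarrow> \<delta> x y \<in> M \<union> {odot}"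
  shows "\<exists>(V :: nat set) E f t. network_rep M odot X \<delta> V E f t"
  using assms
proof (induction "card X" arbitrary: X rule: less_induct)
  case less
  interpret arboreal_map X odot \<delta> by (rule less.prems(3))
  note fin = less.prems(1)
  have M: "\<delta> x y \<in> M" if "x \<in> X" "y \<in> X" "\<delta> x y \<noteq> odot" for x y using less.prems(4) that by blast
  from twins_or_cut_vertex[OF less.prems(1,2)] show ?case
  proof
    assume "\<exists>x\<in>X. \<exists>y\<in>X. x \<noteq> y \<and> \<delta> x y \<noteq> odot \<and> (\<forall>z\<in>X - {x, y}. \<delta> x z = \<delta> y z)"
    then obtain x y where x: "x \<in> X" "y \<in> X" "x \<noteq> y" "\<delta> x y \<noteq> odot"
      and twin: "\<And>z. z \<in> X - {x, y} \<Longrightarrow> \<delta> x z = \<delta> y z" by blast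
    show ?thesis
    proof (cases "X = {x, y}")
      case True
      have "distinct [0, 1, 2 :: nat]" by simp
      from network_rep_cherry[OF this x(3) M[OF x(1,2,4)] sym[OF x(2,1)], of odot]
      show ?thesis unfolding True by blast
    next
      case False
      have "arboreal_map (X - {y}) odot \<delta>"
      proof (rule retract[where \<phi> = "\<lambda>v. if v = y then x else v"])
        fix u v assume uv: "u \<in> X" "v \<in> X" "\<delta> u v \<noteq> odot"
        then show "\<delta> (if u = y then x else u) (if v = y then x else v) \<noteq> odot"
          using x diag[of x] twin[of u] twin[of v] sym[of u x] sym[of u y]
          by (cases "u = x"; cases "v = x") auto
      qed (use x in auto)
      moreover have "card {x, y} < card X" using False x fin by (intro psubset_card_mono) auto
      then have "card (X - {y}) \<ge> 2" using x fin by simp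
      moreover have "card (X - {y}) < card X" by (rule card_Diff1_less[OF fin x(2)])
      ultimately have "\<exists>(V :: nat set) E f t. network_rep M odot (X - {y}) \<delta> V E f t"
        using fin less.prems(4) by (intro less.hyps) auto
      then obtain V :: "nat set" and E f t where N: "network_rep M odot (X - {y}) \<delta> V E f t"
        by blast
      have "finite V" using N by (auto simp: network_rep_def oriented_tree_def)
      then obtain n1 where n1: "n1 \<notin> V" using ex_new_if_finite infinite_UNIV_nat by blast
      obtain n2 where n2: "n2 \<notin> insert n1 V"
        using ex_new_if_finite[of "insert n1 V"] \<open>finite V\<close> infinite_UNIV_nat by blast
      have "network_rep M odot X \<delta> (insert n1 (insert n2 V)) (E \<union> {(f x, n1), (f x, n2)})
          (f(x := n1, y := n2)) (t(f x := \<delta> x y))"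
        by (rule network_rep_twin[OF N x(1-3) M[OF x(1,2,4)] sym twin]) (use n1 n2 in auto)
      then show ?thesis by blast
    qed
  next
    assume "\<exists>s\<in>X. \<exists>A B. A \<noteq> {} \<and> B \<noteq> {} \<and> A \<inter> B = {} \<and> A \<union> B = X - {s} \<and> (\<forall>a\<in>A. \<forall>b\<in>B. \<delta> a b = odot)"
    then obtain s A B where s: "s \<in> X" and AB: "A \<noteq> {}" "B \<noteq> {}" "A \<inter> B = {}" "A \<union> B = X - {s}"
      and "\<forall>a\<in>A. \<forall>b\<in>B. \<delta> a b = odot" by (elim bexE exE conjE)
    then have cross: "\<delta> a b = odot" if "a \<in> A" "b \<in> B" for a b using that by simp
    have part: "\<exists>(V :: nat set) E f t. network_rep M odot (insert s C) \<delta> V E f t"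
      if C: "C \<noteq> {}" "D \<noteq> {}" "C \<inter> D = {}" "C \<union> D = X - {s}" and CD: "\<And>c d. \<lbrakk>c \<in> C; d \<in> D\<rbrakk> \<Longrightarrow> \<delta> c d = odot" for C D
    proof (rule less.hyps)
      have sub: "insert s C \<subseteq> X" using C s by auto
      then show fC: "finite (insert s C)" using fin by (rule finite_subset)
      obtain x where "x \<in> D" using C(2) by auto
      then have "x \<in> X" "x \<notin> insert s C" using C(3,4) by auto
      then have "insert s C \<subset> X" using sub by auto
      then show "card (insert s C) < card X" using fin by (rule psubset_card_mono[rotated])
      have "s \<notin> C" using C(4) by auto
      then show "card (insert s C) \<ge> 2" using fC C(1) by (simp add: Suc_le_eq card_gt_0_iff)
      show "arboreal_map (insert s C) odot \<delta>"
      proof (rule retract[where \<phi> = "\<lambda>v. if v \<in> C then v else s"])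
        fix u v assume uv: "u \<in> X" "v \<in> X" "\<delta> u v \<noteq> odot"
        have "u \<in> C \<or> u \<in> D \<or> u = s" "v \<in> C \<or> v \<in> D \<or> v = s" using C(4) uv by auto
        then show "\<delta> (if u \<in> C then u else s) (if v \<in> C then v else s) \<noteq> odot"
          using uv CD[of u v] CD[of v u] sym[of u v] diag[OF s] by auto
      qed (use C s in auto)
      show "\<delta> x y \<in> M \<union> {odot}" if "x \<in> insert s C" "y \<in> insert s C" for x y
        using less.prems(4) that sub by blast
    qed
    obtain V1 :: "nat set" and E1 f1 t1 where N1: "network_rep M odot (insert s A) \<delta> V1 E1 f1 t1"
      using part[OF AB cross] by blast
    have "\<exists>(V :: nat set) E f t. network_rep M odot (insert s B) \<delta> V E f t"
    proof (rule part[OF AB(2,1)])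
      show "\<delta> c d = odot" if "c \<in> B" "d \<in> A" for c d
        using cross[OF that(2,1)] sym[of c d] that AB(4) by auto
    qed (use AB in auto)
    then obtain V2 :: "nat set" and E2 f2 t2 where N2: "network_rep M odot (insert s B) \<delta> V2 E2 f2 t2"
      by blast
    have fin1: "finite V1" using N1 by (auto simp: network_rep_def oriented_tree_def)
    then obtain K where K: "\<And>v. v \<in> V1 \<Longrightarrow> v < K" by (metis finite_nat_set_iff_bounded)
    define g where "g v = (if v = f2 s then f1 s else v + K)" for v
    have s1: "f1 s \<in> V1" and s2: "f2 s \<in> V2"
      using network_rep_leaf(1)[OF N1 insertI1] network_rep_leaf(1)[OF N2 insertI1] by auto
    have "inj_on g V2"
      using K[OF s1] by (auto simp: g_def inj_on_def split: if_splits)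
    note N2' = network_rep_transport[OF N2 this]
    have "V1 \<inter> g ` V2 = {f1 s}" using s1 s2 K by (fastforce simp: g_def)
    moreover have fin2: "finite (g ` V2)" using N2' by (auto simp: network_rep_def oriented_tree_def)
    obtain n where n: "n \<notin> V1 \<union> g ` V2"
      using ex_new_if_finite[of "V1 \<union> g ` V2"] fin1 fin2 infinite_UNIV_nat by blast
    obtain m where m: "m \<in> M"
    proof -
      have "t1 ` Domain E1 \<subseteq> M" "oriented_tree V1 E1" using N1 by (auto simp: network_rep_def)
      moreover have "indeg E1 (f1 s) = 1" by (rule network_rep_leaf(4)[OF N1 insertI1])
      then have "E1 \<noteq> {}" by (auto simp: indeg_def)
      ultimately show ?thesis using that by fastforce
    qed
    have X: "insert s (A \<union> B) = X" using s AB(4) by auto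
    have "s \<notin> A" "s \<notin> B" using AB(4) by auto
    from network_rep_cut[OF N1 N2' this AB(3) refl _ calculation n m sym[folded X] cross]
    show ?thesis unfolding X by (fastforce simp: g_def)
  qed
qed

lemma arboreal_map_imp_symbolic_arboreal_map:
  assumes "finite X" "card X \<ge> 2" "odot \<notin> M" "m \<in> M" "d \<in> nsets X 2 \<rightarrow> M \<union> {odot}"
    and A: "arboreal_map X odot (\<lambda>x y. if x = y then m else d {x, y})"
  shows "symbolic_arboreal_map X M odot d"
proof -
  have "(if x = y then m else d {x, y}) \<in> M \<union> {odot}" if "x \<in> X" "y \<in> X" for x y
    using assms(4,5) that by (auto simp: Pi_iff)
  then obtain V :: "nat set" and E f t
    where N: "network_rep M odot X (\<lambda>x y. if x = y then m else d {x, y}) V E f t"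
    using arboreal_map_network_rep[OF assms(1,2) A, of M] by blast
  let ?N = "\<lparr>pverts = V, parcs = E\<rparr>"
  have T: "oriented_tree (pverts ?N) (parcs ?N)" using N by (simp add: network_rep_def)
  have fin: "finite E" using oriented_tree_finite_arcs[OF T] by simp
  have fV: "f x \<in> V" if "x \<in> X" for x using network_rep_leaf(1)[OF N that] .
  show ?thesis
  proof (rule symbolic_arboreal_mapI[of f X ?N t])
    show "inj_on f X" using N by (simp add: network_rep_def)
    have "arboreal_network ?N (f ` X)"
      using N outdeg_eq_0_iff[OF fin] by (auto simp: arboreal_network_iff network_rep_def)
    moreover have "t v \<in> M" if "v \<in> V" "out_degree (with_proj ?N) v \<ge> 2" for v
    proof -
      have "outdeg E v \<noteq> 0" using that by (simp add: out_degree_def out_arcs_def outdeg_def)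
      then have "v \<in> Domain E" using outdeg_eq_0_iff[OF fin, of v] by simp
      then show ?thesis using network_repD(5)[OF N] by blast
    qed
    ultimately show "labelled_arboreal_network ?N t (f ` X) M"
      by (simp add: labelled_arboreal_network_def)
    fix x y assume xy: "x \<in> X" "y \<in> X" "x \<noteq> y"
    show "d {x, y} = induced_map odot ?N t (f x) (f y)"
      using N xy fV induced_map_eq[OF T, of "f x" "f y" odot t] by (simp add: network_rep_def)
    assume "share_ancestor ?N (f x) (f y)"
    then obtain v where v: "lca_of E (f x) (f y) v" using share_ancestor_iff[OF T] fV xy by auto
    then show "\<exists>!v. is_lca ?N (f x) (f y) v"
      using is_lca_iff[OF T, of "f x" "f y"] fV xy lca_of_unique[OF T, of "f x" "f y"] by auto
  qed
qed

theorem theorem7p5: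
  fixes X :: "'a set" and M :: "'m set" and odot :: 'm and d :: "'a set \<Rightarrow> 'm"
  assumes "finite X" and "card X \<ge> 2"
    and "M \<noteq> {}" and "odot \<notin> M"
    and "d \<in> nsets X 2 \<rightarrow> M \<union> {odot}"
  shows "symbolic_arboreal_map X M odot d \<longleftrightarrow>
    (Digraph_Component.connected (symbolic_graph X odot d) \<and> ptolemaic (symbolic_graph X odot d)) \<and>
    (\<not> (\<exists>x\<in>X. \<exists>y\<in>X. \<exists>z\<in>X. Delta_relation odot d x y z)) \<and>
    (\<not> (\<exists>x\<in>X. \<exists>y\<in>X. \<exists>z\<in>X. \<exists>u\<in>X. Pi_relation odot d x y z u)) \<and>
    (\<forall>x\<in>X. \<forall>y\<in>X. \<forall>z\<in>X. \<forall>u\<in>X.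
       distinct [x, y, z, u] \<and> d {z, u} = odot \<and>
       (\<forall>e \<in> nsets {x, y, z, u} 2 - {{z, u}}. d e \<in> M)
       \<longrightarrow> d {x, z} = d {y, z} \<and> d {x, u} = d {y, u})"
proof -
  obtain m where m: "m \<in> M" using assms(3) by blast
  have "X \<noteq> {}" using assms(2) by auto
  then show ?thesis
    unfolding arboreal_map_iff[OF \<open>X \<noteq> {}\<close> assms(4) m assms(5), symmetric]
    using symbolic_arboreal_map_imp_arboreal_map[OF _ assms(4) m]
      arboreal_map_imp_symbolic_arboreal_map[OF assms(1,2,4) m assms(5)] by blast
qed

end
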